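(* Let $\alpha_0$ be a real number which is quadratic irrational over $\mathbb{Q}$. Let $G$ be a finite index subgroup of the modular group $\Gamma=\operatorname{PSL}_2(\mathbb{Z})$, acting by homographies on $\mathbb{R}\cup\{\infty\}$. Then, as $s\to+\infty$, $$\operatorname{Card}\{\alpha\in G\cdot\{\alpha_0,\alpha_0^\sigma\}\ \operatorname{mod}\ q_G\;:\;h(\alpha)\leq s\}\;\sim\;\frac{12\;q_G\;\log\Big(\frac{|\operatorname{tr}\gamma_0|+\sqrt{\operatorname{tr}^2\gamma_0-4}}{2}\Big)}{\pi^2\;[\Gamma:G]\;n_0}\;s ,$$ where $q_G$ is the smallest positive integer $q$ such that the homography $z\mapsto z+q$ belongs to $G$; $\gamma_0$ is a nontrivial element of $G$ fixing $\alpha_0$; and $n_0$ is the index of $\gamma_0^{\mathbb{Z}}$ in the stabilizer of $\{\alpha_0,\alpha_0^\sigma\}$ in $G$.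
   Context: For a real quadratic irrational $\alpha$ over $\mathbb{Q}$, $\alpha^\sigma$ is its Galois conjugate over $\mathbb{Q}$ and $h(\alpha)=\frac{2}{|\alpha-\alpha^\sigma|}$. "mod $q_G$" means that elements of the orbit are counted modulo translations by elements of $q_G\mathbb{Z}$. $\operatorname{tr}\gamma_0$ is the trace of a representative of $\gamma_0$ in $\operatorname{SL}_2(\mathbb{Z})$, well defined up to sign. $\gamma_0^{\mathbb{Z}}$ is the cyclic group generated by $\gamma_0$. *)

theory Defs
  imports
    "HOL-Analysis.Analysis"
    "HOL-Algebra.Coset"
    "HOL-Algebra.Generated_Groups"
    "HOL-Algebra.Group_Action"
    "HOL-Computational_Algebra.Polynomial"
    "HOL-Library.Landau_Symbols"
begin

definition quadratic_irrational :: "real \<Rightarrow> bool" where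
  "quadratic_irrational \<alpha> \<longleftrightarrow>
     \<alpha> \<notin> \<rat> \<and> (\<exists>p :: rat poly. degree p = 2 \<and> poly (map_poly of_rat p) \<alpha> = 0)"

text \<open>A degree 2 rational polynomial vanishing at an irrational number is its minimal polynomial
  up to a scalar, so the Galois conjugate is the other root; it is meaningful only for quadratic
  irrationals.\<close>

definition galois_conj :: "real \<Rightarrow> real" where
  "galois_conj \<alpha> = (THE \<beta>. \<beta> \<noteq> \<alpha> \<and>
     (\<exists>p :: rat poly. degree p = 2 \<and>
        poly (map_poly of_rat p) \<alpha> = 0 \<and> poly (map_poly of_rat p) \<beta> = 0))"

definition height :: "real \<Rightarrow> real" where
  "height \<alpha> = 2 / \<bar>\<alpha> - galois_conj \<alpha>\<bar>"

type_synonym mat2 = "int ^ 2 ^ 2"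

definition SL2Z :: "mat2 monoid" where
  "SL2Z = \<lparr>carrier = {A. det A = 1}, mult = (**), one = mat 1\<rparr>"

text \<open>An element of the modular group is a set of the form \<open>{A, - A}\<close>.\<close>

definition PSL2Z :: "mat2 set monoid" where
  "PSL2Z = SL2Z Mod {mat 1, - mat 1}"

text \<open>The real projective line is \<^typ>\<open>real option\<close>, with \<^term>\<open>None\<close> as the point at infinity.\<close>

fun homography :: "mat2 \<Rightarrow> real option \<Rightarrow> real option" where
  "homography A None =
     (if A$2$1 = 0 then None else Some (of_int (A$1$1) / of_int (A$2$1)))"
| "homography A (Some x) =
     (if of_int (A$2$1) * x + of_int (A$2$2) = 0 then None
      else Some ((of_int (A$1$1) * x + of_int (A$1$2)) / (of_int (A$2$1) * x + of_int (A$2$2))))"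

text \<open>Both representatives of an element of the modular group define the same homography, see
  \<open>psl_act_eq_homography\<close> below.\<close>

definition psl_act :: "mat2 set \<Rightarrow> real option \<Rightarrow> real option" where
  "psl_act g z = the_elem ((\<lambda>A. homography A z) ` g)"

definition translation :: "int \<Rightarrow> mat2 set" where
  "translation q = {mat 1, - mat 1} #>\<^bsub>SL2Z\<^esub> vector [vector [1, q], vector [0, 1]]"

definition subgroup_index :: "('a, 'b) monoid_scheme \<Rightarrow> 'a set \<Rightarrow> nat" where
  "subgroup_index K H = card (rcosets\<^bsub>K\<^esub> H)"

definition cusp_width :: "mat2 set set \<Rightarrow> nat" where
  "cusp_width G = (LEAST q. 0 < q \<and> translation (int q) \<in> G)"

definition pair_orbit :: "mat2 set set \<Rightarrow> real \<Rightarrow> real set" where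
  "pair_orbit G \<alpha> =
     {\<beta>. Some \<beta> \<in> (\<Union>z \<in> {Some \<alpha>, Some (galois_conj \<alpha>)}. orbit (PSL2Z\<lparr>carrier := G\<rparr>) psl_act z)}"

text \<open>The setwise stabilizer: elements may exchange the two points.\<close>

definition pair_stabilizer :: "mat2 set set \<Rightarrow> real \<Rightarrow> mat2 set set" where
  "pair_stabilizer G \<alpha> =
     stabilizer (PSL2Z\<lparr>carrier := G\<rparr>) (\<lambda>g. (`) (psl_act g)) {Some \<alpha>, Some (galois_conj \<alpha>)}"

definition translation_rel :: "nat \<Rightarrow> (real \<times> real) set" where
  "translation_rel q = {(x, y). \<exists>k :: int. y = x + of_int k * of_nat q}"

definition orbit_count :: "mat2 set set \<Rightarrow> real \<Rightarrow> real \<Rightarrow> nat" where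
  "orbit_count G \<alpha> s =
     card ({\<beta> \<in> pair_orbit G \<alpha>. height \<beta> \<le> s} // translation_rel (cusp_width G))"

lemma mat2_eq_iff: "(A :: 'a ^ 2 ^ 2) = B \<longleftrightarrow>
    A$1$1 = B$1$1 \<and> A$1$2 = B$1$2 \<and> A$2$1 = B$2$1 \<and> A$2$2 = B$2$2"
  by (auto simp: vec_eq_iff forall_2)

lemma group_SL2Z: "group SL2Z"
proof (rule groupI)
  fix A assume "A \<in> carrier SL2Z"
  then have d: "det A = 1" by (simp add: SL2Z_def)
  let ?B = "vector [vector [A$2$2, - A$1$2], vector [- A$2$1, A$1$1]] :: mat2"
  have "det ?B = 1" "?B ** A = mat 1"
    using d by (auto simp: det_2 mat2_eq_iff matrix_matrix_mult_def sum_2 mat_def algebra_simps)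
  then show "\<exists>B\<in>carrier SL2Z. B \<otimes>\<^bsub>SL2Z\<^esub> A = \<one>\<^bsub>SL2Z\<^esub>" by (auto simp: SL2Z_def)
qed (auto simp: SL2Z_def det_mul matrix_mul_assoc)

lemma uminus_mult:
  fixes A B :: mat2
  shows "(- A) ** B = - (A ** B)" "A ** (- B) = - (A ** B)"
  by (auto simp: mat2_eq_iff matrix_matrix_mult_def sum_2)

lemma normal_pm1: "{mat 1, - mat 1} \<lhd> SL2Z"
proof -
  interpret group SL2Z by (rule group_SL2Z)
  have d: "det (- mat 1 :: mat2) = 1" by (simp add: det_2 mat_def)
  have "subgroup {mat 1, - mat 1} SL2Z"
  proof (rule subgroupI)
    fix A assume A: "A \<in> {mat 1, - mat 1 :: mat2}"
    have "inv\<^bsub>SL2Z\<^esub> A = A"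
      by (rule inv_equality) (use A d in \<open>auto simp: SL2Z_def uminus_mult\<close>)
    with A show "inv\<^bsub>SL2Z\<^esub> A \<in> {mat 1, - mat 1}" by simp
  qed (use d in \<open>auto simp: SL2Z_def uminus_mult\<close>)
  then show ?thesis
    by (rule normalI) (auto simp: r_coset_def l_coset_def SL2Z_def uminus_mult)
qed

lemma group_PSL2Z: "group PSL2Z"
  unfolding PSL2Z_def by (rule normal.factorgroup_is_group[OF normal_pm1])

lemma carrier_PSL2Z: "carrier PSL2Z = (\<lambda>A. {A, - A}) ` {A. det A = 1}"
  by (auto simp: PSL2Z_def carrier_FactGroup r_coset_def SL2Z_def uminus_mult)

lemma translation_eq:
  "translation q = (let T = vector [vector [1, q], vector [0, 1]] in {T, - T})"
  by (auto simp: translation_def r_coset_def SL2Z_def uminus_mult Let_def)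

lemma homography_uminus: "homography (- A) z = homography A z"
proof (cases z)
  case (Some x)
  have *: "of_int ((- A)$i$1) * x + of_int ((- A)$i$2) = - (of_int (A$i$1) * x + of_int (A$i$2))" for i
    by simp
  show ?thesis unfolding Some homography.simps * by (simp only: neg_equal_0_iff_equal minus_divide_divide)
qed simp

lemma psl_act_eq_homography:
  assumes "g \<in> carrier PSL2Z" "A \<in> g"
  shows "psl_act g z = homography A z"
proof -
  from assms have "g = {A, - A}" by (auto simp: carrier_PSL2Z)
  then show ?thesis by (simp add: psl_act_def homography_uminus)
qed

lemma galois_conj_eq:
  assumes irr: "\<alpha> \<notin> \<rat>" and a: "a \<noteq> 0"
    and root: "of_rat a * \<alpha>\<^sup>2 + of_rat b * \<alpha> + of_rat c = 0"
  shows "galois_conj \<alpha> = - of_rat (b / a) - \<alpha>"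
proof -
  have ev: "poly (map_poly of_rat p) x =
      of_rat (coeff p 2) * x\<^sup>2 + of_rat (coeff p 1) * x + of_rat (coeff p 0)"
    if "degree p = 2" for p :: "rat poly" and x :: real
  proof -
    have "degree (map_poly of_rat p :: real poly) = 2" using that by (simp add: degree_map_poly)
    then show ?thesis
      by (simp add: poly_altdef coeff_map_poly numeral_2_eq_2 add.commute add.left_commute)
  qed
  have nz: "of_rat u * \<alpha> + of_rat v = 0 \<Longrightarrow> u = 0" for u v :: rat
  proof (rule ccontr)
    assume h: "of_rat u * \<alpha> + of_rat v = 0" and u: "u \<noteq> 0"
    then have "\<alpha> = of_rat (- v / u)"
      by (simp add: of_rat_divide of_rat_minus field_simps eq_neg_iff_add_eq_0)
    with irr show False by simp
  qed
  let ?\<beta> = "- of_rat (b / a) - \<alpha>"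
  show ?thesis unfolding galois_conj_def
  proof (rule the_equality, safe)
    assume "?\<beta> = \<alpha>"
    then have "of_rat 2 * \<alpha> + of_rat (b / a) = 0" by simp
    from nz[OF this] show False by simp
  next
    let ?p = "[:c, b, a:]"
    have d: "degree ?p = 2" using a by simp
    have "of_rat a * ?\<beta>\<^sup>2 + of_rat b * ?\<beta> + of_rat c = of_rat a * \<alpha>\<^sup>2 + of_rat b * \<alpha> + of_rat c"
      using a by (simp add: of_rat_divide field_simps power2_eq_square)
    then show "\<exists>p. degree p = 2 \<and> poly (map_poly of_rat p) \<alpha> = 0 \<and> poly (map_poly of_rat p) ?\<beta> = 0"
      using root d by (intro exI[of _ ?p]) (simp add: ev numeral_2_eq_2 del: map_poly_pCons)
  next
    fix \<beta> and p :: "rat poly"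
    assume ne: "\<beta> \<noteq> \<alpha>" and p: "degree p = 2"
      and 1: "poly (map_poly of_rat p) \<alpha> = 0" and 2: "poly (map_poly of_rat p) \<beta> = 0"
    define a' b' c' where "a' = coeff p 2" and "b' = coeff p 1" and "c' = coeff p 0"
    have a': "a' \<noteq> 0" using p unfolding a'_def by (metis leading_coeff_0_iff degree_0 zero_neq_numeral)
    have e1: "of_rat a' * \<alpha>\<^sup>2 + of_rat b' * \<alpha> + of_rat c' = 0"
      and e2: "of_rat a' * \<beta>\<^sup>2 + of_rat b' * \<beta> + of_rat c' = 0"
      using 1 2 ev[OF p] by (simp_all add: a'_def b'_def c'_def)
    have "(\<beta> - \<alpha>) * (of_rat a' * (\<alpha> + \<beta>) + of_rat b') = 0"
      using e1 e2 by algebra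
    with ne have s: "of_rat a' * (\<alpha> + \<beta>) + of_rat b' = 0" by simp
    have "of_rat (a * b' - a' * b) * \<alpha> + of_rat (a * c' - a' * c) = 0"
      using e1 root unfolding of_rat_diff of_rat_mult by algebra
    from nz[OF this] have "b' / a' = b / a" using a a' by (simp add: field_simps)
    moreover have "\<beta> = - of_rat (b' / a') - \<alpha>"
      using s a' by (simp add: of_rat_divide field_simps)
    ultimately show "\<beta> = ?\<beta>" by simp
  qed
qed

end

theory Submission
  imports Defs "HOL-Combinatorics.Cycles" "HOL-Real_Asymp.Real_Asymp"
begin

text \<open>
  Put \<open>N(x, y) = (x - \<alpha> y) (x - \<alpha>' y)\<close> for \<open>\<alpha> = \<alpha>\<^sub>0\<close> and its conjugate \<open>\<alpha>'\<close>. The point \<open>g \<alpha>\<close>, taken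
  modulo the translations in \<open>G\<close>, is determined by the vector \<open>v = g\<^sup>-\<^sup>1 e\<^sub>1\<close> up to the stabilizer of \<open>\<alpha>\<close>,
  and its height is \<open>2 \<bar>N(v)\<bar> / \<bar>\<alpha> - \<alpha>'\<bar>\<close>. So one counts the vectors of the orbit \<open>G e\<^sub>1\<close> in two sectors
  that form a fundamental domain of \<open>\<gamma>\<^sub>0\<close>, subject to a bound for \<open>\<bar>N\<bar>\<close>.

  In the coordinates of a unimodular cone, \<open>G e\<^sub>1\<close> is one of finitely many subsets of the integral
  plane, one for each coset of \<open>G\<close>. The normalized number \<open>f\<close> of its points in the triangle
  \<open>s a + t b \<le> 1\<close> is, up to an error \<open>O(a b)\<close>, harmonic for the random walk that moves \<open>(a, b)\<close> to
  \<open>(a, a + b)\<close> or \<open>(a + b, b)\<close> and changes the coset accordingly. A maximum principle shows that \<open>f\<close>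
  converges to a constant as \<open>a\<close> and \<open>b\<close> tend to zero: two states of comparable size, at one of which \<open>f\<close> is
  nearly maximal and at the other nearly minimal, can be led by short paths to almost the same
  state. Hence all cosets have the same limit, and it is found by summing over them and
  comparing with the density \<open>6 / \<pi>\<^sup>2\<close> of the primitive vectors.

  A sector is finally cut into narrow unimodular cones. On a cone with columns \<open>p\<close>, \<open>w\<close> the form \<open>N\<close> is
  close to the square of the linear form with values \<open>\<surd>N(p)\<close>, \<open>\<surd>N(w)\<close>, and the areas of
  the resulting triangles are, up to a common factor, \<open>sinh \<delta>\<close>, where the hyperbolic widths \<open>\<delta>\<close> add up to the
  translation length of \<open>\<gamma>\<^sub>0\<close>.
\<close>

section \<open>Quasi-harmonic functions for the Farey subdivision\<close>

text \<open>A state \<open>(x, a, b)\<close> records a label and the values of a linear form on the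
  two generators of a unimodular cone; cutting the cone at the sum of the generators gives the two
  moves. Their weights \<open>b / (a + b)\<close> and \<open>a / (a + b)\<close> are the areas
  \<open>1 / (2 a (a + b))\<close> and \<open>1 / (2 (a + b) b)\<close> of the subtriangles divided
  by the area \<open>1 / (2 a b)\<close>, so the normalized counts average exactly up to the single
  vector on the cutting ray. The obstacle to a maximum principle is degeneracy: if \<open>a\<close>
  is much smaller than \<open>b\<close>, the move to \<open>(a + b, b)\<close> has tiny weight, and
  a nearly maximal value says nothing about it. Near-extremal values are therefore first moved to
  states with \<open>a\<close> and \<open>b\<close> of the same order, where bounded words preserve
  them. Inverse moves do not occur; both moves permute a finite set of labels, so powers replace
  them. The 12 of the result is the 6 of the density, times two signs of N, times two roots, times
  the 1/2 in the bound for the norm. Pairs of a vector and a root that give the same point modulo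
  translations form one orbit of the pair stabilizer, whence the division by its index.\<close>

locale quasi_harmonic =
  fixes X :: "'a set" and l r :: "'a \<Rightarrow> 'a" and f :: "'a \<Rightarrow> real \<Rightarrow> real \<Rightarrow> real" and E :: real
  assumes l_closed: "x \<in> X \<Longrightarrow> l x \<in> X" and r_closed: "x \<in> X \<Longrightarrow> r x \<in> X"
    and E_nonneg: "0 \<le> E"
    and harmonic: "x \<in> X \<Longrightarrow> 0 < a \<Longrightarrow> 0 < b \<Longrightarrow>
      \<bar>f x a b - (b / (a + b) * f (l x) a (a + b) + a / (a + b) * f (r x) (a + b) b)\<bar> \<le> E * a * b"
begin

lemma quasi_harmonic_swap: "quasi_harmonic X r l (\<lambda>x a b. f x b a) E"
proof
  fix x a b assume "x \<in> X" "0 < (a::real)" "0 < (b::real)"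
  from harmonic[OF this(1,3,2)]
  show "\<bar>f x b a - (b / (a + b) * f (r x) (a + b) a + a / (a + b) * f (l x) b (a + b))\<bar> \<le> E * a * b"
    by (simp add: add.commute mult.commute mult.left_commute)
qed (auto simp: l_closed r_closed E_nonneg)

text \<open>Passing from \<open>f\<close> to its negative turns every statement about the upper
  limit into one about the lower limit.\<close>

lemma quasi_harmonic_uminus: "quasi_harmonic X l r (\<lambda>x a b. - f x a b) E"
proof
  fix x a b assume "x \<in> X" "0 < (a::real)" "0 < (b::real)"
  from harmonic[OF this]
  show "\<bar>- f x a b - (b / (a + b) * - f (l x) a (a + b) + a / (a + b) * - f (r x) (a + b) b)\<bar> \<le> E * a * b"
    by (simp add: abs_le_iff)
qed (auto simp: l_closed r_closed E_nonneg)

section \<open>Leading near-extremal states to coordinates of comparable size\<close>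

lemma upper_bound:
  assumes "x \<in> X" "0 < a" "0 < b"
  shows "f x a b \<le> b / (a + b) * f (l x) a (a + b) + a / (a + b) * f (r x) (a + b) b + E * a * b"
  using harmonic[OF assms] by linarith

lemma larger_child:
  assumes "x \<in> X" "0 < a" "0 < b"
  shows "f x a b - E * a * b \<le> f (l x) a (a + b) \<or> f x a b - E * a * b \<le> f (r x) (a + b) b"
proof (rule ccontr)
  assume *: "\<not> ?thesis"
  define q where "q = b / (a + b)"
  have q: "0 < q" "q < 1" and p: "a / (a + b) = 1 - q" using assms by (auto simp: q_def field_simps)
  let ?c = "f x a b - E * a * b"
  have "q * f (l x) a (a + b) < q * ?c" "(1 - q) * f (r x) (a + b) b < (1 - q) * ?c"
    using * q by auto
  then have "q * f (l x) a (a + b) + (1 - q) * f (r x) (a + b) b < ?c"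
    by (simp add: algebra_simps)
  with upper_bound[OF assms] p show False by (simp add: q_def)
qed

text \<open>Each step raises \<open>(a + b)\<^sup>2\<close> by more than \<open>a b\<close>, so that the errors of a path telescope.\<close>

lemma greedy_path_aux:
  assumes "x \<in> X" "0 < m" "m \<le> a" "m \<le> b" "a \<le> \<mu>" "b \<le> \<mu>" "\<mu> - (a + b) < real n * m"
  shows "\<exists>x'\<in>X. \<exists>a' b'. a \<le> a' \<and> b \<le> b' \<and> a' \<le> \<mu> \<and> b' \<le> \<mu> \<and> \<mu> < a' + b' \<and>
    f x a b - E * ((a' + b')\<^sup>2 - (a + b)\<^sup>2) \<le> f x' a' b'"
  using assms
proof (induction n arbitrary: x a b)
  \<comment> \<open>\<open>n\<close> bounds the number of steps still needed, since each step raises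
    \<open>a + b\<close> by at least \<open>m\<close>.\<close>
  case 0
  then show ?case by (intro bexI[of _ x] exI[of _ a] exI[of _ b]) auto
next
  case (Suc n)
  show ?case
  proof (cases "\<mu> < a + b")
    case True
    then show ?thesis using Suc.prems by (intro bexI[of _ x] exI[of _ a] exI[of _ b]) auto
  next
    case False
    have pos: "0 < a" "0 < b" using Suc.prems by auto
    have E1: "E * a * b \<le> E * ((a + (a + b))\<^sup>2 - (a + b)\<^sup>2)"
      and E2: "E * a * b \<le> E * ((a + b + b)\<^sup>2 - (a + b)\<^sup>2)"
      using pos E_nonneg unfolding mult.assoc
      by (auto intro!: mult_left_mono simp: power2_eq_square algebra_simps)
    from larger_child[OF Suc.prems(1) pos] show ?thesis
    proof
      assume c: "f x a b - E * a * b \<le> f (l x) a (a + b)"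
      obtain x' a' b' where "x' \<in> X" "a \<le> a'" "a + b \<le> b'" "a' \<le> \<mu>" "b' \<le> \<mu>" "\<mu> < a' + b'"
        "f (l x) a (a + b) - E * ((a' + b')\<^sup>2 - (a + (a + b))\<^sup>2) \<le> f x' a' b'"
        using Suc.IH[of "l x" a "a + b"] Suc.prems False l_closed by (auto simp: algebra_simps)
      then show ?thesis using c E1 pos
        by (intro bexI[of _ x'] exI[of _ a'] exI[of _ b']) (auto simp: algebra_simps)
    next
      assume c: "f x a b - E * a * b \<le> f (r x) (a + b) b"
      obtain x' a' b' where "x' \<in> X" "a + b \<le> a'" "b \<le> b'" "a' \<le> \<mu>" "b' \<le> \<mu>" "\<mu> < a' + b'"
        "f (r x) (a + b) b - E * ((a' + b')\<^sup>2 - (a + b + b)\<^sup>2) \<le> f x' a' b'"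
        using Suc.IH[of "r x" "a + b" b] Suc.prems False r_closed by (auto simp: algebra_simps)
      then show ?thesis using c E2 pos
        by (intro bexI[of _ x'] exI[of _ a'] exI[of _ b']) (auto simp: algebra_simps)
    qed
  qed
qed

text \<open>Stopping once \<open>a + b\<close> exceeds \<open>\<mu>\<close> leaves both coordinates
  at most \<open>\<mu>\<close> and the larger one above \<open>\<mu> / 2\<close>. The smaller one
  may still be tiny; \<open>comparable_state\<close> deals with that.\<close>

lemma greedy_path:
  assumes "x \<in> X" "0 < a" "0 < b" "a \<le> \<mu>" "b \<le> \<mu>"
  shows "\<exists>x'\<in>X. \<exists>a' b'. 0 < a' \<and> 0 < b' \<and> a' \<le> \<mu> \<and> b' \<le> \<mu> \<and> \<mu> < a' + b' \<and>
    f x a b - 4 * E * \<mu>\<^sup>2 \<le> f x' a' b'"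
proof -
  obtain n where "\<mu> - (a + b) < real n * min a b"
    using reals_Archimedean3[of "min a b"] assms by auto
  then obtain x' a' b' where *: "x' \<in> X" "a \<le> a'" "b \<le> b'" "a' \<le> \<mu>" "b' \<le> \<mu>" "\<mu> < a' + b'"
    "f x a b - E * ((a' + b')\<^sup>2 - (a + b)\<^sup>2) \<le> f x' a' b'"
    using greedy_path_aux[of x "min a b" a b \<mu> n] assms by auto
  have "(a' + b')\<^sup>2 \<le> (2 * \<mu>)\<^sup>2" using * assms by (intro power_mono) auto
  then have "(a' + b')\<^sup>2 - (a + b)\<^sup>2 \<le> 4 * \<mu>\<^sup>2" by (simp add: power_mult_distrib)
      (use zero_le_power2[of "a + b"] in linarith)
  then have "E * ((a' + b')\<^sup>2 - (a + b)\<^sup>2) \<le> 4 * E * \<mu>\<^sup>2"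
    using mult_left_mono[OF _ E_nonneg] by (fastforce simp: mult.assoc mult.left_commute)
  then show ?thesis using * assms by (intro bexI[of _ x'] exI[of _ a'] exI[of _ b']) auto
qed

lemma funpow_l_closed: "x \<in> X \<Longrightarrow> (l ^^ n) x \<in> X"
  by (induction n) (auto simp: l_closed)

text \<open>Splitting off the \<open>r\<close> child along \<open>l, l, \<dots>\<close>: the excess over \<open>S\<close> at \<open>(a, n a + b)\<close>, divided by
  \<open>n a + b\<close>, is non-decreasing in \<open>n\<close> up to the error terms.\<close>

lemma first_r_bound:
  assumes x: "x \<in> X" and a: "0 < a" "a \<le> b"
    and k: "b \<le> real k * a" "real k * a \<le> 2 * b"
    and S: "\<And>n. n < k \<Longrightarrow> f (r ((l ^^ n) x)) (real (Suc n) * a + b) (real n * a + b) \<le> S"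
    and U: "f ((l ^^ k) x) a (real k * a + b) \<le> U" "S \<le> U"
  shows "f x a b \<le> (S + U) / 2 + 2 * E * b\<^sup>2"
proof -
  define d where "d n = f ((l ^^ n) x) a (real n * a + b) - S" for n
  have b: "0 < b" using a by simp
  have tele: "d 0 / b \<le> d n / (real n * a + b) + real n * E * a" if "n \<le> k" for n
    using that
  proof (induction n)
    case 0 then show ?case by simp
  next
    case (Suc n)
    let ?B = "real n * a + b"
    have B: "0 < ?B" using a b by (simp add: add_nonneg_pos)
    have q: "?B / (a + ?B) + a / (a + ?B) = 1"
      using add_pos_pos[OF a(1) B] by (simp add: add_divide_distrib[symmetric] add_ac)
    have "f ((l ^^ n) x) a ?B \<le> ?B / (a + ?B) * f (l ((l ^^ n) x)) a (a + ?B)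
        + a / (a + ?B) * f (r ((l ^^ n) x)) (a + ?B) ?B + E * a * ?B"
      by (rule upper_bound[OF funpow_l_closed[OF x] a(1) B])
    also have "a / (a + ?B) * f (r ((l ^^ n) x)) (a + ?B) ?B \<le> a / (a + ?B) * S"
      using S[of n] Suc.prems a B by (intro mult_left_mono) (auto simp: algebra_simps)
    finally have "d n \<le> ?B / (a + ?B) * d (Suc n) + (?B / (a + ?B) + a / (a + ?B) - 1) * S + E * a * ?B"
      by (simp add: d_def algebra_simps)
    then have "d n \<le> ?B / (a + ?B) * d (Suc n) + E * a * ?B" using q by simp
    then have "d n / ?B \<le> (?B / (a + ?B) * d (Suc n) + E * a * ?B) / ?B"
      using B by (intro divide_right_mono) auto
    also have "(C / (a + C) * D + E * a * C) / C = D / (a + C) + E * a" if "0 < C" for C D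
      using that by (simp add: add_divide_distrib)
    from this[OF B] have "(?B / (a + ?B) * d (Suc n) + E * a * ?B) / ?B = d (Suc n) / (a + ?B) + E * a" .
    finally show ?case using Suc by (simp add: algebra_simps)
  qed
  \<comment> \<open>After \<open>k\<close> steps the cone left over carries the share
    \<open>b / (k a + b)\<close> of the mass, which is at most 1/2. The rest lies in the split-off
    cones, where the value is at most \<open>S\<close>; this is the origin of the average
    \<open>(S + U) / 2\<close>.\<close>
  have kB: "2 * b \<le> real k * a + b" using k by simp
  have "d k / (real k * a + b) \<le> (U - S) / (real k * a + b)"
    using U b kB by (intro divide_right_mono) (auto simp: d_def)
  also have "\<dots> \<le> (U - S) / (2 * b)"
    using U b kB by (intro divide_left_mono) auto
  finally have "d 0 / b \<le> (U - S) / (2 * b) + real k * E * a" using tele[of k] by simp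
  then have "d 0 \<le> (U - S) / 2 + b * (E * (real k * a))"
    using b by (simp add: field_simps)
  also have "b * (E * (real k * a)) \<le> b * (E * (2 * b))"
    using k b E_nonneg by (intro mult_left_mono) auto
  finally show ?thesis by (simp add: d_def power2_eq_square field_simps)
qed

text \<open>Even if \<open>a\<close> is tiny, the \<open>r\<close> children split off along
  \<open>l, l, ...\<close> have both coordinates between \<open>b\<close> and \<open>3 * b\<close>,
  and together they carry at least half of the mass. They cannot all have a value well below
  \<open>M\<close>, as the other half exceeds \<open>M\<close> only slightly.\<close>

lemma comparable_state_le:
  assumes x: "x \<in> X" and a: "0 < a" "a \<le> b" and e: "0 < e"
    and up: "\<And>y a b. y \<in> X \<Longrightarrow> 0 < a \<Longrightarrow> 0 < b \<Longrightarrow> a < \<delta> \<Longrightarrow> b < \<delta> \<Longrightarrow> f y a b < M + e"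
    and big: "M - 2 * e < f x a b" and b: "4 * b < \<delta>" "2 * E * b\<^sup>2 \<le> e"
  shows "\<exists>y\<in>X. \<exists>a' b'. b \<le> a' \<and> a' \<le> 3 * b \<and> b \<le> b' \<and> b' \<le> 3 * b \<and> M - 7 * e < f y a' b'"
proof (rule ccontr)
  assume neg: "\<not> ?thesis"
  define k where "k = nat \<lceil>b / a\<rceil>"
  have b0: "0 < b" using a by simp
  have k1: "b / a \<le> real k" "real k < b / a + 1"
    unfolding k_def using a b0 by (auto simp: of_nat_nat ceiling_less_iff intro: order_trans[OF le_of_int_ceiling])
      linarith
  then have k: "b \<le> real k * a" "real k * a \<le> b + a" using a by (auto simp: field_simps)
  have *: "f (r ((l ^^ n) x)) (real (Suc n) * a + b) (real n * a + b) \<le> M - 7 * e" if "n < k" for n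
  proof -
    have "real (Suc n) * a \<le> real k * a" using that a by (intro mult_right_mono) auto
    then have "real (Suc n) * a + b \<le> 3 * b" using k a by linarith
    moreover have "r ((l ^^ n) x) \<in> X" using funpow_l_closed[OF x] r_closed by blast
    moreover have "b \<le> real n * a + b" "real n * a + b \<le> real (Suc n) * a + b"
      using a by (auto simp: algebra_simps)
    ultimately show ?thesis using neg by (meson not_less order_trans)
  qed
  have "f ((l ^^ k) x) a (real k * a + b) < M + e"
    using k a b b0 by (intro up funpow_l_closed x) auto
  \<comment> \<open>The constant 7: the mean of \<open>M - 7 * e\<close> and \<open>M + e\<close> is
    \<open>M - 3 * e\<close>, and the error term adds at most \<open>e\<close>, so that
    \<open>f x a b\<close> would be at most \<open>M - 2 * e\<close>.\<close>
  then have "f x a b \<le> (M - 7 * e + (M + e)) / 2 + 2 * E * b\<^sup>2"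
    using k a e by (intro first_r_bound[OF x a _ _ *]) auto
  moreover have "(M - 7 * e + (M + e)) / 2 = M - 3 * e" by (simp add: field_simps)
  ultimately show False using big b(2) by linarith
qed

lemma comparable_state:
  assumes x: "x \<in> X" and ab: "0 < a" "0 < b" "a \<le> \<mu>" "b \<le> \<mu>" "\<mu> < a + b" and e: "0 < e"
    and up: "\<And>y a b. y \<in> X \<Longrightarrow> 0 < a \<Longrightarrow> 0 < b \<Longrightarrow> a < \<delta> \<Longrightarrow> b < \<delta> \<Longrightarrow> f y a b < M + e"
    and big: "M - 2 * e < f x a b" and b: "4 * \<mu> < \<delta>" "2 * E * \<mu>\<^sup>2 \<le> e"
  shows "\<exists>y\<in>X. \<exists>a' b'. \<mu> / 2 \<le> a' \<and> a' \<le> 3 * \<mu> \<and> \<mu> / 2 \<le> b' \<and> b' \<le> 3 * \<mu> \<and> M - 7 * e < f y a' b'"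
proof -
  have sq: "2 * E * c\<^sup>2 \<le> e" if "0 \<le> c" "c \<le> \<mu>" for c
  proof -
    have "E * c\<^sup>2 \<le> E * \<mu>\<^sup>2" using that E_nonneg by (intro mult_left_mono power_mono) auto
    with b show ?thesis by linarith
  qed
  show ?thesis
  proof (cases "a \<le> b")
    case True
    from comparable_state_le[OF x ab(1) True e, of \<delta> M] up big b sq[of b] ab
    obtain y a' b' where "y \<in> X" "b \<le> a'" "a' \<le> 3 * b" "b \<le> b'" "b' \<le> 3 * b" "M - 7 * e < f y a' b'" by fastforce
    then show ?thesis using True ab by (intro bexI[of _ y] exI[of _ a'] exI[of _ b']) auto
  next
    case False
    interpret sw: quasi_harmonic X r l "\<lambda>x a b. f x b a" E by (rule quasi_harmonic_swap)
    have ba: "b \<le> a" using False by simp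
    from sw.comparable_state_le[OF x ab(2) ba e, of \<delta> M] up big b sq[of a] ab
    obtain y a' b' where "y \<in> X" "a \<le> a'" "a' \<le> 3 * a" "a \<le> b'" "b' \<le> 3 * a" "M - 7 * e < f y b' a'"
      by fastforce
    then show ?thesis using False ab by (intro bexI[of _ y] exI[of _ b'] exI[of _ a']) auto
  qed
qed

end

section \<open>Propagation of near-extremal values along words in the two moves\<close>

fun farey_step :: "bool \<Rightarrow> real \<times> real \<Rightarrow> real \<times> real" where
  "farey_step c (a, b) = (if c then (a, a + b) else (a + b, b))"

lemma farey_path_bounds:
  assumes "0 < \<rho>" "\<rho> \<le> a" "\<rho> \<le> b" "a \<le> C" "b \<le> C" "fold farey_step w (a, b) = (a', b')"
  shows "\<rho> \<le> a' \<and> \<rho> \<le> b' \<and> a' \<le> 2 ^ length w * C \<and> b' \<le> 2 ^ length w * C"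
  using assms
proof (induction w arbitrary: a b C)
  case (Cons c w)
  show ?case using Cons.IH[of "fst (farey_step c (a, b))" "snd (farey_step c (a, b))" "2 * C"] Cons.prems
    by (cases c) (auto simp: mult_ac)
qed auto

lemma fold_farey_step_replicate:
  "fold farey_step (replicate n True) (a, b) = (a, b + real n * a)"
  "fold farey_step (replicate n False) (a, b) = (a + real n * b, b)"
  by (induction n arbitrary: a b) (auto simp: algebra_simps)

abbreviation walk :: "('a \<Rightarrow> 'a) \<Rightarrow> ('a \<Rightarrow> 'a) \<Rightarrow> bool list \<Rightarrow> 'a \<Rightarrow> 'a" where
  "walk l r \<equiv> fold (\<lambda>c. if c then l else r)"

lemma walk_replicate:
  "walk l r (replicate n True) x = (l ^^ n) x" "walk l r (replicate n False) x = (r ^^ n) x"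
  by (induction n arbitrary: x) (auto simp: funpow_swap1)

lemma pos_pos_exI: "0 < x \<Longrightarrow> 0 < y \<Longrightarrow> P x y \<Longrightarrow> \<exists>x>0. \<exists>y>0. P x (y :: real)" for x :: real
  by blast

context quasi_harmonic
begin

text \<open>If the coordinates differ by a factor of at most \<open>C\<close>, each child has weight
  at least \<theta>. A deficit \<open>e\<close> of one child would lower the average by at least
  \<open>\<theta> * e\<close>, while the slack of the parent, the excess of the other child and the
  error term are at most a quarter of that each.\<close>

lemma near_sup_step_aux:
  assumes C: "1 \<le> C" and e: "0 < e" and \<theta>: "\<theta> = 1 / (1 + C)"
    and \<rho>: "0 < \<rho>" "\<rho> \<le> a" "\<rho> \<le> b" "a \<le> C * \<rho>" "b \<le> C * \<rho>" "E * (C * \<rho>)\<^sup>2 \<le> \<theta> * e / 4"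
    and q: "q = b / (a + b)" "1 - q = a / (a + b)"
    and v: "v \<le> q * u + (1 - q) * u' + E * a * b" "u' < M + \<theta> * e / 4" "M - \<theta> * e / 4 < v"
  shows "M - e < u"
proof -
  have "E * a * b \<le> E * (C * \<rho>)\<^sup>2"
  proof -
    have "0 \<le> E" by (rule E_nonneg)
    moreover have "a * b \<le> (C * \<rho>) * (C * \<rho>)" using \<rho> by (intro mult_mono) auto
    ultimately show ?thesis unfolding power2_eq_square mult.assoc[of E] by (intro mult_left_mono) auto
  qed
  with \<rho> have Eab: "E * a * b \<le> \<theta> * e / 4" by linarith
  have \<theta>q: "\<theta> \<le> q"
  proof -
    have "a \<le> C * b" using \<rho> C mult_left_mono[of \<rho> b C] by linarith
    then have "a + b \<le> (1 + C) * b" by (simp add: algebra_simps)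
    moreover have "0 < a + b" "0 < 1 + C" using \<rho> C by auto
    ultimately show ?thesis unfolding \<theta> q(1) by (simp add: field_simps)
  qed
  have \<theta>0: "0 < \<theta>" using C \<theta> by simp
  have q1: "0 < q" "0 \<le> 1 - q" using \<theta>q \<theta>0 q(2) \<rho> by auto
  have "(1 - q) * u' \<le> (1 - q) * (M + \<theta> * e / 4)" using q1 v by (intro mult_left_mono) auto
  also have "\<dots> = M - q * M + (1 - q) * (\<theta> * e / 4)" by (simp add: algebra_simps)
  also have "(1 - q) * (\<theta> * e / 4) \<le> 1 * (\<theta> * e / 4)" using q1 \<theta>0 e by (intro mult_right_mono) auto
  finally have "q * u > q * M - 3 * (\<theta> * e / 4)" using v Eab by linarith
  moreover have "\<theta> * e \<le> q * e" using \<theta>q e by (intro mult_right_mono) auto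
  moreover have "0 < \<theta> * e" using \<theta>0 e by simp
  ultimately have "q * u > q * M - q * e" by linarith
  then have "q * (M - e) < q * u" by (simp add: algebra_simps)
  then show ?thesis using q1 by simp
qed

lemma small_square:
  assumes "0 < e" "0 \<le> K"
  shows "\<exists>\<rho>\<^sub>0>0. \<forall>\<rho>. 0 < \<rho> \<and> \<rho> < \<rho>\<^sub>0 \<longrightarrow> K * \<rho>\<^sup>2 \<le> (e :: real)"
proof (intro exI[of _ "min 1 (e / (K + 1))"] conjI allI impI)
  fix \<rho> assume *: "0 < \<rho> \<and> \<rho> < min 1 (e / (K + 1))"
  then have "K * \<rho>\<^sup>2 \<le> K * \<rho>" using assms
    by (intro mult_left_mono) (auto simp: power2_eq_square mult_left_le)
  also have "\<dots> \<le> (K + 1) * \<rho>" using * by (intro mult_right_mono) auto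
  also have "\<dots> \<le> e" using * assms by (simp add: field_simps)
  finally show "K * \<rho>\<^sup>2 \<le> e" .
qed (use assms in auto)

text \<open>An upper bound for the upper limit as \<open>a\<close> and \<open>b\<close> tend to
  zero, uniformly in the label; the upper limit itself is characterized by the additional condition
  that values above \<open>M - e\<close> occur at arbitrarily small coordinates.\<close>

definition eventual_upper_bound :: "real \<Rightarrow> bool" where
  "eventual_upper_bound M \<longleftrightarrow> (\<forall>e>0. \<exists>\<delta>>0. \<forall>y\<in>X. \<forall>a b. 0 < a \<and> a < \<delta> \<and> 0 < b \<and> b < \<delta> \<longrightarrow> f y a b < M + e)"

lemma eventual_upper_boundE:
  assumes "eventual_upper_bound M" "0 < e"
  obtains \<delta> where "0 < \<delta>"
    "\<And>y a b. y \<in> X \<Longrightarrow> 0 < a \<Longrightarrow> 0 < b \<Longrightarrow> a < \<delta> \<Longrightarrow> b < \<delta> \<Longrightarrow> f y a b < M + e"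
proof -
  have "\<exists>\<delta>>0. \<forall>y\<in>X. \<forall>a b. 0 < a \<and> a < \<delta> \<and> 0 < b \<and> b < \<delta> \<longrightarrow> f y a b < M + e"
    using assms by (simp add: eventual_upper_bound_def)
  then obtain \<delta> where *: "0 < \<delta>" "\<forall>y\<in>X. \<forall>a b. 0 < a \<and> a < \<delta> \<and> 0 < b \<and> b < \<delta> \<longrightarrow> f y a b < M + e"
    by (elim exE conjE) (rule that)
  show ?thesis by (rule that[OF *(1)]) (use *(2) in auto)
qed

lemma near_sup_step:
  assumes M: "eventual_upper_bound M" and C: "1 \<le> C" and e: "0 < e"
  shows "\<exists>e'>0. \<exists>\<rho>\<^sub>0>0. \<forall>\<rho> a b. \<forall>x\<in>X. 0 < \<rho> \<and> \<rho> < \<rho>\<^sub>0 \<and> \<rho> \<le> a \<and> \<rho> \<le> b \<and> a \<le> C * \<rho> \<and> b \<le> C * \<rho> \<and>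
    M - e' < f x a b \<longrightarrow> M - e < f (l x) a (a + b) \<and> M - e < f (r x) (a + b) b"
proof -
  define \<theta> where "\<theta> = 1 / (1 + C)"
  have \<theta>: "0 < \<theta>" using C by (simp add: \<theta>_def)
  then have e4: "0 < \<theta> * e / 4" using e by simp
  obtain \<delta> where \<delta>: "0 < \<delta>"
    "\<And>y a b. y \<in> X \<Longrightarrow> 0 < a \<Longrightarrow> 0 < b \<Longrightarrow> a < \<delta> \<Longrightarrow> b < \<delta> \<Longrightarrow> f y a b < M + \<theta> * e / 4"
    using eventual_upper_boundE[OF M e4] by metis
  obtain \<rho>1 where \<rho>1: "0 < \<rho>1" "\<And>\<rho>. 0 < \<rho> \<Longrightarrow> \<rho> < \<rho>1 \<Longrightarrow> (E * C\<^sup>2) * \<rho>\<^sup>2 \<le> \<theta> * e / 4"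
    using small_square[OF e4, of "E * C\<^sup>2"] E_nonneg by auto
  define \<rho>\<^sub>0 where "\<rho>\<^sub>0 = min \<rho>1 (\<delta> / (2 * C))"
  show ?thesis
  proof (rule pos_pos_exI[of "\<theta> * e / 4" \<rho>\<^sub>0]; (intro allI ballI impI conjI)?; (elim conjE)?)
    show "0 < \<rho>\<^sub>0" using \<rho>1 \<delta> C by (simp add: \<rho>\<^sub>0_def)
    fix \<rho> a b x assume x: "x \<in> X" and \<rho>: "0 < \<rho>" "\<rho> < \<rho>\<^sub>0" "\<rho> \<le> a" "\<rho> \<le> b" "a \<le> C * \<rho>" "b \<le> C * \<rho>"
      and big: "M - \<theta> * e / 4 < f x a b"
    have ab: "0 < a" "0 < b" using \<rho> by auto
    have "2 * C * \<rho> < \<delta>" using \<rho> C by (simp add: \<rho>\<^sub>0_def field_simps)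
    then have s: "a + b < \<delta>" using \<rho> by linarith
    have q: "E * (C * \<rho>)\<^sup>2 \<le> \<theta> * e / 4" using \<rho>1(2)[of \<rho>] \<rho> by (simp add: \<rho>\<^sub>0_def power_mult_distrib mult_ac)
    have p: "1 - b / (a + b) = a / (a + b)" "1 - a / (a + b) = b / (a + b)" using ab by (auto simp: field_simps)
    note ub = upper_bound[OF x ab]
    show "M - e < f (l x) a (a + b)"
    proof (rule near_sup_step_aux[OF C e \<theta>_def \<rho>(1,3-6) q refl p(1) _ _ big])
      show "f x a b \<le> b / (a + b) * f (l x) a (a + b) + (1 - b / (a + b)) * f (r x) (a + b) b + E * a * b"
        using ub unfolding p .
      show "f (r x) (a + b) b < M + \<theta> * e / 4" using ab s x by (intro \<delta> r_closed) auto
    qed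
    show "M - e < f (r x) (a + b) b"
    proof (rule near_sup_step_aux[OF C e \<theta>_def \<rho>(1,4,3,6,5) q _ _ _ _ big])
      show "f x a b \<le> (a / (a + b)) * f (r x) (a + b) b + (1 - a / (a + b)) * f (l x) a (a + b) + E * b * a"
        using ub unfolding p by (simp only: mult_ac add_ac)
      show "f (l x) a (a + b) < M + \<theta> * e / 4" using ab s x by (intro \<delta> l_closed) auto
    qed (use p in \<open>auto simp: add.commute\<close>)
  qed (use e4 in auto)
qed

text \<open>The tolerance \<open>e'\<close> and the threshold \<open>\<rho>\<^sub>0\<close> may
  depend on the word and on \<open>C\<close>, but not on the scale \<rho> of the state; this
  uniformity is what allows finitely many words to be treated at once.\<close>

definition near_sup_persists :: "real \<Rightarrow> real \<Rightarrow> bool list \<Rightarrow> real \<Rightarrow> real \<Rightarrow> real \<Rightarrow> bool" where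
  "near_sup_persists M C w e e' \<rho>\<^sub>0 \<longleftrightarrow> (\<forall>\<rho> a b. \<forall>x\<in>X.
    0 < \<rho> \<and> \<rho> < \<rho>\<^sub>0 \<and> \<rho> \<le> a \<and> \<rho> \<le> b \<and> a \<le> C * \<rho> \<and> b \<le> C * \<rho> \<and> M - e' < f x a b \<longrightarrow>
    (case fold farey_step w (a, b) of (a', b') \<Rightarrow> M - e < f (walk l r w x) a' b'))"

lemma near_sup_persistsD:
  assumes "near_sup_persists M C w e e' \<rho>\<^sub>0" "x \<in> X" "0 < \<rho>" "\<rho> < \<rho>\<^sub>0" "\<rho> \<le> a" "\<rho> \<le> b" "a \<le> C * \<rho>" "b \<le> C * \<rho>"
    "M - e' < f x a b" "fold farey_step w (a, b) = (a', b')"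
  shows "M - e < f (walk l r w x) a' b'"
  using assms(1)[unfolded near_sup_persists_def, rule_format, of x \<rho> a b] assms by simp

lemma near_sup_persists_mono:
  assumes "near_sup_persists M C w e e1 \<rho>1" "e2 \<le> e1" "\<rho>2 \<le> \<rho>1"
  shows "near_sup_persists M C w e e2 \<rho>2"
  unfolding near_sup_persists_def
proof (intro allI ballI impI; elim conjE)
  fix \<rho> a b x assume *: "x \<in> X" "0 < \<rho>" "\<rho> < \<rho>2" "\<rho> \<le> a" "\<rho> \<le> b" "a \<le> C * \<rho>" "b \<le> C * \<rho>" "M - e2 < f x a b"
  obtain a' b' where ab: "fold farey_step w (a, b) = (a', b')" by fastforce
  have "M - e < f (walk l r w x) a' b'"
    by (rule near_sup_persistsD[OF assms(1) *(1,2) _ *(4-7) _ ab]) (use * assms in auto)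
  then show "case fold farey_step w (a, b) of (a', b') \<Rightarrow> M - e < f (walk l r w x) a' b'" by (simp add: ab)
qed

lemma near_sup_walk:
  assumes M: "eventual_upper_bound M" and C: "1 \<le> C" and e: "0 < e"
  shows "\<exists>e'>0. \<exists>\<rho>\<^sub>0>0. near_sup_persists M C w e e' \<rho>\<^sub>0"
  using C
proof (induction w arbitrary: C)
  case Nil
  show ?case using e by (intro pos_pos_exI[of e 1]) (auto simp: near_sup_persists_def)
next
  case (Cons c w)
  \<comment> \<open>One move at most doubles the coordinates and does not lower them, so the rest of
    the word is handled at the same scale with \<open>2 * C\<close>.\<close>
  have "1 \<le> 2 * C" using Cons.prems by simp
  from Cons.IH[OF this] obtain e1 \<rho>1 where 1: "0 < e1" "0 < \<rho>1" "near_sup_persists M (2 * C) w e e1 \<rho>1"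
    by metis
  from near_sup_step[OF M Cons.prems 1(1)] obtain e2 \<rho>2 where 2: "0 < e2" "0 < \<rho>2" and
    step: "\<forall>\<rho> a b. \<forall>x\<in>X. 0 < \<rho> \<and> \<rho> < \<rho>2 \<and> \<rho> \<le> a \<and> \<rho> \<le> b \<and> a \<le> C * \<rho> \<and> b \<le> C * \<rho> \<and>
      M - e2 < f x a b \<longrightarrow> M - e1 < f (l x) a (a + b) \<and> M - e1 < f (r x) (a + b) b"
    by (elim exE conjE) (rule that)
  have "near_sup_persists M C (c # w) e e2 (min \<rho>1 \<rho>2)"
    unfolding near_sup_persists_def
  proof (intro allI ballI impI; elim conjE)
    fix \<rho> a b x assume x: "x \<in> X" and \<rho>: "0 < \<rho>" "\<rho> < min \<rho>1 \<rho>2" "\<rho> \<le> a" "\<rho> \<le> b" "a \<le> C * \<rho>" "b \<le> C * \<rho>"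
      and big: "M - e2 < f x a b"
    have s: "M - e1 < f (l x) a (a + b)" "M - e1 < f (r x) (a + b) b"
      using step[rule_format, OF x, of \<rho> a b] \<rho> big by auto
    obtain a' b' where ab: "fold farey_step (c # w) (a, b) = (a', b')" by fastforce
    have "M - e < f (walk l r (c # w) x) a' b'"
    proof (cases c)
      case True
      with near_sup_persistsD[OF 1(3) l_closed[OF x], of \<rho> a "a + b" a' b'] s ab \<rho>
      show ?thesis by auto
    next
      case False
      with near_sup_persistsD[OF 1(3) r_closed[OF x], of \<rho> "a + b" b a' b'] s ab \<rho>
      show ?thesis by auto
    qed
    then show "case fold farey_step (c # w) (a, b) of (a', b') \<Rightarrow> M - e < f (walk l r (c # w) x) a' b'"
      unfolding ab prod.case .
  qed
  with 1 2 show ?case by (intro pos_pos_exI[of e2 "min \<rho>1 \<rho>2"]) auto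
qed

lemma near_sup_walks:
  assumes M: "eventual_upper_bound M" and C: "1 \<le> C" and e: "0 < e" and W: "finite W"
  shows "\<exists>e'>0. \<exists>\<rho>\<^sub>0>0. \<forall>w\<in>W. near_sup_persists M C w e e' \<rho>\<^sub>0"
  using W
proof (induction W)
  case empty
  show ?case by (rule pos_pos_exI[of 1 1]) auto
next
  case (insert w W)
  from insert.IH obtain e1 \<rho>1 where 1: "0 < e1" "0 < \<rho>1" "\<forall>w\<in>W. near_sup_persists M C w e e1 \<rho>1"
    by (elim exE conjE) (rule that)
  from near_sup_walk[OF M C e, of w] obtain e2 \<rho>2 where 2: "0 < e2" "0 < \<rho>2" "near_sup_persists M C w e e2 \<rho>2"
    by (elim exE conjE) (rule that)
  have "\<forall>v\<in>insert w W. near_sup_persists M C v e (min e1 e2) (min \<rho>1 \<rho>2)"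
    using 1(3) 2(3) by (auto intro: near_sup_persists_mono)
  with 1 2 show ?case by (intro pos_pos_exI[of "min e1 e2" "min \<rho>1 \<rho>2"]) auto
qed

text \<open>A nearly maximal state of tiny size is raised to the prescribed scale by a greedy path,
  made comparable, and brought to the prescribed label by a connecting word. The constant
  \<open>C\<close> depends only on the lengths of the connecting words and not on \<open>e\<close>:
  the words used afterwards are chosen in terms of both \<open>C\<close> and
  \<open>e\<close>.\<close>

lemma near_sup_everywhere:
  assumes M: "eventual_upper_bound M"
    and attained: "\<And>e \<delta>. 0 < e \<Longrightarrow> 0 < \<delta> \<Longrightarrow> \<exists>x\<in>X. \<exists>a b. 0 < a \<and> a < \<delta> \<and> 0 < b \<and> b < \<delta> \<and> M - e < f x a b"
    and fin: "finite X" and trans: "\<And>x y. x \<in> X \<Longrightarrow> y \<in> X \<Longrightarrow> \<exists>w. walk l r w x = y"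
  shows "\<exists>C\<ge>1. \<forall>e>0. \<exists>\<rho>\<^sub>0>0. \<forall>\<rho>. \<forall>y\<in>X. 0 < \<rho> \<and> \<rho> < \<rho>\<^sub>0 \<longrightarrow>
    (\<exists>a b. \<rho> \<le> a \<and> \<rho> \<le> b \<and> a \<le> C * \<rho> \<and> b \<le> C * \<rho> \<and> M - e < f y a b)"
proof -
  obtain wd where wd: "\<And>x y. x \<in> X \<Longrightarrow> y \<in> X \<Longrightarrow> walk l r (wd x y) x = y"
    using trans by metis
  define W where "W = (\<lambda>(x, y). wd x y) ` (X \<times> X)"
  have W: "finite W" using fin by (simp add: W_def)
  define n where "n = Max (length ` W)"
  have n: "length w \<le> n" if "w \<in> W" for w using W that by (simp add: n_def)
  show ?thesis
  \<comment> \<open>The states are made comparable at scale \<open>2 * \<rho>\<close>, which puts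
    their coordinates between \<rho> and \<open>6 * \<rho>\<close>; a connecting word of length at
    most \<open>n\<close> enlarges them by at most \<open>2 ^ n\<close>.\<close>
  proof (rule exI[of _ "6 * 2 ^ n"], intro conjI allI impI)
    have "(1::real) \<le> 2 ^ n" by simp
    then show "(1::real) \<le> 6 * 2 ^ n" by linarith
    fix e :: real assume e: "0 < e"
    have "(1::real) \<le> 6" by simp
    from near_sup_walks[OF M this e W] obtain e' \<rho>1
      where 1: "0 < e'" "0 < \<rho>1" "\<forall>w\<in>W. near_sup_persists M 6 w e e' \<rho>1"
      by (elim exE conjE) (rule that)
    define e1 where "e1 = e' / 7"
    have e1: "0 < e1" using 1 by (simp add: e1_def)
    obtain \<delta> where \<delta>: "0 < \<delta>"
      "\<And>y a b. y \<in> X \<Longrightarrow> 0 < a \<Longrightarrow> 0 < b \<Longrightarrow> a < \<delta> \<Longrightarrow> b < \<delta> \<Longrightarrow> f y a b < M + e1"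
      using eventual_upper_boundE[OF M e1] by metis
    obtain \<rho>2 where \<rho>2: "0 < \<rho>2" "\<And>\<rho>. 0 < \<rho> \<Longrightarrow> \<rho> < \<rho>2 \<Longrightarrow> (16 * E) * \<rho>\<^sup>2 \<le> e1"
      using small_square[OF e1, of "16 * E"] E_nonneg by auto
    show "\<exists>\<rho>\<^sub>0>0. \<forall>\<rho>. \<forall>y\<in>X. 0 < \<rho> \<and> \<rho> < \<rho>\<^sub>0 \<longrightarrow>
      (\<exists>a b. \<rho> \<le> a \<and> \<rho> \<le> b \<and> a \<le> 6 * 2 ^ n * \<rho> \<and> b \<le> 6 * 2 ^ n * \<rho> \<and> M - e < f y a b)"
    proof (rule exI[of _ "min (\<delta> / 8) (min \<rho>1 \<rho>2)"], intro conjI allI ballI impI; (elim conjE)?)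
      fix \<rho> y assume y: "y \<in> X" and \<rho>: "0 < \<rho>" "\<rho> < min (\<delta> / 8) (min \<rho>1 \<rho>2)"
      have sq: "16 * E * \<rho>\<^sup>2 \<le> e1" using \<rho>2(2)[of \<rho>] \<rho> by auto
      obtain x a b where x: "x \<in> X" "0 < a" "a < 2 * \<rho>" "0 < b" "b < 2 * \<rho>" "M - e1 < f x a b"
        using attained[OF e1, of "2 * \<rho>"] \<rho> by auto
      obtain x2 a2 b2 where 2: "x2 \<in> X" "0 < a2" "0 < b2" "a2 \<le> 2 * \<rho>" "b2 \<le> 2 * \<rho>" "2 * \<rho> < a2 + b2"
        "f x a b - 4 * E * (2 * \<rho>)\<^sup>2 \<le> f x2 a2 b2"
        using greedy_path[OF x(1,2,4), of "2 * \<rho>"] x by auto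
      have "4 * E * (2 * \<rho>)\<^sup>2 \<le> e1" "2 * E * (2 * \<rho>)\<^sup>2 \<le> e1"
        using sq E_nonneg by (auto simp: power_mult_distrib intro: order_trans[rotated])
      moreover from this have "M - 2 * e1 < f x2 a2 b2" using 2 x by linarith
      ultimately obtain x3 a3 b3 where 3: "x3 \<in> X" "2 * \<rho> / 2 \<le> a3" "a3 \<le> 3 * (2 * \<rho>)"
        "2 * \<rho> / 2 \<le> b3" "b3 \<le> 3 * (2 * \<rho>)" "M - 7 * e1 < f x3 a3 b3"
        using comparable_state[OF 2(1-6) e1, of \<delta> M] \<delta>(2) \<rho> by auto
      obtain a b where ab: "fold farey_step (wd x3 y) (a3, b3) = (a, b)" by fastforce
      have w: "wd x3 y \<in> W" using 3 y by (auto simp: W_def)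
      have "M - e < f (walk l r (wd x3 y) x3) a b"
        by (rule near_sup_persistsD[OF _ 3(1) \<rho>(1) _ _ _ _ _ _ ab]) (use 1(3) w 3 \<rho> in \<open>auto simp: e1_def\<close>)
      then have "M - e < f y a b" using wd[OF 3(1) y] by simp
      moreover have "\<rho> \<le> a \<and> \<rho> \<le> b \<and> a \<le> 2 ^ length (wd x3 y) * (6 * \<rho>) \<and> b \<le> 2 ^ length (wd x3 y) * (6 * \<rho>)"
        using 3 \<rho> by (intro farey_path_bounds[OF _ _ _ _ _ ab]) auto
      moreover have "2 ^ length (wd x3 y) * (6 * \<rho>) \<le> 2 ^ n * (6 * \<rho>)"
        using n[OF w] \<rho> by (intro mult_right_mono power_increasing) auto
      ultimately show "\<exists>a b. \<rho> \<le> a \<and> \<rho> \<le> b \<and> a \<le> 6 * 2 ^ n * \<rho> \<and> b \<le> 6 * 2 ^ n * \<rho> \<and> M - e < f y a b"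
        by (intro exI[of _ a] exI[of _ b]) (auto simp: mult_ac)
    qed (use \<delta> 1 \<rho>2 in auto)
  qed
qed

section \<open>Coincidence of the upper and the lower limit\<close>

lemma eventual_upper_bound_exists:
  assumes "\<And>x a b. x \<in> X \<Longrightarrow> 0 < a \<Longrightarrow> 0 < b \<Longrightarrow> \<bar>f x a b\<bar> \<le> B" "X \<noteq> {}"
  shows "\<exists>M. eventual_upper_bound M \<and>
    (\<forall>e>0. \<forall>\<delta>>0. \<exists>x\<in>X. \<exists>a b. 0 < a \<and> a < \<delta> \<and> 0 < b \<and> b < \<delta> \<and> M - e < f x a b)"
proof -
  \<comment> \<open>The upper limit is obtained as the infimum of all bounds that hold for
    sufficiently small coordinates.\<close>
  define Y where "Y = {u. \<exists>\<delta>>0. \<forall>x\<in>X. \<forall>a b. 0 < a \<and> a < \<delta> \<and> 0 < b \<and> b < \<delta> \<longrightarrow> f x a b \<le> u}"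
  have YI: "u \<in> Y" if "0 < \<delta>" "\<forall>x\<in>X. \<forall>a b. 0 < a \<and> a < \<delta> \<and> 0 < b \<and> b < \<delta> \<longrightarrow> f x a b \<le> u" for u \<delta>
    unfolding Y_def using that by (intro CollectI exI[of _ \<delta>] conjI)
  obtain x where x: "x \<in> X" using assms by auto
  have "B \<in> Y" using assms(1) by (force simp: Y_def abs_le_iff intro!: exI[of _ 1])
  then have ne: "Y \<noteq> {}" by blast
  have bd: "bdd_below Y"
  proof (rule bdd_belowI)
    fix u assume "u \<in> Y"
    then obtain \<delta> where "0 < \<delta>" "f x (\<delta> / 2) (\<delta> / 2) \<le> u" using x by (force simp: Y_def)
    then show "- B \<le> u" using assms(1)[OF x, of "\<delta> / 2" "\<delta> / 2"] by (auto simp: abs_le_iff)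
  qed
  have up: "eventual_upper_bound (Inf Y)"
    unfolding eventual_upper_bound_def
  proof (intro allI impI)
    fix e :: real assume "0 < e"
    then obtain u where "u \<in> Y" "u < Inf Y + e"
      using cInf_lessD[OF ne, of "Inf Y + e"] by auto
    moreover from this(1) obtain \<delta> where "0 < \<delta>"
      "\<forall>x\<in>X. \<forall>a b. 0 < a \<and> a < \<delta> \<and> 0 < b \<and> b < \<delta> \<longrightarrow> f x a b \<le> u"
      unfolding Y_def by blast
    ultimately show "\<exists>\<delta>>0. \<forall>y\<in>X. \<forall>a b. 0 < a \<and> a < \<delta> \<and> 0 < b \<and> b < \<delta> \<longrightarrow> f y a b < Inf Y + e"
      by (intro exI[of _ \<delta>]) (auto intro: le_less_trans)
  qed
  moreover have "\<exists>x\<in>X. \<exists>a b. 0 < a \<and> a < \<delta> \<and> 0 < b \<and> b < \<delta> \<and> Inf Y - e < f x a b"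
    if "0 < e" "0 < \<delta>" for e \<delta>
  proof (rule ccontr)
    assume "\<not> ?thesis"
    then have "\<forall>x\<in>X. \<forall>a b. 0 < a \<and> a < \<delta> \<and> 0 < b \<and> b < \<delta> \<longrightarrow> f x a b \<le> Inf Y - e"
      by (meson not_less)
    with that(2) have "Inf Y - e \<in> Y" by (rule YI)
    then have "Inf Y \<le> Inf Y - e" by (rule cInf_lower[OF _ bd])
    then show False using that by simp
  qed
  ultimately show ?thesis by blast
qed

end

text \<open>An injective self-map of a finite set has finite order. This makes it possible to return
  to a given label by moves of one kind, and to express the inverse of a move as a power of
  it.\<close>

lemma funpow_id_on_finite:
  assumes "finite X" "inj_on g X" "\<And>x. x \<in> X \<Longrightarrow> g x \<in> X"
  shows "\<exists>n>0. \<forall>x\<in>X. (g ^^ n) x = x"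
proof -
  define p where "p x = (if x \<in> X then g x else x)" for x
  have "bij_betw g X X"
    using assms by (simp add: bij_betw_def endo_inj_surj image_subset_iff)
  then have "bij_betw p X X" by (rule bij_betw_cong[THEN iffD1, rotated]) (simp add: p_def)
  then have "p permutes X" by (rule bij_imp_permutes) (simp add: p_def)
  then obtain n where n: "0 < n" "p ^^ n = id"
    using permutation_is_nilpotent permutation_permutes assms(1) by blast
  have "(g ^^ k) x = (p ^^ k) x \<and> (g ^^ k) x \<in> X" if "x \<in> X" for x k
    using that by (induction k) (auto simp: p_def assms(3))
  then show ?thesis using n by (intro exI[of _ n]) simp
qed

text \<open>With \<open>M\<close> the upper limit of \<open>f\<close> and \<open>M'\<close> that of
  its negative, the claim amounts to \<open>M + M' \<le> 0\<close>. At any small scale a nearly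
  maximal and a nearly minimal state with the same label \<open>y\<close> exist. Words of the form
  \<open>l ^ i\<close>, \<open>r ^ nr\<close> can equalize their coordinates, first the second and
  then the first one, without changing the label at the end.\<close>

theorem quasi_harmonic_limit:
  fixes X :: "'a set" and f :: "'a \<Rightarrow> real \<Rightarrow> real \<Rightarrow> real"
  assumes "quasi_harmonic X l r f E"
    and fin: "finite X" and ne: "X \<noteq> {}" and inj: "inj_on l X" "inj_on r X"
    and trans: "\<And>x y. x \<in> X \<Longrightarrow> y \<in> X \<Longrightarrow> \<exists>w. walk l r w x = y"
    and bounded: "\<And>x a b. x \<in> X \<Longrightarrow> 0 < a \<Longrightarrow> 0 < b \<Longrightarrow> \<bar>f x a b\<bar> \<le> B"
    and cont: "\<And>e. 0 < e \<Longrightarrow> \<exists>\<eta>>0. \<exists>\<delta>>0. \<forall>x\<in>X. \<forall>a b a' b'. 0 < a \<and> a \<le> a' \<and> a' \<le> (1 + \<eta>) * a \<and>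
      0 < b \<and> b \<le> b' \<and> b' \<le> (1 + \<eta>) * b \<and> a' < \<delta> \<and> b' < \<delta> \<longrightarrow> \<bar>f x a b - f x a' b'\<bar> < e"
  shows "\<exists>c. \<forall>e>0. \<exists>\<delta>>0. \<forall>x\<in>X. \<forall>a b. 0 < a \<and> a < \<delta> \<and> 0 < b \<and> b < \<delta> \<longrightarrow> \<bar>f x a b - c\<bar> < e"
proof -
  interpret f: quasi_harmonic X l r f E by fact
  let ?g = "\<lambda>x a b. - f x a b"
  interpret g: quasi_harmonic X l r ?g E by (rule f.quasi_harmonic_uminus)
  have "\<exists>M. f.eventual_upper_bound M \<and>
    (\<forall>e>0. \<forall>\<delta>>0. \<exists>x\<in>X. \<exists>a b. 0 < a \<and> a < \<delta> \<and> 0 < b \<and> b < \<delta> \<and> M - e < f x a b)"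
    by (rule f.eventual_upper_bound_exists[OF bounded ne])
  then obtain M where M: "f.eventual_upper_bound M"
    "\<forall>e>0. \<forall>\<delta>>0. \<exists>x\<in>X. \<exists>a b. 0 < a \<and> a < \<delta> \<and> 0 < b \<and> b < \<delta> \<and> M - e < f x a b"
    by (elim exE conjE) (rule that)
  have bounded': "\<bar>- f x a b\<bar> \<le> B" if "x \<in> X" "0 < a" "0 < b" for x a b using bounded[OF that] by simp
  have "\<exists>M. g.eventual_upper_bound M \<and>
    (\<forall>e>0. \<forall>\<delta>>0. \<exists>x\<in>X. \<exists>a b. 0 < a \<and> a < \<delta> \<and> 0 < b \<and> b < \<delta> \<and> M - e < - f x a b)"
    by (rule g.eventual_upper_bound_exists[OF bounded' ne])
  then obtain M' where M': "g.eventual_upper_bound M'"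
    "\<forall>e>0. \<forall>\<delta>>0. \<exists>x\<in>X. \<exists>a b. 0 < a \<and> a < \<delta> \<and> 0 < b \<and> b < \<delta> \<and> M' - e < - f x a b"
    by (elim exE conjE) (rule that)
  have "\<exists>C\<ge>1. \<forall>e>0. \<exists>\<rho>\<^sub>0>0. \<forall>\<rho>. \<forall>y\<in>X. 0 < \<rho> \<and> \<rho> < \<rho>\<^sub>0 \<longrightarrow>
    (\<exists>a b. \<rho> \<le> a \<and> \<rho> \<le> b \<and> a \<le> C * \<rho> \<and> b \<le> C * \<rho> \<and> M - e < f y a b)"
    by (rule f.near_sup_everywhere[OF M(1) _ fin trans]) (use M(2) in auto)
  then obtain C1 where C1: "1 \<le> C1" "\<forall>e>0. \<exists>\<rho>\<^sub>0>0. \<forall>\<rho>. \<forall>y\<in>X. 0 < \<rho> \<and> \<rho> < \<rho>\<^sub>0 \<longrightarrow>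
    (\<exists>a b. \<rho> \<le> a \<and> \<rho> \<le> b \<and> a \<le> C1 * \<rho> \<and> b \<le> C1 * \<rho> \<and> M - e < f y a b)"
    by (elim exE conjE) (rule that)
  have "\<exists>C\<ge>1. \<forall>e>0. \<exists>\<rho>\<^sub>0>0. \<forall>\<rho>. \<forall>y\<in>X. 0 < \<rho> \<and> \<rho> < \<rho>\<^sub>0 \<longrightarrow>
    (\<exists>a b. \<rho> \<le> a \<and> \<rho> \<le> b \<and> a \<le> C * \<rho> \<and> b \<le> C * \<rho> \<and> M' - e < - f y a b)"
    by (rule g.near_sup_everywhere[OF M'(1) _ fin trans]) (use M'(2) in auto)
  then obtain C2 where C2: "1 \<le> C2" "\<forall>e>0. \<exists>\<rho>\<^sub>0>0. \<forall>\<rho>. \<forall>y\<in>X. 0 < \<rho> \<and> \<rho> < \<rho>\<^sub>0 \<longrightarrow>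
    (\<exists>a b. \<rho> \<le> a \<and> \<rho> \<le> b \<and> a \<le> C2 * \<rho> \<and> b \<le> C2 * \<rho> \<and> M' - e < - f y a b)"
    by (elim exE conjE) (rule that)
  define C where "C = max C1 C2"
  have C: "1 \<le> C" "C1 \<le> C" "C2 \<le> C" using C1 by (auto simp: C_def)
  obtain y where y: "y \<in> X" using ne by blast
  obtain nl where nl: "0 < nl" "\<forall>x\<in>X. (l ^^ nl) x = x"
    using funpow_id_on_finite[OF fin inj(1) f.l_closed] by blast
  obtain nr where nr: "0 < nr" "\<forall>x\<in>X. (r ^^ nr) x = x"
    using funpow_id_on_finite[OF fin inj(2) f.r_closed] by blast
  have "M + M' \<le> e" if "0 < e" for e
  proof -
    have e4: "0 < e / 4" using that by simp
    obtain \<eta> \<delta> where \<eta>: "0 < \<eta>" "0 < \<delta>" and c: "\<forall>x\<in>X. \<forall>a b a' b'. 0 < a \<and> a \<le> a' \<and> a' \<le> (1 + \<eta>) * a \<and>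
      0 < b \<and> b \<le> b' \<and> b' \<le> (1 + \<eta>) * b \<and> a' < \<delta> \<and> b' < \<delta> \<longrightarrow> \<bar>f x a b - f x a' b'\<bar> < e / 4"
      using cont[OF e4] by (elim exE conjE) (rule that)
    \<comment> \<open>Rounding and the unknown starting point put the second coordinate between
      \<open>nl * (K - C) * \<rho>\<close> and \<open>nl * (K + C) * \<rho>\<close>; another
      \<open>C\<close> accounts for \<open>a\<close> in the first coordinate. \<open>K\<close> is so
      large that \<open>K + 2 * C\<close> and \<open>K - C\<close> differ at most by the factor
      \<open>1 + \<eta>\<close>.\<close>
    obtain K :: nat where K: "(2 * C + (1 + \<eta>) * C) / \<eta> < real K"
      using reals_Archimedean2 by blast
    then have K': "2 * C + (1 + \<eta>) * C \<le> real K * \<eta>" using \<eta> by (simp add: field_simps)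
    then have K2: "real K + 2 * C \<le> (1 + \<eta>) * (real K - C)" by (simp add: algebra_simps)
    have KC: "C < real K"
    proof -
      have "\<eta> * C < 2 * C + (1 + \<eta>) * C" using C by (simp add: algebra_simps)
      with K' have "C * \<eta> < real K * \<eta>" by (simp add: mult.commute)
      then show ?thesis using \<eta> by simp
    qed
    \<comment> \<open>The number of \<open>l\<close> moves depends on the states, and these are
      found only after the tolerances \<open>e1\<close> and \<open>e2\<close> are fixed. Hence the
      tolerances are chosen for all candidate words simultaneously.\<close>
    define W where "W = (\<lambda>i. replicate i True @ replicate nr False) ` {..nl * K}"
    have W: "finite W" by (simp add: W_def)
    obtain e1 \<rho>1 where 1: "0 < e1" "0 < \<rho>1" "\<forall>w\<in>W. f.near_sup_persists M C w (e / 4) e1 \<rho>1"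
      using f.near_sup_walks[OF M(1) C(1) e4 W] by (elim exE conjE) (rule that)
    obtain e2 \<rho>2 where 2: "0 < e2" "0 < \<rho>2" "\<forall>w\<in>W. g.near_sup_persists M' C w (e / 4) e2 \<rho>2"
      using g.near_sup_walks[OF M'(1) C(1) e4 W] by (elim exE conjE) (rule that)
    obtain \<rho>3 where 3: "0 < \<rho>3" "\<forall>\<rho>. \<forall>y\<in>X. 0 < \<rho> \<and> \<rho> < \<rho>3 \<longrightarrow>
      (\<exists>a b. \<rho> \<le> a \<and> \<rho> \<le> b \<and> a \<le> C1 * \<rho> \<and> b \<le> C1 * \<rho> \<and> M - e1 < f y a b)"
      using C1(2)[rule_format, OF 1(1)] by (elim exE conjE) (rule that)
    obtain \<rho>4 where 4: "0 < \<rho>4" "\<forall>\<rho>. \<forall>y\<in>X. 0 < \<rho> \<and> \<rho> < \<rho>4 \<longrightarrow>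
      (\<exists>a b. \<rho> \<le> a \<and> \<rho> \<le> b \<and> a \<le> C2 * \<rho> \<and> b \<le> C2 * \<rho> \<and> M' - e2 < - f y a b)"
      using C2(2)[rule_format, OF 2(1)] by (elim exE conjE) (rule that)
    define D where "D = (real nr * real nl + real nl) * (real K + 2 * C)"
    have "0 < real nl" using nl by simp
    then have D: "0 < D" unfolding D_def using C by (intro mult_pos_pos add_nonneg_pos) auto
    define m where "m = min (min \<rho>1 \<rho>2) (min (min \<rho>3 \<rho>4) (\<delta> / D))"
    have "0 < \<delta> / D" using D \<eta> by simp
    then have m: "0 < m" unfolding m_def using 1(2) 2(2) 3(1) 4(1) by (simp only: min_less_iff_conj)
    have m_le: "m \<le> \<rho>1" "m \<le> \<rho>2" "m \<le> \<rho>3" "m \<le> \<rho>4" "m \<le> \<delta> / D"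
      unfolding m_def by (simp_all only: min.coboundedI1 min.coboundedI2 order_refl)
    define \<rho> where "\<rho> = m / 2"
    have "0 < \<rho>" "\<rho> < m" using m by (simp_all add: \<rho>_def)
    then have \<rho>: "0 < \<rho>" "\<rho> < \<rho>1" "\<rho> < \<rho>2" "\<rho> < \<rho>3" "\<rho> < \<rho>4" "\<rho> < \<delta> / D"
      using m_le by (blast intro: less_le_trans)+
    then have \<rho>D: "D * \<rho> < \<delta>" using D by (simp add: field_simps)
    obtain a b where ab: "\<rho> \<le> a" "\<rho> \<le> b" "a \<le> C1 * \<rho>" "b \<le> C1 * \<rho>" "M - e1 < f y a b"
      using 3(2) y \<rho> by blast
    obtain a' b' where ab': "\<rho> \<le> a'" "\<rho> \<le> b'" "a' \<le> C2 * \<rho>" "b' \<le> C2 * \<rho>" "M' - e2 < - f y a' b'"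
      using 4(2) y \<rho> by blast
    have C\<rho>: "C1 * \<rho> \<le> C * \<rho>" "C2 * \<rho> \<le> C * \<rho>" using C \<rho> by auto
    \<comment> \<open>After \<open>num a\<close> steps \<open>l\<close> the second coordinate is about \<open>nl K \<rho>\<close>, whatever \<open>a\<close> and \<open>b\<close> were; after \<open>nr\<close>
      further steps \<open>r\<close> so is the first one, up to the factor \<open>nr\<close>, and the label has returned to \<open>y\<close>.\<close>
    define num where "num a = nl * nat \<lfloor>real K * \<rho> / a\<rfloor>" for a
    define p1 where "p1 = real nl * (real K - C) * \<rho>"
    define p2 where "p2 = real nr * p1"
    have key: "replicate (num a) True @ replicate nr False \<in> W \<and>
        fold farey_step (replicate (num a) True @ replicate nr False) (a, b) =
          (a + real nr * (b + real (num a) * a), b + real (num a) * a) \<and>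
        walk l r (replicate (num a) True @ replicate nr False) y = y \<and>
        p1 \<le> b + real (num a) * a \<and> b + real (num a) * a \<le> (1 + \<eta>) * p1 \<and> b + real (num a) * a < \<delta> \<and>
        p2 \<le> a + real nr * (b + real (num a) * a) \<and> a + real nr * (b + real (num a) * a) \<le> (1 + \<eta>) * p2 \<and>
        a + real nr * (b + real (num a) * a) < \<delta>"
      if h: "\<rho> \<le> a" "\<rho> \<le> b" "a \<le> C * \<rho>" "b \<le> C * \<rho>" for a b
    proof -
      define m where "m = nat \<lfloor>real K * \<rho> / a\<rfloor>"
      define u where "u = b + real (num a) * a"
      have a: "0 < a" using h \<rho> by linarith
      have nonneg: "0 \<le> real K * \<rho> / a" using a \<rho> by simp
      have m: "real m \<le> real K * \<rho> / a" "real K * \<rho> / a < real m + 1"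
        unfolding m_def using nonneg by (auto simp: of_nat_nat)
      then have ma: "real m * a \<le> real K * \<rho>" "real K * \<rho> < real m * a + a"
        using a by (auto simp: field_simps)
      have num: "num a = nl * m" by (simp add: num_def m_def)
      have "real m * \<rho> \<le> real m * a" using h by (intro mult_left_mono) auto
      then have "real m * \<rho> \<le> real K * \<rho>" using ma by linarith
      then have "m \<le> K" using \<rho> by simp
      then have inW: "replicate (num a) True @ replicate nr False \<in> W" by (auto simp: W_def num)
      have lnum: "(l ^^ (nl * m)) y = y"
      proof (induction m)
        case (Suc m)
        then show ?case using nl y by (simp add: funpow_add)
      qed simp
      have nl1: "1 \<le> real nl" and nr1: "1 \<le> real nr" using nl nr by auto
      have lo: "p1 \<le> u"
      proof -
        have "real nl * (real K * \<rho> - C * \<rho>) \<le> real nl * (real m * a)"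
          using ma h by (intro mult_left_mono) auto
        then show ?thesis using h \<rho> by (simp add: u_def p1_def num algebra_simps)
      qed
      have hi: "u \<le> real nl * (real K + C) * \<rho>"
      proof -
        have "real nl * (real m * a) \<le> real nl * (real K * \<rho>)" using ma by (intro mult_left_mono) auto
        moreover have "1 * (C * \<rho>) \<le> real nl * (C * \<rho>)"
          using nl1 C \<rho> by (intro mult_right_mono) auto
        with h have "b \<le> real nl * (C * \<rho>)" by linarith
        ultimately show ?thesis by (simp add: u_def num algebra_simps)
      qed
      have hi': "a + real nr * u \<le> real nr * (real nl * (real K + 2 * C) * \<rho>)"
      proof -
        have "real nr * u \<le> real nr * (real nl * (real K + C) * \<rho>)" using hi by (intro mult_left_mono) auto
        moreover have "1 * 1 \<le> real nr * real nl" using nl1 nr1 by (intro mult_mono) auto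
        then have "1 * (C * \<rho>) \<le> real nr * real nl * (C * \<rho>)" using C \<rho> by (intro mult_right_mono) auto
        ultimately show ?thesis using h by (simp add: algebra_simps)
      qed
      have ref: "real nl * (real K + 2 * C) * \<rho> \<le> (1 + \<eta>) * p1"
      proof -
        have "real nl * (real K + 2 * C) * \<rho> \<le> real nl * ((1 + \<eta>) * (real K - C)) * \<rho>"
          using K2 \<rho> by (intro mult_right_mono mult_left_mono) auto
        then show ?thesis by (simp add: p1_def mult_ac)
      qed
      have hi2: "u \<le> real nl * (real K + 2 * C) * \<rho>"
      proof -
        have "real nl * (real K + C) * \<rho> \<le> real nl * (real K + 2 * C) * \<rho>"
          using C \<rho> by (intro mult_right_mono mult_left_mono) auto
        with hi show ?thesis by linarith
      qed
      have D1: "real nl * (real K + 2 * C) * \<rho> \<le> D * \<rho>" "real nr * (real nl * (real K + 2 * C) * \<rho>) \<le> D * \<rho>"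
        using C \<rho> by (auto simp: D_def algebra_simps)
      have "real nr * (real nl * (real K + 2 * C) * \<rho>) \<le> real nr * ((1 + \<eta>) * p1)"
        using ref by (intro mult_left_mono) auto
      then have ref2: "a + real nr * u \<le> (1 + \<eta>) * p2" using hi' by (simp add: p2_def mult_ac)
      have "real nr * p1 \<le> real nr * u" using lo by (intro mult_left_mono) auto
      then have lo2: "p2 \<le> a + real nr * u" using a by (simp add: p2_def)
      have path: "fold farey_step (replicate (num a) True @ replicate nr False) (a, b) = (a + real nr * u, u)"
        by (simp only: fold_append comp_apply fold_farey_step_replicate u_def)
      have lab: "walk l r (replicate (num a) True @ replicate nr False) y = y"
        using lnum nr(2) y by (simp only: fold_append comp_apply walk_replicate num)
      have bd: "u < \<delta>" "a + real nr * u < \<delta>" "u \<le> (1 + \<eta>) * p1"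
        using hi2 hi' D1 \<rho>D ref by linarith+
      show ?thesis
        unfolding u_def[symmetric] using inW path lab lo lo2 ref2 bd by blast
    qed
    have p: "0 < p1" "0 < p2" using nl nr KC \<rho> by (auto simp: p1_def p2_def)
    let ?w = "replicate (num a) True @ replicate nr False" and ?w' = "replicate (num a') True @ replicate nr False"
    let ?u = "b + real (num a) * a" and ?u' = "b' + real (num a') * a'"
    have h: "a \<le> C * \<rho>" "b \<le> C * \<rho>" "a' \<le> C * \<rho>" "b' \<le> C * \<rho>" using ab ab' C\<rho> by linarith+
    note k = key[OF ab(1,2) h(1,2)] and k' = key[OF ab'(1,2) h(3,4)]
    have "M - e / 4 < f (walk l r ?w y) (a + real nr * ?u) ?u"
      using k 1(3) by (intro f.near_sup_persistsD[OF _ y \<rho>(1,2) ab(1,2) h(1,2) ab(5)]) auto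
    then have s1: "M - e / 4 < f y (a + real nr * ?u) ?u" using k by simp
    have "M' - e / 4 < - f (walk l r ?w' y) (a' + real nr * ?u') ?u'"
      using k' 2(3) by (intro g.near_sup_persistsD[OF _ y \<rho>(1,3) ab'(1,2) h(3,4) ab'(5)]) auto
    then have s2: "M' - e / 4 < - f y (a' + real nr * ?u') ?u'" using k' by simp
    have "\<bar>f y p2 p1 - f y (a + real nr * ?u) ?u\<bar> < e / 4"
      by (rule c[rule_format, OF y]) (use k p in auto)
    moreover have "\<bar>f y p2 p1 - f y (a' + real nr * ?u') ?u'\<bar> < e / 4"
      by (rule c[rule_format, OF y]) (use k' p in auto)
    ultimately show ?thesis using s1 s2 by linarith
  qed
  \<comment> \<open>In other words, the upper limit \<open>M\<close> is at most the lower limit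
    \<open>- M'\<close>.\<close>
  then have MM: "M + M' \<le> 0" by (rule field_le_epsilon[of "M + M'" 0, simplified])
  show ?thesis
  proof (rule exI[of _ M], intro allI impI)
    fix e :: real assume e: "0 < e"
    obtain \<delta>1 where 1: "0 < \<delta>1"
      "\<And>y a b. y \<in> X \<Longrightarrow> 0 < a \<Longrightarrow> 0 < b \<Longrightarrow> a < \<delta>1 \<Longrightarrow> b < \<delta>1 \<Longrightarrow> f y a b < M + e"
      using f.eventual_upper_boundE[OF M(1) e] by metis
    obtain \<delta>2 where 2: "0 < \<delta>2"
      "\<And>y a b. y \<in> X \<Longrightarrow> 0 < a \<Longrightarrow> 0 < b \<Longrightarrow> a < \<delta>2 \<Longrightarrow> b < \<delta>2 \<Longrightarrow> - f y a b < M' + e"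
      using g.eventual_upper_boundE[OF M'(1) e] by metis
    have "\<bar>f x a b - M\<bar> < e" if "x \<in> X" "0 < a" "0 < b" "a < min \<delta>1 \<delta>2" "b < min \<delta>1 \<delta>2" for x a b
      using 1(2)[of x a b] 2(2)[of x a b] that MM by auto
    then show "\<exists>\<delta>>0. \<forall>x\<in>X. \<forall>a b. 0 < a \<and> a < \<delta> \<and> 0 < b \<and> b < \<delta> \<longrightarrow> \<bar>f x a b - M\<bar> < e"
      using 1 2 by (intro exI[of _ "min \<delta>1 \<delta>2"]) auto
  qed
qed

section \<open>Lattice points in cones\<close>

definition cone_points :: "(int \<times> int) set \<Rightarrow> real \<Rightarrow> real \<Rightarrow> (int \<times> int) set" where
  "cone_points A a b = {(s, t). (s, t) \<in> A \<and> 1 \<le> s \<and> 1 \<le> t \<and> of_int s * a + of_int t * b \<le> 1}"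

text \<open>The triangle has area \<open>1 / (2 * a * b)\<close>, so the factor normalizes the full
  lattice to density one. Only vectors in the interior of the cone are counted, which keeps the
  counts of adjacent cones disjoint.\<close>

definition cone_density :: "(int \<times> int) set \<Rightarrow> real \<Rightarrow> real \<Rightarrow> real" where
  "cone_density A a b = 2 * a * b * real (card (cone_points A a b))"

text \<open>The vectors of \<open>A\<close> in the cone spanned by \<open>e\<^sub>1\<close> and \<open>e\<^sub>1 + e\<^sub>2\<close>, respectively \<open>e\<^sub>1 + e\<^sub>2\<close> and \<open>e\<^sub>2\<close>, in the
  coordinates of that cone.\<close>

definition shear_left :: "(int \<times> int) set \<Rightarrow> (int \<times> int) set" where
  "shear_left A = {(s, t). (s + t, t) \<in> A}"

definition shear_right :: "(int \<times> int) set \<Rightarrow> (int \<times> int) set" where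
  "shear_right A = {(s, t). (s, s + t) \<in> A}"

definition primitive_vectors :: "(int \<times> int) set" where
  "primitive_vectors = {(s, t). coprime s t}"

lemma inj_shear_left: "inj shear_left"
proof (rule injI)
  fix A B assume h: "shear_left A = shear_left B"
  have "(s, t) \<in> A \<longleftrightarrow> (s, t) \<in> B" for s t
  proof -
    have "(s - t, t) \<in> shear_left A \<longleftrightarrow> (s - t, t) \<in> shear_left B" by (simp only: h)
    then show ?thesis by (simp add: shear_left_def)
  qed
  then show "A = B" by auto
qed

lemma inj_shear_right: "inj shear_right"
proof (rule injI)
  fix A B assume h: "shear_right A = shear_right B"
  have "(s, t) \<in> A \<longleftrightarrow> (s, t) \<in> B" for s t
  proof -
    have "(s, t - s) \<in> shear_right A \<longleftrightarrow> (s, t - s) \<in> shear_right B" by (simp only: h)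
    then show ?thesis by (simp add: shear_right_def)
  qed
  then show "A = B" by auto
qed

lemma cone_points_UNIV_eq:
  assumes "0 < a" "0 < b"
  shows "cone_points UNIV a b =
    (\<lambda>(t, s). (s, int t)) ` (SIGMA t:{1..nat \<lfloor>1 / b\<rfloor>}. {1..\<lfloor>(1 - real t * b) / a\<rfloor>})" (is "?L = ?R")
proof (intro equalityI subsetI)
  fix v assume "v \<in> ?L"
  then obtain s t where v: "v = (s, t)" and st: "1 \<le> s" "1 \<le> t" "of_int s * a + of_int t * b \<le> 1"
    by (auto simp: cone_points_def)
  have "0 < of_int s * a" using st assms by simp
  then have "of_int t * b \<le> 1" using st by linarith
  then have "of_int t \<le> 1 / b" using assms by (simp add: field_simps)
  then have "t \<le> \<lfloor>1 / b\<rfloor>" by (simp add: le_floor_iff)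
  moreover have "s \<le> \<lfloor>(1 - of_int t * b) / a\<rfloor>" using st assms by (simp add: le_floor_iff field_simps)
  ultimately show "v \<in> ?R" using st v by (intro image_eqI[of _ _ "(nat t, s)"]) auto
next
  fix v assume "v \<in> ?R"
  then obtain s t where v: "v = (s, int t)" and t: "1 \<le> t" and s: "1 \<le> s" "s \<le> \<lfloor>(1 - real t * b) / a\<rfloor>"
    by auto
  from s(2) have "of_int s \<le> (1 - real t * b) / a" by (simp add: le_floor_iff)
  then have "of_int s * a + real t * b \<le> 1" using assms by (simp add: field_simps)
  then show "v \<in> ?L" using v s t by (simp add: cone_points_def)
qed

lemma finite_cone_points:
  assumes "0 < a" "0 < b"
  shows "finite (cone_points A a b)"
proof (rule finite_subset)
  show "cone_points A a b \<subseteq> cone_points UNIV a b" by (auto simp: cone_points_def)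
  show "finite (cone_points UNIV a b)" unfolding cone_points_UNIV_eq[OF assms] by (intro finite_imageI finite_SigmaI) auto
qed

lemma card_cone_points_UNIV:
  assumes "0 < a" "0 < b"
  shows "real (card (cone_points UNIV a b)) = (\<Sum>t = 1..nat \<lfloor>1 / b\<rfloor>. of_int \<lfloor>(1 - real t * b) / a\<rfloor>)"
proof -
  have "inj_on (\<lambda>(t, s). (s, int t)) S" for S :: "(nat \<times> int) set" by (auto simp: inj_on_def)
  then have "card (cone_points UNIV a b) = (\<Sum>t = 1..nat \<lfloor>1 / b\<rfloor>. card {1..\<lfloor>(1 - real t * b) / a\<rfloor>})"
    unfolding cone_points_UNIV_eq[OF assms] by (subst card_image) auto
  also have "real \<dots> = (\<Sum>t = 1..nat \<lfloor>1 / b\<rfloor>. of_int \<lfloor>(1 - real t * b) / a\<rfloor>)"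
    unfolding of_nat_sum
  proof (rule sum.cong)
    fix t assume t: "t \<in> {1..nat \<lfloor>1 / b\<rfloor>}"
    then have "int t \<le> \<lfloor>1 / b\<rfloor>" by auto
    then have "real t \<le> 1 / b" by (simp add: le_floor_iff)
    then have "0 \<le> (1 - real t * b) / a" using assms by (simp add: field_simps)
    then show "real (card {1..\<lfloor>(1 - real t * b) / a\<rfloor>}) = of_int \<lfloor>(1 - real t * b) / a\<rfloor>" by simp
  qed simp
  finally show ?thesis .
qed

lemma sum_arithmetic: "(\<Sum>t = 1..k. 1 - real t * b) = real k - b * real k * (real k + 1) / 2"
  by (induction k) (auto simp: field_simps)

text \<open>Row \<open>t\<close> contains the integer part of \<open>(1 - t b) / a\<close> points.
  Without rounding the sum is an arithmetic series with value close to \<open>1 / (2 a b)\<close>.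
  Rounding down can only lose points, so the upper bound is clean; it loses at most one point per
  row, which gives the lower bound.\<close>

lemma card_cone_points_UNIV_bounds:
  assumes a: "0 < a" and b: "0 < b"
  shows "2 * a * b * card (cone_points UNIV a b) \<le> 1"
    and "b \<le> 1 \<Longrightarrow> 1 - 2 * a - 2 * b \<le> 2 * a * b * card (cone_points UNIV a b)"
proof -
  define k where "k = nat \<lfloor>1 / b\<rfloor>"
  define x where "x = real k * b"
  have k: "real k \<le> 1 / b" "1 / b < real k + 1"
    unfolding k_def using b by (auto simp: of_nat_nat)
  then have x: "x \<le> 1" "1 < x + b" using b by (auto simp: x_def field_simps)
  have "0 \<le> x" using b by (simp add: x_def)
  have "a * real (card (cone_points UNIV a b)) = (\<Sum>t = 1..k. a * of_int \<lfloor>(1 - real t * b) / a\<rfloor>)"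
    by (simp add: card_cone_points_UNIV[OF a b] k_def sum_distrib_left)
  also have "\<dots> \<le> (\<Sum>t = 1..k. 1 - real t * b)"
  proof (rule sum_mono)
    fix t
    have "of_int \<lfloor>(1 - real t * b) / a\<rfloor> \<le> (1 - real t * b) / a" by simp
    from mult_left_mono[OF this less_imp_le[OF a]]
    show "a * of_int \<lfloor>(1 - real t * b) / a\<rfloor> \<le> 1 - real t * b" using a by simp
  qed
  finally have "2 * b * (a * card (cone_points UNIV a b)) \<le> 2 * b * (real k - b * real k * (real k + 1) / 2)"
    unfolding sum_arithmetic using b by (intro mult_left_mono) auto
  also have "\<dots> = 1 - (1 - x)\<^sup>2 - x * b" by (simp add: x_def power2_eq_square field_simps)
  also have "\<dots> \<le> 1" using mult_nonneg_nonneg[OF \<open>0 \<le> x\<close> less_imp_le[OF b]] zero_le_power2[of "1 - x"] by linarith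
  finally show "2 * a * b * card (cone_points UNIV a b) \<le> 1" by (simp add: mult_ac)
  assume b1: "b \<le> 1"
  have "1 - b\<^sup>2 - b - 2 * a \<le> 1 - (1 - x)\<^sup>2 - x * b - 2 * x * a"
  proof -
    have "(1 - x)\<^sup>2 \<le> b\<^sup>2" using x by (intro power_mono) auto
    moreover have "x * b \<le> 1 * b" "x * a \<le> 1 * a" using x a b by (intro mult_right_mono; simp)+
    ultimately show ?thesis by simp
  qed
  also have "\<dots> = 2 * b * ((\<Sum>t = 1..k. 1 - real t * b) - real k * a)"
    unfolding sum_arithmetic by (simp add: x_def power2_eq_square field_simps)
  also have "(\<Sum>t = 1..k. 1 - real t * b) - real k * a = (\<Sum>t = 1..k. 1 - real t * b - a)"
    by (simp add: sum_subtractf)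
  also have "\<dots> \<le> (\<Sum>t = 1..k. a * of_int \<lfloor>(1 - real t * b) / a\<rfloor>)"
  proof (rule sum_mono)
    fix t
    have "(1 - real t * b) / a - 1 \<le> of_int \<lfloor>(1 - real t * b) / a\<rfloor>" by linarith
    from mult_left_mono[OF this less_imp_le[OF a]]
    have "a * ((1 - real t * b) / a) - a * 1 \<le> a * of_int \<lfloor>(1 - real t * b) / a\<rfloor>"
      by (simp only: right_diff_distrib)
    then show "1 - real t * b - a \<le> a * of_int \<lfloor>(1 - real t * b) / a\<rfloor>" using a by simp
  qed
  also have "\<dots> = a * real (card (cone_points UNIV a b))"
    by (simp add: card_cone_points_UNIV[OF a b] k_def sum_distrib_left)
  finally have "1 - b\<^sup>2 - b - 2 * a \<le> 2 * b * (a * real (card (cone_points UNIV a b)))" using b by simp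
  moreover have "b\<^sup>2 \<le> b" using b b1 by (simp add: power2_eq_square mult_left_le)
  ultimately show "1 - 2 * a - 2 * b \<le> 2 * a * b * card (cone_points UNIV a b)" by (simp add: mult_ac)
qed

lemma cone_density_bounds:
  assumes "0 < a" "0 < b"
  shows "0 \<le> cone_density A a b" "cone_density A a b \<le> 1"
proof -
  show "0 \<le> cone_density A a b" using assms by (simp add: cone_density_def)
  have "card (cone_points A a b) \<le> card (cone_points UNIV a b)"
    by (intro card_mono finite_cone_points assms) (auto simp: cone_points_def)
  then have "cone_density A a b \<le> 2 * a * b * card (cone_points UNIV a b)"
    unfolding cone_density_def using assms by (intro mult_left_mono) auto
  with card_cone_points_UNIV_bounds(1)[OF assms] show "cone_density A a b \<le> 1" by simp
qed

text \<open>Vectors with \<open>s > t\<close> lie in the left subcone and those with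
  \<open>s < t\<close> in the right one. On the diagonal primitivity leaves at most
  \<open>(1, 1)\<close>, whose contribution \<open>2 * a * b\<close> is the error term.\<close>

lemma cone_density_harmonic:
  assumes a: "0 < a" and b: "0 < b" and A: "A \<subseteq> primitive_vectors"
  shows "\<bar>cone_density A a b - (b / (a + b) * cone_density (shear_left A) a (a + b) +
    a / (a + b) * cone_density (shear_right A) (a + b) b)\<bar> \<le> 2 * a * b"
proof -
  define L where "L = (\<lambda>(s, t). (s + t, t)) ` cone_points (shear_left A) a (a + b)"
  define R where "R = (\<lambda>(s, t). (s, s + t)) ` cone_points (shear_right A) (a + b) b"
  define D where "D = cone_points A a b \<inter> {(1, 1)}"
  have ab: "0 < a + b" using a b by simp
  have fin: "finite L" "finite R" "finite D"
    unfolding L_def R_def D_def using a b ab by (auto intro!: finite_imageI finite_cone_points)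
  have L_iff: "(s, t) \<in> L \<longleftrightarrow> (s, t) \<in> cone_points A a b \<and> t < s" for s t
  proof -
    have "(s, t) \<in> L \<longleftrightarrow> (s - t, t) \<in> cone_points (shear_left A) a (a + b)"
      by (force simp: L_def image_iff)
    then show ?thesis by (auto simp: cone_points_def shear_left_def algebra_simps)
  qed
  have R_iff: "(s, t) \<in> R \<longleftrightarrow> (s, t) \<in> cone_points A a b \<and> s < t" for s t
  proof -
    have "(s, t) \<in> R \<longleftrightarrow> (s, t - s) \<in> cone_points (shear_right A) (a + b) b"
      by (force simp: R_def image_iff)
    then show ?thesis by (auto simp: cone_points_def shear_right_def algebra_simps)
  qed
  have D_iff: "(s, t) \<in> D \<longleftrightarrow> (s, t) \<in> cone_points A a b \<and> s = t" for s t
    using A by (auto simp: D_def cone_points_def primitive_vectors_def)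
  have "cone_points A a b = L \<union> R \<union> D"
    by (auto simp: L_iff R_iff D_iff)
  moreover have "L \<inter> R = {}" "(L \<union> R) \<inter> D = {}" by (auto simp: L_iff R_iff D_iff)
  ultimately have "card (cone_points A a b) = card L + card R + card D"
    using fin by (simp add: card_Un_disjoint)
  moreover have "card L = card (cone_points (shear_left A) a (a + b))"
    unfolding L_def by (intro card_image) (auto simp: inj_on_def)
  moreover have "card R = card (cone_points (shear_right A) (a + b) b)"
    unfolding R_def by (intro card_image) (auto simp: inj_on_def)
  ultimately have c: "card (cone_points A a b) = card (cone_points (shear_left A) a (a + b)) +
    card (cone_points (shear_right A) (a + b) b) + card D" by simp
  have w: "b / (a + b) * (2 * a * (a + b) * u) = 2 * a * b * u" "a / (a + b) * (2 * (a + b) * b * u) = 2 * a * b * u" for u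
    using ab by (auto simp: field_simps)
  have "cone_density A a b - (b / (a + b) * cone_density (shear_left A) a (a + b) +
    a / (a + b) * cone_density (shear_right A) (a + b) b) = 2 * a * b * card D"
    unfolding cone_density_def w c by (simp add: algebra_simps)
  moreover have "card D \<le> card {(1 :: int, 1 :: int)}" unfolding D_def by (intro card_mono) auto
  then have "card D \<le> 1" by simp
  then have "2 * a * b * real (card D) \<le> 2 * a * b * 1" using a b by (intro mult_left_mono) auto
  ultimately show ?thesis using a b by simp
qed

text \<open>The bound is uniform in \<open>A\<close>: lowering the coordinates from
  \<open>(a', b')\<close> to \<open>(a, b)\<close> only adds points, and no more of them than in the
  full lattice, where the density is one up to an error linear in the coordinates.\<close>

lemma cone_density_continuity:
  assumes e: "0 < e"
  shows "\<exists>\<eta>>0. \<exists>\<delta>>0. \<forall>A a b a' b'. 0 < a \<and> a \<le> a' \<and> a' \<le> (1 + \<eta>) * a \<and>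
      0 < b \<and> b \<le> b' \<and> b' \<le> (1 + \<eta>) * b \<and> a' < \<delta> \<and> b' < \<delta> \<longrightarrow> \<bar>cone_density A a b - cone_density A a' b'\<bar> < e"
proof (rule pos_pos_exI[of "min 1 (e / 8)" "min 1 (e / 16)"])
  show "\<forall>A a b a' b'. 0 < a \<and> a \<le> a' \<and> a' \<le> (1 + min 1 (e / 8)) * a \<and>
      0 < b \<and> b \<le> b' \<and> b' \<le> (1 + min 1 (e / 8)) * b \<and> a' < min 1 (e / 16) \<and> b' < min 1 (e / 16) \<longrightarrow>
      \<bar>cone_density A a b - cone_density A a' b'\<bar> < e"
  proof (intro allI impI; elim conjE)
    fix A a b a' b'
    define \<eta> where "\<eta> = min 1 (e / 8)"
    assume a: "0 < a" "a \<le> a'" "a' \<le> (1 + min 1 (e / 8)) * a"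
      and b: "0 < b" "b \<le> b'" "b' \<le> (1 + min 1 (e / 8)) * b" and small: "a' < min 1 (e / 16)" "b' < min 1 (e / 16)"
    have \<eta>: "0 < \<eta>" "\<eta> \<le> 1" "\<eta> \<le> e / 8" using e by (auto simp: \<eta>_def)
    have a': "0 < a'" and b': "0 < b'" using a b by auto
    have shrink: "(1 - \<eta>) * x' \<le> x" if "x' \<le> (1 + \<eta>) * x" "0 < x" for x x'
    proof -
      have "(1 - \<eta>) * x' \<le> (1 - \<eta>) * ((1 + \<eta>) * x)" using that \<eta> by (intro mult_left_mono) auto
      also have "\<dots> = x - \<eta> * \<eta> * x" by (simp add: algebra_simps)
      also have "\<dots> \<le> x" using that by simp
      finally show ?thesis .
    qed
    \<comment> \<open>The ratio of the area of the smaller triangle, which belongs to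
      \<open>(a', b')\<close>, to that of the larger one.\<close>
    define q where "q = a * b / (a' * b')"
    have "((1 - \<eta>) * a') * ((1 - \<eta>) * b') \<le> a * b"
      using shrink[of a' a] shrink[of b' b] a b a' b' \<eta> by (intro mult_mono) (auto simp: \<eta>_def)
    moreover have "(1 - 2 * \<eta>) * (a' * b') \<le> ((1 - \<eta>) * a') * ((1 - \<eta>) * b')"
    proof -
      have "((1 - \<eta>) * a') * ((1 - \<eta>) * b') = (1 - 2 * \<eta>) * (a' * b') + \<eta> * \<eta> * (a' * b')" by (simp add: algebra_simps)
      moreover have "0 \<le> \<eta> * \<eta> * (a' * b')" using a' b' by simp
      ultimately show ?thesis by linarith
    qed
    ultimately have "(1 - 2 * \<eta>) * (a' * b') \<le> a * b" by linarith
    then have q: "1 - 2 * \<eta> \<le> q" using a' b' by (simp add: q_def field_simps)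
    have "a * b \<le> a' * b'" using a b by (intro mult_mono) auto
    then have q1: "q \<le> 1" "0 \<le> q" using a' b' a b by (auto simp: q_def field_simps)
    have ab: "a * b = q * (a' * b')" using a' b' by (simp add: q_def)
    let ?n = "\<lambda>A. real (card (cone_points A a b))" and ?n' = "\<lambda>A. real (card (cone_points A a' b'))"
    have sub: "cone_points A a' b' \<subseteq> cone_points A a b" for A
    proof -
      have "of_int s * a + of_int t * b \<le> of_int s * a' + of_int t * b'" if "1 \<le> s" "1 \<le> t" for s t
        using that a b by (intro add_mono mult_left_mono) auto
      then show ?thesis by (fastforce simp: cone_points_def)
    qed
    have le: "?n' A \<le> ?n A" by (simp add: card_mono finite_cone_points a b sub)
    have diff: "real (card (cone_points A a b - cone_points A a' b')) = ?n A - ?n' A" for A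
      using sub[of A] finite_cone_points[OF a(1) b(1), of A]
      by (subst card_Diff_subset) (auto intro: finite_subset simp: of_nat_diff card_mono)
    have "?n A - ?n' A \<le> ?n UNIV - ?n' UNIV"
      unfolding diff[symmetric] using a b
      by (intro of_nat_mono card_mono finite_Diff finite_cone_points) (auto simp: cone_points_def)
    then have "2 * (a * b) * (?n A - ?n' A) \<le> 2 * (a * b) * (?n UNIV - ?n' UNIV)"
      using a b by (intro mult_left_mono) auto
    also have "\<dots> = 2 * a * b * ?n UNIV - q * (2 * a' * b' * ?n' UNIV)"
      by (simp add: ab algebra_simps)
    also have "\<dots> \<le> 1 - q * (1 - 2 * a' - 2 * b')"
      using card_cone_points_UNIV_bounds[OF a(1) b(1)] card_cone_points_UNIV_bounds(2)[OF a' b'] small q1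
      by (intro diff_mono mult_left_mono) auto
    also have "\<dots> = (1 - q) + q * (2 * a' + 2 * b')" by (simp add: algebra_simps)
    also have "q * (2 * a' + 2 * b') \<le> 1 * (2 * a' + 2 * b')" using q1 a' b' by (intro mult_right_mono) auto
    finally have 1: "2 * (a * b) * (?n A - ?n' A) \<le> 2 * \<eta> + 2 * a' + 2 * b'" using q by simp
    have "cone_density A a' b' \<le> 1" "0 \<le> cone_density A a' b'" by (rule cone_density_bounds[OF a' b'])+
    then have "(1 - q) * cone_density A a' b' \<le> (1 - q) * 1" "0 \<le> (1 - q) * cone_density A a' b'"
      using q1 by (intro mult_left_mono mult_nonneg_nonneg; simp)+
    moreover have "cone_density A a b - cone_density A a' b' =
      2 * (a * b) * (?n A - ?n' A) - (1 - q) * cone_density A a' b'"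
      unfolding cone_density_def by (simp add: ab algebra_simps)
    moreover have "0 \<le> 2 * (a * b) * (?n A - ?n' A)" using a b le by simp
    ultimately show "\<bar>cone_density A a b - cone_density A a' b'\<bar> < e"
      using 1 q \<eta> small e by (auto simp: abs_if)
  qed
qed (use e in auto)

theorem cone_density_limit:
  assumes fin: "finite \<A>" and ne: "\<A> \<noteq> {}" and prim: "\<And>A. A \<in> \<A> \<Longrightarrow> A \<subseteq> primitive_vectors"
    and closed: "\<And>A. A \<in> \<A> \<Longrightarrow> shear_left A \<in> \<A>" "\<And>A. A \<in> \<A> \<Longrightarrow> shear_right A \<in> \<A>"
    and trans: "\<And>A B. A \<in> \<A> \<Longrightarrow> B \<in> \<A> \<Longrightarrow> \<exists>w. walk shear_left shear_right w A = B"
  shows "\<exists>c. \<forall>e>0. \<exists>\<delta>>0. \<forall>A\<in>\<A>. \<forall>a b. 0 < a \<and> a < \<delta> \<and> 0 < b \<and> b < \<delta> \<longrightarrow> \<bar>cone_density A a b - c\<bar> < e"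
proof (rule quasi_harmonic_limit[where B = 1 and E = 2])
  show "quasi_harmonic \<A> shear_left shear_right cone_density 2"
  proof
    fix A a b assume "A \<in> \<A>" "0 < (a::real)" "0 < (b::real)"
    then show "\<bar>cone_density A a b - (b / (a + b) * cone_density (shear_left A) a (a + b) +
      a / (a + b) * cone_density (shear_right A) (a + b) b)\<bar> \<le> 2 * a * b"
      by (intro cone_density_harmonic prim)
  qed (auto simp: closed)
  show "inj_on shear_left \<A>" "inj_on shear_right \<A>"
    using inj_shear_left inj_shear_right by (auto intro: inj_on_subset)
  show "\<bar>cone_density A a b\<bar> \<le> 1" if "A \<in> \<A>" "0 < a" "0 < b" for A a b
    using cone_density_bounds[OF that(2,3), of A] by simp
  fix e :: real assume "0 < e"
  from cone_density_continuity[OF this] obtain \<eta> \<delta> where "0 < \<eta>" "0 < \<delta>"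
    "\<forall>A a b a' b'. 0 < a \<and> a \<le> a' \<and> a' \<le> (1 + \<eta>) * a \<and>
      0 < b \<and> b \<le> b' \<and> b' \<le> (1 + \<eta>) * b \<and> a' < \<delta> \<and> b' < \<delta> \<longrightarrow> \<bar>cone_density A a b - cone_density A a' b'\<bar> < e"
    by (elim exE conjE) (rule that)
  then show "\<exists>\<eta>>0. \<exists>\<delta>>0. \<forall>A\<in>\<A>. \<forall>a b a' b'. 0 < a \<and> a \<le> a' \<and> a' \<le> (1 + \<eta>) * a \<and>
      0 < b \<and> b \<le> b' \<and> b' \<le> (1 + \<eta>) * b \<and> a' < \<delta> \<and> b' < \<delta> \<longrightarrow> \<bar>cone_density A a b - cone_density A a' b'\<bar> < e"
    by (intro pos_pos_exI[of \<eta> \<delta>]) simp_all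
qed (use fin ne trans in auto)

section \<open>The density of the primitive vectors\<close>

text \<open>Sorting all lattice points by the greatest common divisor of their coordinates.\<close>

lemma cone_points_UNIV_primitive:
  assumes m: "0 < (m :: nat)"
  shows "real (card (cone_points UNIV (1 / m) (1 / m))) =
    (\<Sum>d = 1..m. real (card (cone_points primitive_vectors (real d / real m) (real d / real m))))"
proof -
  define S where "S d = (\<lambda>(s, t). (int d * s, int d * t)) ` cone_points primitive_vectors (real d / m) (real d / m)" for d :: nat
  have S_iff: "(s, t) \<in> S d \<longleftrightarrow> (s, t) \<in> cone_points UNIV (1 / m) (1 / m) \<and> gcd s t = int d" if d: "1 \<le> d" for s t d
  proof
    assume "(s, t) \<in> S d"
    then obtain s' t' where st: "s = int d * s'" "t = int d * t'" and h: "coprime s' t'" "1 \<le> s'" "1 \<le> t'"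
      "of_int s' * (real d / m) + of_int t' * (real d / m) \<le> 1"
      by (auto simp: S_def cone_points_def primitive_vectors_def)
    have "1 * 1 \<le> int d * s'" "1 * 1 \<le> int d * t'" using h d by (intro mult_mono; simp)+
    moreover have "gcd (int d * s') (int d * t') = int d"
      using h gcd_mult_distrib_int[of "int d" s' t'] by (simp add: coprime_iff_gcd_eq_1)
    moreover have "of_int s * (1 / real m) + of_int t * (1 / real m) \<le> 1" using h by (simp add: st mult_ac)
    ultimately show "(s, t) \<in> cone_points UNIV (1 / m) (1 / m) \<and> gcd s t = int d"
      using st by (simp add: cone_points_def)
  next
    assume h: "(s, t) \<in> cone_points UNIV (1 / m) (1 / m) \<and> gcd s t = int d"
    then obtain s' t' where st: "s = int d * s'" "t = int d * t'" by (metis gcd_dvd1 gcd_dvd2 dvdE)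
    have "int d * gcd s' t' = int d" using h gcd_mult_distrib_int[of "int d" s' t'] unfolding st by simp
    then have "coprime s' t'" using d by (simp add: coprime_iff_gcd_eq_1)
    moreover have "0 < int d * s'" "0 < int d * t'" using h by (auto simp: st cone_points_def)
    then have "1 \<le> s'" "1 \<le> t'" using d by (auto simp: zero_less_mult_iff)
    moreover have "of_int s' * (real d / m) + of_int t' * (real d / m) \<le> 1"
      using h by (simp add: st cone_points_def mult_ac)
    ultimately have "(s', t') \<in> cone_points primitive_vectors (real d / m) (real d / m)"
      by (simp add: cone_points_def primitive_vectors_def)
    then show "(s, t) \<in> S d" unfolding S_def st by (force intro: image_eqI[of _ _ "(s', t')"])
  qed
  have "cone_points UNIV (1 / m) (1 / m) = (\<Union>d\<in>{1..m}. S d)"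
  proof (intro equalityI subsetI)
    fix v assume v: "v \<in> cone_points UNIV (1 / m) (1 / m)"
    then obtain s t where st: "v = (s, t)" "1 \<le> s" "1 \<le> t" "of_int s * (1 / m) + of_int t * (1 / m) \<le> 1"
      by (auto simp: cone_points_def)
    then have "of_int s + of_int t \<le> real m" using m by (simp add: field_simps)
    then have "s \<le> int m" using st by linarith
    moreover have "gcd s t \<le> s" using st by (intro zdvd_imp_le) auto
    moreover have "1 \<le> gcd s t" using st by (smt (verit) gcd_pos_int)
    ultimately have g: "1 \<le> gcd s t" "gcd s t \<le> int m" by linarith+
    then have "nat (gcd s t) \<in> {1..m}" by (simp add: nat_le_iff)
    moreover have "(s, t) \<in> S (nat (gcd s t))" using v st g by (subst S_iff) auto
    ultimately have "nat (gcd s t) \<in> {1..m}" "(s, t) \<in> S (nat (gcd s t))" by blast+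
    then show "v \<in> (\<Union>d\<in>{1..m}. S d)" using st by blast
  next
    fix v assume "v \<in> (\<Union>d\<in>{1..m}. S d)"
    then show "v \<in> cone_points UNIV (1 / m) (1 / m)" using S_iff by (cases v) auto
  qed
  moreover have "card (\<Union>d\<in>{1..m}. S d) = (\<Sum>d = 1..m. card (S d))"
  proof (rule card_UN_disjoint)
    show "\<forall>d\<in>{1..m}. finite (S d)" using m by (auto simp: S_def intro!: finite_imageI finite_cone_points)
    show "\<forall>i\<in>{1..m}. \<forall>j\<in>{1..m}. i \<noteq> j \<longrightarrow> S i \<inter> S j = {}" using S_iff by auto
  qed simp
  moreover have "card (S d) = card (cone_points primitive_vectors (real d / real m) (real d / real m))" if "d \<in> {1..m}" for d
    unfolding S_def using that by (intro card_image) (auto simp: inj_on_def)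
  ultimately show ?thesis by simp
qed

text \<open>At \<open>a = b = 1 / m\<close> the integral vectors whose coordinates have greatest
  common divisor \<open>d\<close> are \<open>d\<close> times primitive vectors for
  \<open>d / m\<close>, so the total density is the sum of \<open>H (d / m) / d^2\<close>. For
  growing \<open>m\<close> it tends to one, while the terms tend to \<open>c / d^2\<close>. Since
  \<open>H\<close> is at most one, Tannery's theorem permits the interchange, and
  \<open>c * (pi^2 / 6) = 1\<close> follows.\<close>

lemma primitive_density:
  assumes lim: "\<And>e. 0 < e \<Longrightarrow> \<exists>\<delta>>0. \<forall>a b. 0 < a \<and> a < \<delta> \<and> 0 < b \<and> b < \<delta> \<longrightarrow>
    \<bar>cone_density primitive_vectors a b - c\<bar> < e"
  shows "c = 6 / pi\<^sup>2"
proof -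
  define H where "H x = cone_density primitive_vectors x x" for x
  have H_lim: "(H \<longlongrightarrow> c) (at_right 0)"
  proof (rule tendstoI)
    fix e :: real assume "0 < e"
    from lim[OF this] obtain \<delta> where "0 < \<delta>" "\<forall>a b. 0 < a \<and> a < \<delta> \<and> 0 < b \<and> b < \<delta> \<longrightarrow>
      \<bar>cone_density primitive_vectors a b - c\<bar> < e" by blast
    then show "\<forall>\<^sub>F x in at_right 0. dist (H x) c < e"
      unfolding eventually_at_right_field by (intro exI[of _ \<delta>]) (auto simp: H_def dist_real_def)
  qed
  \<comment> \<open>This turns the finite sum over \<open>d \<le> m\<close> into an infinite series
    with an index range independent of \<open>m\<close>, as Tannery's theorem demands.\<close>
  have H_zero: "H x = 0" if "1 \<le> x" for x
  proof -
    have "cone_points primitive_vectors x x = {}"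
    proof -
      have "1 < of_int s * x + of_int t * x" if "1 \<le> s" "1 \<le> t" for s t :: int
        using that \<open>1 \<le> x\<close> mult_mono[of 1 "of_int s" 1 x] mult_mono[of 1 "of_int t" 1 x] by force
      then show ?thesis by (fastforce simp: cone_points_def)
    qed
    then show ?thesis by (simp add: H_def cone_density_def)
  qed
  define F where "F k n = H (real (Suc k) / real (Suc n)) / (real (Suc k))\<^sup>2" for k n
  have sums: "(\<lambda>k. 1 / (real (Suc k))\<^sup>2) sums (pi\<^sup>2 / 6)" using inverse_squares_sums by (simp add: add.commute)
  have F_lim: "(\<lambda>n. F k n) \<longlonglongrightarrow> c / (real (Suc k))\<^sup>2" for k
  proof -
    have "filterlim (\<lambda>n. real (Suc k) / real (Suc n)) (at_right 0) sequentially"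
      unfolding filterlim_at
      using LIMSEQ_Suc[OF lim_const_over_n] by auto
    from filterlim_compose[OF H_lim this] show ?thesis unfolding F_def by (intro tendsto_divide) auto
  qed
  have "\<bar>F k n\<bar> \<le> 1 / (real (Suc k))\<^sup>2" for k n
    unfolding F_def H_def using cone_density_bounds[of "real (Suc k) / real (Suc n)" "real (Suc k) / real (Suc n)"]
    by (auto simp: divide_simps)
  then have "(\<lambda>n. \<Sum>k. F k n) \<longlonglongrightarrow> (\<Sum>k. c / (real (Suc k))\<^sup>2)"
    using tannerys_theorem[of F "\<lambda>k. c / (real (Suc k))\<^sup>2" sequentially "\<lambda>k. 1 / (real (Suc k))\<^sup>2"] F_lim sums_summable[OF sums]
    by (auto intro!: always_eventually)
  also have "(\<Sum>k. c / (real (Suc k))\<^sup>2) = c * (pi\<^sup>2 / 6)"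
    using sums_mult[OF sums, of c] by (simp add: sums_unique[symmetric])
  finally have 1: "(\<lambda>n. \<Sum>k. F k n) \<longlonglongrightarrow> c * (pi\<^sup>2 / 6)" .
  have F_sum: "(\<Sum>k. F k n) = 2 * (1 / Suc n) * (1 / Suc n) * card (cone_points UNIV (1 / Suc n) (1 / Suc n))" for n
  proof -
    have "(\<Sum>k. F k n) = (\<Sum>k\<in>{..n}. F k n)"
      by (rule suminf_finite) (auto simp: F_def intro!: H_zero)
    also have "\<dots> = (\<Sum>d\<in>{1..Suc n}. H (real d / Suc n) / (real d)\<^sup>2)"
      by (rule sum.reindex_bij_witness[of _ "\<lambda>d. d - 1" Suc]) (auto simp: F_def)
    also have "\<dots> = (\<Sum>d\<in>{1..Suc n}. 2 * (1 / Suc n) * (1 / Suc n) * card (cone_points primitive_vectors (real d / real (Suc n)) (real d / real (Suc n))))"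
      by (rule sum.cong) (auto simp: H_def cone_density_def power2_eq_square)
    also have "\<dots> = 2 * (1 / Suc n) * (1 / Suc n) * card (cone_points UNIV (1 / Suc n) (1 / Suc n))"
      unfolding cone_points_UNIV_primitive[OF zero_less_Suc] sum_distrib_left ..
    finally show ?thesis .
  qed
  have 2: "(\<lambda>n. \<Sum>k. F k n) \<longlonglongrightarrow> 1"
  proof (rule tendsto_sandwich)
    show "\<forall>\<^sub>F n in sequentially. 1 - 4 / Suc n \<le> (\<Sum>k. F k n)"
      using card_cone_points_UNIV_bounds(2)[of "1 / Suc n" "1 / Suc n" for n]
      by (intro always_eventually) (auto simp: F_sum)
    show "\<forall>\<^sub>F n in sequentially. (\<Sum>k. F k n) \<le> 1"
      using card_cone_points_UNIV_bounds(1)[of "1 / Suc n" "1 / Suc n" for n]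
      by (intro always_eventually) (auto simp: F_sum)
    show "(\<lambda>n. 1 - 4 / real (Suc n)) \<longlonglongrightarrow> 1" by real_asymp
  qed simp
  from LIMSEQ_unique[OF 1 2] show ?thesis by (simp add: field_simps)
qed

section \<open>Cosets of a finite index subgroup\<close>

definition mat2_of :: "int \<Rightarrow> int \<Rightarrow> int \<Rightarrow> int \<Rightarrow> mat2" where
  "mat2_of a b c d = vector [vector [a, b], vector [c, d]]"

lemma mat2_of_nth [simp]:
  "mat2_of a b c d $ 1 $ 1 = a" "mat2_of a b c d $ 1 $ 2 = b"
  "mat2_of a b c d $ 2 $ 1 = c" "mat2_of a b c d $ 2 $ 2 = d"
  by (simp_all add: mat2_of_def)

text \<open>The adjugate, which is the inverse on \<open>SL2\<close>; it is polynomial in the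
  entries and reverses products of arbitrary matrices.\<close>

definition adj2 :: "mat2 \<Rightarrow> mat2" where
  "adj2 A = mat2_of (A$2$2) (- A$1$2) (- A$2$1) (A$1$1)"

definition act2 :: "mat2 \<Rightarrow> int \<times> int \<Rightarrow> int \<times> int" where
  "act2 A v = (A$1$1 * fst v + A$1$2 * snd v, A$2$1 * fst v + A$2$2 * snd v)"

definition SL2 :: "mat2 set" where "SL2 = {A. det A = 1}"

definition translation_mat :: "int \<Rightarrow> mat2" where "translation_mat k = mat2_of 1 k 0 1"

definition lower_mat :: "int \<Rightarrow> mat2" where "lower_mat k = mat2_of 1 0 k 1"

lemma mat2_mult_nth: "((A :: mat2) ** B) $ i $ j = A$i$1 * B$1$j + A$i$2 * B$2$j"
  by (simp add: matrix_matrix_mult_def sum_2)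

lemma mat2_one_nth [simp]:
  "(mat 1 :: mat2)$1$1 = 1" "(mat 1 :: mat2)$1$2 = 0" "(mat 1 :: mat2)$2$1 = 0" "(mat 1 :: mat2)$2$2 = 1"
  by (simp_all add: mat_def)

lemma SL2_iff: "A \<in> SL2 \<longleftrightarrow> A$1$1 * A$2$2 - A$1$2 * A$2$1 = 1"
  by (simp add: SL2_def det_2)

lemma SL2_closed [simp, intro]:
  "mat 1 \<in> SL2" "A \<in> SL2 \<Longrightarrow> B \<in> SL2 \<Longrightarrow> A ** B \<in> SL2" "A \<in> SL2 \<Longrightarrow> adj2 A \<in> SL2"
  "A \<in> SL2 \<Longrightarrow> - A \<in> SL2" "translation_mat k \<in> SL2" "lower_mat k \<in> SL2"
  by (auto simp: SL2_def det_mul) (auto simp: det_2 adj2_def translation_mat_def lower_mat_def algebra_simps)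

lemma adj2_inverse:
  assumes "A \<in> SL2" shows "adj2 A ** A = mat 1" "A ** adj2 A = mat 1"
  using assms by (auto simp: SL2_iff mat2_eq_iff mat2_mult_nth adj2_def algebra_simps)

lemma adj2_cancel:
  assumes "A \<in> SL2"
  shows "adj2 A ** (A ** B) = B" "A ** (adj2 A ** B) = B" "(B ** A) ** adj2 A = B" "(B ** adj2 A) ** A = B"
  using adj2_inverse[OF assms]
  by (simp_all add: matrix_mul_assoc) (simp_all add: matrix_mul_assoc[symmetric])

lemma adj2_mult: "adj2 (A ** B) = adj2 B ** adj2 A"
  by (auto simp: mat2_eq_iff mat2_mult_nth adj2_def algebra_simps)

lemma adj2_adj2 [simp]: "adj2 (adj2 A) = A"
  by (auto simp: mat2_eq_iff adj2_def)

lemma adj2_translation_mat [simp]: "adj2 (translation_mat k) = translation_mat (- k)"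
  and adj2_lower_mat [simp]: "adj2 (lower_mat k) = lower_mat (- k)"
  by (auto simp: mat2_eq_iff adj2_def translation_mat_def lower_mat_def)

lemma translation_mat_add: "translation_mat j ** translation_mat k = translation_mat (j + k)"
  by (auto simp: mat2_eq_iff mat2_mult_nth translation_mat_def)

lemma act2_mult: "act2 (A ** B) v = act2 A (act2 B v)"
  by (auto simp: act2_def mat2_mult_nth algebra_simps)

lemma act2_one [simp]: "act2 (mat 1) v = v"
  by (auto simp: act2_def)

lemma act2_uminus: "act2 (- A) v = - act2 A v" "act2 A (- v) = - act2 A v"
  by (auto simp: act2_def uminus_prod_def)

lemma act2_adj2:
  assumes "A \<in> SL2" shows "act2 (adj2 A) (act2 A v) = v" "act2 A (act2 (adj2 A) v) = v"
  using adj2_inverse[OF assms] by (simp_all add: act2_mult[symmetric])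

lemma act2_e1: "act2 A (1, 0) = (A$1$1, A$2$1)"
  by (simp add: act2_def)

lemma act2_e1_primitive:
  assumes "A \<in> SL2" shows "act2 A (1, 0) \<in> primitive_vectors"
proof -
  have "A$1$1 * A$2$2 - A$1$2 * A$2$1 = 1" using assms by (simp add: SL2_iff)
  then have "coprime (A$1$1) (A$2$1)"
    by (intro coprimeI) (metis dvd_diff dvd_mult dvd_mult2)
  then show ?thesis by (simp add: primitive_vectors_def act2_e1)
qed

lemma primitive_eq_act2_e1:
  assumes "v \<in> primitive_vectors" shows "\<exists>A\<in>SL2. act2 A (1, 0) = v"
proof -
  obtain x y where v: "v = (x, y)" "coprime x y" using assms by (auto simp: primitive_vectors_def)
  obtain a b where "a * x + b * y = 1" using v(2) bezout_int[of x y] by auto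
  then show ?thesis using v
    by (intro bexI[of _ "mat2_of x (- b) y a"]) (auto simp: SL2_iff act2_e1 algebra_simps)
qed

lemma fix_e1_translation:
  assumes "A \<in> SL2" "act2 A (1, 0) = (1, 0)" shows "\<exists>k. A = translation_mat k"
  using assms by (intro exI[of _ "A$1$2"]) (auto simp: act2_e1 SL2_iff mat2_eq_iff translation_mat_def)

text \<open>The Euclidean algorithm on the bottom row: right multiplication by an elementary matrix
  adds one entry, up to sign, to the other and can be chosen to lower the sum of the absolute
  values, until an entry vanishes. Only steps with \<open>\<bar>k\<bar> = 1\<close> are allowed, so
  that they correspond to single moves of the walk or their inverses.\<close>

lemma SL2_induct [consumes 1, case_names one uminus translation lower]:
  assumes A: "A \<in> SL2" and one: "P (mat 1)" and neg: "\<And>A. A \<in> SL2 \<Longrightarrow> P A \<Longrightarrow> P (- A)"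
    and t: "\<And>A k. A \<in> SL2 \<Longrightarrow> \<bar>k\<bar> = 1 \<Longrightarrow> P A \<Longrightarrow> P (A ** translation_mat k)"
    and l: "\<And>A k. A \<in> SL2 \<Longrightarrow> \<bar>k\<bar> = 1 \<Longrightarrow> P A \<Longrightarrow> P (A ** lower_mat k)"
  shows "P A"
proof -
  \<comment> \<open>The hypotheses pass from \<open>A\<close> to
    \<open>A ** translation_mat k\<close>; used with \<open>- k\<close> they pass back, as the
    descent requires.\<close>
  have tb: "P A" if "P (A ** translation_mat k)" "A \<in> SL2" "\<bar>k\<bar> = 1" for A k
    using t[of "A ** translation_mat k" "- k"] that adj2_cancel(3)[of "translation_mat k" A] by auto
  have lb: "P A" if "P (A ** lower_mat k)" "A \<in> SL2" "\<bar>k\<bar> = 1" for A k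
    using l[of "A ** lower_mat k" "- k"] that adj2_cancel(3)[of "lower_mat k" A] by auto
  have transl: "P (translation_mat k)" for k
  proof (induction k rule: int_induct[of _ 0])
    case base
    have "translation_mat 0 = mat 1" by (auto simp: mat2_eq_iff translation_mat_def)
    then show ?case using one by simp
  next
    case (step1 i) then show ?case using t[of "translation_mat i" 1] by (simp add: translation_mat_add)
  next
    case (step2 i) then show ?case using t[of "translation_mat i" "- 1"] by (simp add: translation_mat_add)
  qed
  have up: "P A" if "A \<in> SL2" "A$2$1 = 0" for A
  proof -
    have "A$1$1 * A$2$2 = 1" using that by (simp add: SL2_iff)
    then have "A$1$1 = 1 \<and> A$2$2 = 1 \<or> A$1$1 = -1 \<and> A$2$2 = -1" by (auto simp: zmult_eq_1_iff)
    then have "A = translation_mat (A$1$2) \<or> A = - translation_mat (- A$1$2)"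
      using that by (auto simp: mat2_eq_iff translation_mat_def)
    then show ?thesis using transl neg by (metis SL2_closed(5))
  qed
  show ?thesis
    using A
  proof (induction "nat (\<bar>A$2$1\<bar> + \<bar>A$2$2\<bar>)" arbitrary: A rule: less_induct)
    case less
    let ?c = "A$2$1" and ?d = "A$2$2"
    have rowT: "(A ** translation_mat k)$2$1 = ?c" "(A ** translation_mat k)$2$2 = k * ?c + ?d" for k
      by (simp_all add: mat2_mult_nth translation_mat_def)
    have rowL: "(A ** lower_mat k)$2$1 = ?c + k * ?d" "(A ** lower_mat k)$2$2 = ?d" for k
      by (simp_all add: mat2_mult_nth lower_mat_def)
    consider "?c = 0" | "?d = 0" | "?c \<noteq> 0" "?d \<noteq> 0" "\<bar>?d\<bar> \<le> \<bar>?c\<bar>" | "?c \<noteq> 0" "?d \<noteq> 0" "\<bar>?c\<bar> \<le> \<bar>?d\<bar>"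
      by linarith
    then show ?case
    proof cases
      case 1 then show ?thesis using up less.prems by blast
    next
      case 2
      \<comment> \<open>The bottom row \<open>(c, 0)\<close> becomes \<open>(c, c)\<close> and then
        \<open>(0, c)\<close>.\<close>
      have "(A ** translation_mat 1 ** lower_mat (-1))$2$1 = 0"
        using 2 by (simp add: mat2_mult_nth translation_mat_def lower_mat_def)
      then have "P (A ** translation_mat 1 ** lower_mat (-1))" by (rule up[rotated]) (use less.prems in auto)
      then have "P (A ** translation_mat 1)" by (rule lb) (use less.prems in auto)
      then show ?thesis by (rule tb) (use less.prems in auto)
    next
      case 3
      obtain k :: int where k: "\<bar>k\<bar> = 1" "\<bar>?c + k * ?d\<bar> < \<bar>?c\<bar>"
      proof (cases "0 < ?c * ?d")
        case True
        then show ?thesis using 3 that[of "-1"] by (auto simp: zero_less_mult_iff)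
      next
        case False
        then show ?thesis using 3 that[of "1"] by (auto simp: zero_less_mult_iff)
      qed
      then have "P (A ** lower_mat k)" by (intro less.hyps) (use less.prems in \<open>auto simp: rowL\<close>)
      then show ?thesis by (rule lb) (use k less.prems in auto)
    next
      case 4
      obtain k :: int where k: "\<bar>k\<bar> = 1" "\<bar>k * ?c + ?d\<bar> < \<bar>?d\<bar>"
      proof (cases "0 < ?c * ?d")
        case True
        then show ?thesis using 4 that[of "-1"] by (auto simp: zero_less_mult_iff)
      next
        case False
        then show ?thesis using 4 that[of "1"] by (auto simp: zero_less_mult_iff)
      qed
      then have "P (A ** translation_mat k)" by (intro less.hyps) (use less.prems in \<open>auto simp: rowT\<close>)
      then show ?thesis by (rule tb) (use k less.prems in auto)
    qed
  qed
qed

section \<open>Subgroups of finite index and their pulled-back vector orbits\<close>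

locale matrix_group =
  fixes H :: "mat2 set"
  assumes sub: "H \<subseteq> SL2" and one_mem: "mat 1 \<in> H"
    and mult_mem: "A \<in> H \<Longrightarrow> B \<in> H \<Longrightarrow> A ** B \<in> H" and adj_mem: "A \<in> H \<Longrightarrow> adj2 A \<in> H"
    and uminus_mem: "A \<in> H \<Longrightarrow> - A \<in> H"
begin

definition coset :: "mat2 \<Rightarrow> mat2 set" where "coset A = (\<lambda>B. B ** A) ` H"

definition cosets :: "mat2 set set" where "cosets = coset ` SL2"

definition orbit_vectors :: "(int \<times> int) set" where "orbit_vectors = (\<lambda>A. act2 A (1, 0)) ` H"

text \<open>The orbit of the first basis vector under \<open>H\<close>, written in the coordinates
  of the basis formed by the columns of \<open>A\<close>. It depends only on the coset of
  \<open>A\<close>, and the two shears become right multiplications.\<close>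

definition pulled_orbit :: "mat2 \<Rightarrow> (int \<times> int) set" where
  "pulled_orbit A = {v. act2 A v \<in> orbit_vectors}"

definition width :: nat where "width = (LEAST q. 0 < q \<and> translation_mat (int q) \<in> H)"

lemma mem_SL2: "A \<in> H \<Longrightarrow> A \<in> SL2" using sub by blast

lemma coset_eq_iff:
  assumes A: "A \<in> SL2" and B: "B \<in> SL2"
  shows "coset A = coset B \<longleftrightarrow> A ** adj2 B \<in> H"
proof
  assume "coset A = coset B"
  moreover have "mat 1 ** A \<in> coset A" unfolding coset_def using one_mem by blast
  ultimately obtain C where "C \<in> H" "A = C ** B" by (auto simp: coset_def)
  then show "A ** adj2 B \<in> H" using adj2_cancel(3)[OF B] by simp
next
  assume h: "A ** adj2 B \<in> H"
  have *: "coset A \<subseteq> coset B" if "A ** adj2 B \<in> H" "B \<in> SL2" for A B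
  proof
    fix C assume "C \<in> coset A"
    then obtain D where "D \<in> H" "C = D ** A" by (auto simp: coset_def)
    then have "C = (D ** (A ** adj2 B)) ** B" "D ** (A ** adj2 B) \<in> H"
      using adj2_cancel(4)[OF that(2), of "D ** A"] mult_mem[OF \<open>D \<in> H\<close> that(1)]
      by (simp_all add: matrix_mul_assoc)
    then show "C \<in> coset B" by (auto simp: coset_def)
  qed
  have "B ** adj2 A \<in> H" using adj_mem[OF h] by (simp add: adj2_mult)
  then show "coset A = coset B" using * h A B by blast
qed

lemma orbit_vectors_act:
  assumes "A \<in> H" shows "act2 A v \<in> orbit_vectors \<longleftrightarrow> v \<in> orbit_vectors"
proof
  assume "v \<in> orbit_vectors"
  then show "act2 A v \<in> orbit_vectors" using assms mult_mem by (force simp: orbit_vectors_def act2_mult[symmetric])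
next
  assume "act2 A v \<in> orbit_vectors"
  then obtain B where "B \<in> H" "act2 A v = act2 B (1, 0)" by (auto simp: orbit_vectors_def)
  then have "v = act2 (adj2 A ** B) (1, 0)" using act2_adj2(1)[OF mem_SL2[OF assms], of v] by (simp add: act2_mult)
  then show "v \<in> orbit_vectors" using \<open>B \<in> H\<close> assms adj_mem mult_mem by (auto simp: orbit_vectors_def)
qed

lemma orbit_vectors_uminus: "- v \<in> orbit_vectors \<longleftrightarrow> v \<in> orbit_vectors"
  using orbit_vectors_act[OF uminus_mem[OF one_mem], of v] by (simp add: act2_uminus)

lemma orbit_vectors_primitive: "orbit_vectors \<subseteq> primitive_vectors"
  using act2_e1_primitive sub by (auto simp: orbit_vectors_def)

lemma pulled_orbit_mult: "A \<in> H \<Longrightarrow> pulled_orbit (A ** B) = pulled_orbit B"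
  by (simp add: pulled_orbit_def act2_mult orbit_vectors_act)

lemma pulled_orbit_uminus: "pulled_orbit (- A) = pulled_orbit A"
  by (simp add: pulled_orbit_def act2_uminus orbit_vectors_uminus)

lemma pulled_orbit_coset:
  assumes "coset A = coset B" "A \<in> SL2" "B \<in> SL2" shows "pulled_orbit A = pulled_orbit B"
proof -
  have "A ** adj2 B \<in> H" using assms by (simp add: coset_eq_iff)
  from pulled_orbit_mult[OF this, of B] show ?thesis using adj2_cancel(4)[OF assms(3)] by simp
qed

lemma pulled_orbit_primitive:
  assumes A: "A \<in> SL2" shows "pulled_orbit A \<subseteq> primitive_vectors"
proof
  fix v assume "v \<in> pulled_orbit A"
  then obtain B where "B \<in> H" "act2 A v = act2 B (1, 0)" by (auto simp: pulled_orbit_def orbit_vectors_def)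
  then have "v = act2 (adj2 A ** B) (1, 0)" using act2_adj2(1)[OF A, of v] by (simp add: act2_mult)
  then show "v \<in> primitive_vectors" using A \<open>B \<in> H\<close> mem_SL2 by (auto intro: act2_e1_primitive)
qed

lemma shear_left_pulled_orbit: "shear_left (pulled_orbit A) = pulled_orbit (A ** translation_mat 1)"
proof -
  have "act2 (translation_mat 1) (s, t) = (s + t, t)" for s t by (simp add: act2_def translation_mat_def)
  then show ?thesis by (simp add: shear_left_def pulled_orbit_def act2_mult set_eq_iff)
qed

lemma shear_right_pulled_orbit: "shear_right (pulled_orbit A) = pulled_orbit (A ** lower_mat 1)"
proof -
  have "act2 (lower_mat 1) (s, t) = (s, s + t)" for s t by (simp add: act2_def lower_mat_def)
  then show ?thesis by (simp add: shear_right_def pulled_orbit_def act2_mult set_eq_iff)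
qed

end

locale finite_index_matrix_group = matrix_group +
  assumes finite_cosets: "finite cosets"
begin

abbreviation family :: "(int \<times> int) set set" where "family \<equiv> pulled_orbit ` SL2"

lemma finite_family: "finite family"
proof -
  define F where "F C = pulled_orbit (SOME A. A \<in> SL2 \<and> coset A = C)" for C
  have F: "F (coset A) = pulled_orbit A" if A: "A \<in> SL2" for A
    unfolding F_def
  proof (rule someI2)
    show "A \<in> SL2 \<and> coset A = coset A" using A by simp
    fix B assume "B \<in> SL2 \<and> coset B = coset A"
    then show "pulled_orbit B = pulled_orbit A" using A by (intro pulled_orbit_coset) simp_all
  qed
  have "family \<subseteq> F ` cosets"
  proof
    fix x assume "x \<in> family"
    then obtain A where A: "A \<in> SL2" "x = pulled_orbit A" by blast
    then show "x \<in> F ` cosets" unfolding cosets_def using F[of A] by (intro image_eqI[of _ _ "coset A"]) simp_all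
  qed
  then show ?thesis using finite_cosets finite_surj by blast
qed

text \<open>A walk contains only the two shears, whereas generating \<open>SL2\<close> also takes
  their inverses. Each shear permutes the finite family, so one of its powers acts there as the
  inverse.\<close>

lemma family_walk:
  assumes A: "A \<in> SL2" and C: "C \<in> SL2"
  shows "\<exists>w. walk shear_left shear_right w (pulled_orbit A) = pulled_orbit (A ** C)"
proof -
  have closed: "shear_left F \<in> family" "shear_right F \<in> family" if "F \<in> family" for F
    using that by (auto simp: shear_left_pulled_orbit shear_right_pulled_orbit)
  have backward: "\<exists>w. walk shear_left shear_right w F = F'" if "F \<in> family" "F' \<in> family" "g F' = F"
    "g = shear_left \<or> g = shear_right" for F F' g
  proof -
    have "\<exists>n>0. \<forall>x\<in>family. (g ^^ n) x = x"
      using inj_shear_left inj_shear_right that(4) closed finite_family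
      by (intro funpow_id_on_finite) (auto intro: inj_on_subset)
    then obtain n where n: "0 < n" "\<forall>x\<in>family. (g ^^ n) x = x" by metis
    from n(2) that(2) have "(g ^^ n) F' = F'" by (rule bspec)
    moreover from n(1) obtain m where "n = Suc m" by (cases n) auto
    ultimately have "(g ^^ m) F = F'" using that(3) by (simp del: funpow.simps add: funpow_Suc_right)
    moreover have "\<exists>c. walk shear_left shear_right (replicate m c) F = (g ^^ m) F"
      using that(4) walk_replicate by metis
    ultimately show ?thesis by metis
  qed
  show ?thesis using C A
  proof (induction C arbitrary: A rule: SL2_induct)
    case one
    show ?case by (intro exI[of _ "[]"]) simp
  next
    case (uminus C)
    then show ?case by (simp add: uminus_mult pulled_orbit_uminus)
  next
    case (translation C k)
    from translation(3)[OF translation(4)] obtain w where w: "walk shear_left shear_right w (pulled_orbit A) = pulled_orbit (A ** C)" by blast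
    have "\<exists>w. walk shear_left shear_right w (pulled_orbit (A ** C)) = pulled_orbit (A ** (C ** translation_mat k))"
    proof (cases "k = 1")
      case True
      then show ?thesis by (intro exI[of _ "[True]"]) (simp add: shear_left_pulled_orbit matrix_mul_assoc)
    next
      case False
      then have k: "k = -1" using translation by auto
      have "shear_left (pulled_orbit (A ** (C ** translation_mat k))) = pulled_orbit (A ** C)"
        using adj2_cancel(3)[of "translation_mat (-1)" "A ** C"]
        by (simp add: shear_left_pulled_orbit matrix_mul_assoc k)
      then show ?thesis by (rule backward[where g = shear_left, rotated 2]) (use translation(1,4) in auto)
    qed
    then obtain w' where "walk shear_left shear_right w' (pulled_orbit (A ** C)) = pulled_orbit (A ** (C ** translation_mat k))" by blast
    with w have "walk shear_left shear_right (w @ w') (pulled_orbit A) = pulled_orbit (A ** (C ** translation_mat k))" by simp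
    then show ?case by blast
  next
    case (lower C k)
    from lower(3)[OF lower(4)] obtain w where w: "walk shear_left shear_right w (pulled_orbit A) = pulled_orbit (A ** C)" by blast
    have "\<exists>w. walk shear_left shear_right w (pulled_orbit (A ** C)) = pulled_orbit (A ** (C ** lower_mat k))"
    proof (cases "k = 1")
      case True
      then show ?thesis by (intro exI[of _ "[False]"]) (simp add: shear_right_pulled_orbit matrix_mul_assoc)
    next
      case False
      then have k: "k = -1" using lower by auto
      have "shear_right (pulled_orbit (A ** (C ** lower_mat k))) = pulled_orbit (A ** C)"
        using adj2_cancel(3)[of "lower_mat (-1)" "A ** C"]
        by (simp add: shear_right_pulled_orbit matrix_mul_assoc k)
      then show ?thesis by (rule backward[where g = shear_right, rotated 2]) (use lower(1,4) in auto)
    qed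
    then obtain w' where "walk shear_left shear_right w' (pulled_orbit (A ** C)) = pulled_orbit (A ** (C ** lower_mat k))" by blast
    with w have "walk shear_left shear_right (w @ w') (pulled_orbit A) = pulled_orbit (A ** (C ** lower_mat k))" by simp
    then show ?case by blast
  qed
qed

text \<open>By the pigeonhole principle two different translations lie in the same coset, and their
  quotient is a nontrivial translation in \<open>H\<close>.\<close>

lemma width_exists: "\<exists>q>0. translation_mat (int q) \<in> H"
proof -
  have "\<not> inj_on (\<lambda>k. coset (translation_mat (int k))) UNIV"
  proof
    assume "inj_on (\<lambda>k. coset (translation_mat (int k))) UNIV"
    moreover have "finite (range (\<lambda>k. coset (translation_mat (int k))))"
      by (rule finite_subset[OF _ finite_cosets]) (auto simp: cosets_def)
    ultimately have "finite (UNIV :: nat set)" by (rule finite_imageD[rotated])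
    then show False by simp
  qed
  then obtain i j where ij: "i \<noteq> j" "coset (translation_mat (int i)) = coset (translation_mat (int j))"
    by (auto simp: inj_on_def)
  have *: "translation_mat (int i - int j) \<in> H"
    using ij(2) by (simp add: coset_eq_iff translation_mat_add)
  then have "translation_mat (int j - int i) \<in> H" using adj_mem[OF *] by simp
  then have "translation_mat (int (nat \<bar>int i - int j\<bar>)) \<in> H" using * by (simp add: abs_if)
  then show ?thesis using ij(1) by (intro exI[of _ "nat \<bar>int i - int j\<bar>"]) auto
qed

lemma width: "0 < width" "translation_mat (int width) \<in> H"
  using LeastI_ex[OF width_exists] by (auto simp: width_def)

lemma translation_mat_mem_iff: "translation_mat k \<in> H \<longleftrightarrow> int width dvd k"
proof
  have mult: "translation_mat (int width * m) \<in> H" for m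
  proof (induction m rule: int_induct[of _ 0])
    case base
    have "translation_mat 0 = mat 1" by (auto simp: mat2_eq_iff translation_mat_def)
    then show ?case using one_mem by simp
  next
    case (step1 i)
    from mult_mem[OF step1(2) width(2)] show ?case by (simp add: translation_mat_add algebra_simps)
  next
    case (step2 i)
    from mult_mem[OF step2(2) adj_mem[OF width(2)]] show ?case by (simp add: translation_mat_add algebra_simps)
  qed
  then show "int width dvd k \<Longrightarrow> translation_mat k \<in> H" by auto
  assume k: "translation_mat k \<in> H"
  define r where "r = k mod int width"
  have "translation_mat r \<in> H"
    using mult_mem[OF k mult[of "- (k div int width)"]]
    by (simp add: translation_mat_add r_def minus_mult_div_eq_mod)
  moreover have r: "0 \<le> r" "r < int width" using width(1) by (auto simp: r_def)
  moreover have "\<not> (0 < nat r \<and> translation_mat (int (nat r)) \<in> H)"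
    using r unfolding width_def by (intro not_less_Least) auto
  ultimately have "r = 0" by auto
  then show "int width dvd k" by (simp add: r_def mod_eq_0_iff_dvd)
qed

text \<open>If \<open>D\<close> maps the first basis vector to \<open>v\<close>, then the matrices
  \<open>A\<close> that send \<open>v\<close> into the orbit are the products of an element of
  \<open>H\<close>, a translation and the inverse of \<open>D\<close>. Their coset depends exactly
  on the translation modulo the width. Thus the pulled-back orbits, taken over all cosets, cover
  every primitive vector \<open>width\<close> times.\<close>

lemma card_cosets_over_primitive:
  assumes "v \<in> primitive_vectors"
  shows "card {C \<in> cosets. \<exists>A\<in>SL2. C = coset A \<and> v \<in> pulled_orbit A} = width"
proof -
  obtain D where D: "D \<in> SL2" "v = act2 D (1, 0)" using primitive_eq_act2_e1[OF assms] by blast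
  let ?f = "\<lambda>k. coset (translation_mat (int k) ** adj2 D)"
  have eq: "coset (translation_mat i ** adj2 D) = coset (translation_mat j ** adj2 D) \<longleftrightarrow> int width dvd i - j" for i j
  proof -
    have "(translation_mat i ** adj2 D) ** adj2 (translation_mat j ** adj2 D) = translation_mat (i - j)"
      using adj2_cancel(4)[OF D(1), of "translation_mat i"]
      by (simp add: adj2_mult matrix_mul_assoc translation_mat_add)
    then show ?thesis using D by (simp add: coset_eq_iff translation_mat_mem_iff)
  qed
  have "{C \<in> cosets. \<exists>A\<in>SL2. C = coset A \<and> v \<in> pulled_orbit A} = ?f ` {0..<width}"
  proof (intro equalityI subsetI)
    fix C assume "C \<in> {C \<in> cosets. \<exists>A\<in>SL2. C = coset A \<and> v \<in> pulled_orbit A}"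
    then obtain A where A: "A \<in> SL2" "C = coset A" "act2 A v \<in> orbit_vectors" by (auto simp: pulled_orbit_def)
    then obtain B where B: "B \<in> H" "act2 A v = act2 B (1, 0)" by (auto simp: orbit_vectors_def)
    have "act2 (adj2 B ** A ** D) (1, 0) = (1, 0)"
      using B D act2_adj2(1)[OF mem_SL2[OF B(1)]] by (simp add: act2_mult)
    moreover have "adj2 B ** A ** D \<in> SL2" using A B D mem_SL2 by auto
    ultimately obtain k where k: "adj2 B ** A ** D = translation_mat k" using fix_e1_translation by blast
    have "A = B ** (translation_mat k ** adj2 D)"
      using adj2_cancel(3)[OF D(1), of "adj2 B ** A"] adj2_cancel(2)[OF mem_SL2[OF B(1)], of A] k
      by (simp add: matrix_mul_assoc)
    then have "A ** adj2 (translation_mat k ** adj2 D) = B"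
      using D adj2_cancel(3)[of "translation_mat k ** adj2 D" B] by simp
    then have "coset A = coset (translation_mat k ** adj2 D)"
      using A B D by (simp add: coset_eq_iff)
    also have "\<dots> = coset (translation_mat (k mod int width) ** adj2 D)"
      unfolding eq by (simp add: minus_mod_eq_mult_div)
    finally have "C = ?f (nat (k mod int width))" using A width by simp
    have "nat (k mod int width) < width" using width(1) by (simp add: nat_less_iff)
    moreover note \<open>C = ?f (nat (k mod int width))\<close>
    ultimately show "C \<in> ?f ` {0..<width}" by (intro image_eqI[of _ _ "nat (k mod int width)"]) simp_all
  next
    fix C assume "C \<in> ?f ` {0..<width}"
    then obtain k where C: "C = ?f k" by auto
    have "act2 (translation_mat (int k) ** adj2 D) v = (1, 0)"
      using D act2_adj2(1)[OF D(1)] by (simp add: act2_mult) (simp add: act2_def translation_mat_def)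
    moreover have "(1, 0) \<in> orbit_vectors" using one_mem by (force simp: orbit_vectors_def)
    ultimately have "v \<in> pulled_orbit (translation_mat (int k) ** adj2 D)" by (simp add: pulled_orbit_def)
    then show "C \<in> {C \<in> cosets. \<exists>A\<in>SL2. C = coset A \<and> v \<in> pulled_orbit A}"
      using D C by (auto simp: cosets_def)
  qed
  moreover have "inj_on ?f {0..<width}"
  proof (rule inj_onI)
    fix i j assume ij: "i \<in> {0..<width}" "j \<in> {0..<width}" "?f i = ?f j"
    then have "int width dvd int i - int j" by (simp add: eq)
    then have "int i mod int width = int j mod int width" by (simp add: mod_eq_dvd_iff)
    then show "i = j" using ij by simp
  qed
  ultimately show ?thesis by (simp add: card_image)
qed

text \<open>The common limit \<open>c\<close> is found by double counting:
  \<open>card cosets\<close> times \<open>c\<close> equals \<open>width\<close> times the density of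
  the primitive vectors.\<close>

lemma pulled_orbit_density:
  assumes e: "0 < e"
  shows "\<exists>\<delta>>0. \<forall>A\<in>SL2. \<forall>a b. 0 < a \<and> a < \<delta> \<and> 0 < b \<and> b < \<delta> \<longrightarrow>
    \<bar>cone_density (pulled_orbit A) a b - 6 * real width / (pi\<^sup>2 * real (card cosets))\<bar> < e"
proof -
  have "\<exists>c. \<forall>e>0. \<exists>\<delta>>0. \<forall>A\<in>family. \<forall>a b. 0 < a \<and> a < \<delta> \<and> 0 < b \<and> b < \<delta> \<longrightarrow> \<bar>cone_density A a b - c\<bar> < e"
  proof (rule cone_density_limit)
    show "finite family" by (rule finite_family)
    show "family \<noteq> {}" using SL2_closed(1) by blast
    show "F \<subseteq> primitive_vectors" if "F \<in> family" for F using that pulled_orbit_primitive by blast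
    show "shear_left F \<in> family" "shear_right F \<in> family" if "F \<in> family" for F
      using that by (auto simp: shear_left_pulled_orbit shear_right_pulled_orbit)
    fix F F' assume "F \<in> family" "F' \<in> family"
    then obtain A B where AB: "A \<in> SL2" "B \<in> SL2" "F = pulled_orbit A" "F' = pulled_orbit B" by auto
    have "\<exists>w. walk shear_left shear_right w (pulled_orbit A) = pulled_orbit (A ** (adj2 A ** B))"
      using AB by (intro family_walk) auto
    then show "\<exists>w. walk shear_left shear_right w F = F'" using AB adj2_cancel(2) by simp
  qed
  then obtain c where c: "\<forall>e>0. \<exists>\<delta>>0. \<forall>A\<in>family. \<forall>a b. 0 < a \<and> a < \<delta> \<and> 0 < b \<and> b < \<delta> \<longrightarrow> \<bar>cone_density A a b - c\<bar> < e"
    by (elim exE) (rule that)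
  \<comment> \<open>The sum has to run over cosets and not over the family of sets, because
    different cosets may have the same pulled-back orbit and the multiplicity \<open>width\<close>
    counts cosets.\<close>
  define F where "F C = pulled_orbit (SOME A. A \<in> SL2 \<and> coset A = C)" for C
  have F: "F (coset A) = pulled_orbit A" if A: "A \<in> SL2" for A
    unfolding F_def
  proof (rule someI2)
    show "A \<in> SL2 \<and> coset A = coset A" using A by simp
    fix B assume "B \<in> SL2 \<and> coset B = coset A"
    then show "pulled_orbit B = pulled_orbit A" using A by (intro pulled_orbit_coset) simp_all
  qed
  define n where "n = card cosets"
  have "cosets \<noteq> {}" using SL2_closed(1) by (auto simp: cosets_def)
  then have n: "0 < n" using finite_cosets by (simp add: n_def card_gt_0_iff)
  have sum: "(\<Sum>C\<in>cosets. cone_density (F C) a b) = real width * cone_density primitive_vectors a b"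
    if ab: "0 < a" "0 < b" for a b
  proof -
    let ?P = "cone_points primitive_vectors a b"
    have finP: "finite ?P" by (rule finite_cone_points[OF ab])
    have FP: "cone_points (F C) a b = {v \<in> ?P. v \<in> F C}" if "C \<in> cosets" for C
      using that F pulled_orbit_primitive by (auto simp: cosets_def cone_points_def)
    have "(\<Sum>C\<in>cosets. card (cone_points (F C) a b)) = (\<Sum>C\<in>cosets. card {v \<in> ?P. v \<in> F C})"
      by (simp add: FP)
    also have "\<dots> = width * card ?P"
    proof (rule sum_multicount[OF finite_cosets finP], rule ballI)
      fix v assume "v \<in> ?P"
      then have "v \<in> primitive_vectors" by (auto simp: cone_points_def)
      moreover have "{C \<in> cosets. v \<in> F C} = {C \<in> cosets. \<exists>A\<in>SL2. C = coset A \<and> v \<in> pulled_orbit A}"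
        using F by (auto simp: cosets_def)
      ultimately show "card {C \<in> cosets. v \<in> F C} = width" using card_cosets_over_primitive by simp
    qed
    finally have "(\<Sum>C\<in>cosets. real (card (cone_points (F C) a b))) = real width * real (card ?P)"
      by (simp flip: of_nat_sum of_nat_mult)
    then show ?thesis unfolding cone_density_def sum_distrib_left[symmetric] by simp
  qed
  have "real n * c / real width = 6 / pi\<^sup>2"
  proof (rule primitive_density)
    fix e :: real assume e: "0 < e"
    define e' where "e' = e * real width / real n"
    have e': "0 < e'" using e n width by (simp add: e'_def)
    from c[rule_format, OF this] obtain \<delta> where \<delta>: "0 < \<delta>"
      "\<forall>A\<in>family. \<forall>a b. 0 < a \<and> a < \<delta> \<and> 0 < b \<and> b < \<delta> \<longrightarrow> \<bar>cone_density A a b - c\<bar> < e'"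
      by (elim exE conjE) (rule that)
    have "\<bar>cone_density primitive_vectors a b - real n * c / real width\<bar> < e"
      if ab: "0 < a" "a < \<delta>" "0 < b" "b < \<delta>" for a b
    proof -
      have d: "\<bar>cone_density (F C) a b - c\<bar> < e'" if "C \<in> cosets" for C
      proof -
        have "F C \<in> family" using that F by (auto simp: cosets_def)
        then show ?thesis using \<delta>(2) ab by blast
      qed
      have "\<bar>\<Sum>C\<in>cosets. cone_density (F C) a b - c\<bar> \<le> (\<Sum>C\<in>cosets. \<bar>cone_density (F C) a b - c\<bar>)" by (rule sum_abs)
      also have "\<dots> < (\<Sum>C\<in>cosets. e')" using d finite_cosets \<open>cosets \<noteq> {}\<close> by (intro sum_strict_mono) auto
      also have "\<dots> = e * real width" using n by (simp add: n_def[symmetric] e'_def)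
      also have "(\<Sum>C\<in>cosets. cone_density (F C) a b - c) = real width * cone_density primitive_vectors a b - real n * c"
        using sum[OF ab(1,3)] by (simp add: sum_subtractf n_def)
      finally have "\<bar>real width * cone_density primitive_vectors a b - real n * c\<bar> < e * real width" .
      moreover have "real width * cone_density primitive_vectors a b - real n * c =
        real width * (cone_density primitive_vectors a b - real n * c / real width)"
        using width(1) by (simp add: field_simps)
      ultimately show ?thesis using width(1) by (simp add: abs_mult mult.commute)
    qed
    then show "\<exists>\<delta>>0. \<forall>a b. 0 < a \<and> a < \<delta> \<and> 0 < b \<and> b < \<delta> \<longrightarrow>
      \<bar>cone_density primitive_vectors a b - real n * c / real width\<bar> < e" using \<delta>(1) by blast
  qed
  then have "c = 6 * real width / (pi\<^sup>2 * real (card cosets))"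
    using n width(1) by (simp add: n_def[symmetric] field_simps)
  with c[rule_format, OF e] show ?thesis by simp
qed

end

section \<open>Lattice points in sectors of a norm form\<close>

definition cross2 :: "int \<times> int \<Rightarrow> int \<times> int \<Rightarrow> int" where
  "cross2 p w = fst p * snd w - fst w * snd p"

lemma cross2_identity:
  "cross2 q w * cross2 p v = cross2 v w * cross2 p q + cross2 q v * cross2 p w"
  by (simp add: cross2_def algebra_simps)

lemma parallel_primitive:
  assumes "p \<in> primitive_vectors" "q \<in> primitive_vectors" "cross2 p q = 0"
  shows "q = p \<or> q = - p"
proof -
  obtain A where A: "A \<in> SL2" "act2 A (1, 0) = p" using primitive_eq_act2_e1[OF assms(1)] by blast
  define v where "v = act2 (adj2 A) q"
  have q: "act2 A v = q" using act2_adj2(2)[OF A(1)] by (simp add: v_def)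
  have snd0: "snd v = 0" using assms(3) A by (auto simp: v_def act2_def adj2_def cross2_def algebra_simps)
  obtain B where "B \<in> SL2" "act2 B (1, 0) = q" using primitive_eq_act2_e1[OF assms(2)] by blast
  then have "act2 (adj2 A ** B) (1, 0) = v" by (simp add: act2_mult v_def)
  then have "v \<in> primitive_vectors" using A \<open>B \<in> SL2\<close> act2_e1_primitive by (metis SL2_closed(2,3))
  then have "\<bar>fst v\<bar> = 1" using snd0 by (auto simp: primitive_vectors_def coprime_iff_gcd_eq_1)
  then have "v = (1, 0) \<or> v = - (1, 0)" using snd0 by (cases v) auto
  then show ?thesis using A q act2_uminus(2)[of A "(1, 0)"] by auto
qed

lemma card_Int_singleton_le: "card (S \<inter> {x}) \<le> 1"
  using card_mono[of "{x}" "S \<inter> {x}"] by simp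

lemma sinh_tanh_small:
  assumes "0 < (\<theta> :: real)"
  shows "\<exists>\<eta>>0. \<forall>x. 0 < x \<and> x \<le> \<eta> \<longrightarrow> sinh x \<le> (1 + \<theta>) * x \<and> (1 - \<theta>) * x \<le> tanh x"
proof -
  have "((\<lambda>x::real. sinh x / x) \<longlongrightarrow> 1) (at_right 0)" by real_asymp
  then have "\<forall>\<^sub>F x in at_right 0. sinh x / x < 1 + \<theta>" using assms by (intro order_tendstoD) auto
  moreover have "((\<lambda>x::real. tanh x / x) \<longlongrightarrow> 1) (at_right 0)" by real_asymp
  then have "\<forall>\<^sub>F x in at_right 0. 1 - \<theta> < tanh x / x" using assms by (intro order_tendstoD) auto
  ultimately have "\<forall>\<^sub>F x in at_right 0. sinh x / x < 1 + \<theta> \<and> 1 - \<theta> < tanh x / x" by eventually_elim simp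
  then obtain b where b: "0 < b" "\<forall>y>0. y < b \<longrightarrow> sinh y / y < 1 + \<theta> \<and> 1 - \<theta> < tanh y / y"
    unfolding eventually_at_right_field by blast
  show ?thesis
  proof (intro exI[of _ "b / 2"] conjI allI impI)
    show "0 < b / 2" using b by simp
    fix x assume "0 < x \<and> x \<le> b / 2"
    then have x: "0 < x" "sinh x / x < 1 + \<theta>" "1 - \<theta> < tanh x / x" using b by auto
    show "sinh x \<le> (1 + \<theta>) * x" using x by (simp add: divide_less_eq)
    show "(1 - \<theta>) * x \<le> tanh x" using x by (simp add: less_divide_eq)
  qed
qed

lemma le_sinh: "0 \<le> x \<Longrightarrow> x \<le> sinh (x :: real)"
proof -
  assume "0 \<le> x"
  have "sinh 0 - 0 \<le> sinh x - x"
  proof (rule DERIV_nonneg_imp_nondecreasing[OF \<open>0 \<le> x\<close>])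
    fix y :: real
    have "((\<lambda>x. sinh x - x) has_real_derivative (cosh y - 1)) (at y)" by (auto intro!: derivative_eq_intros)
    then show "\<exists>z. ((\<lambda>x. sinh x - x) has_real_derivative z) (at y) \<and> 0 \<le> z"
      using cosh_real_ge_1[of y] by auto
  qed
  then show ?thesis by simp
qed

text \<open>Two linear forms of positive determinant, whose product is the norm form up to sign in
  the application. The set \<open>P\<close> is required to have the same density \<open>c\<close> in
  the coordinates of every unimodular basis, uniformly in the basis.\<close>

locale form_sector =
  fixes x1 x2 z1 z2 :: real and P :: "(int \<times> int) set" and c :: real
  assumes W_pos: "0 < x1 * z2 - x2 * z1"
    and primitive: "P \<subseteq> primitive_vectors"
    and density: "\<And>e. 0 < e \<Longrightarrow> \<exists>\<delta>>0. \<forall>A\<in>SL2. \<forall>a b. 0 < a \<and> a < \<delta> \<and> 0 < b \<and> b < \<delta> \<longrightarrow>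
      \<bar>cone_density {v. act2 A v \<in> P} a b - c\<bar> < e"
begin

definition W :: real where "W = x1 * z2 - x2 * z1"
definition \<xi> :: "int \<times> int \<Rightarrow> real" where "\<xi> v = x1 * of_int (fst v) + x2 * of_int (snd v)"
definition \<zeta> :: "int \<times> int \<Rightarrow> real" where "\<zeta> v = z1 * of_int (fst v) + z2 * of_int (snd v)"
definition positive :: "int \<times> int \<Rightarrow> bool" where "positive v \<longleftrightarrow> 0 < \<xi> v \<and> 0 < \<zeta> v"
text \<open>Together with \<open>g\<close>, hyperbolic polar coordinates on the positive cone:
  \<open>\<xi> = g * exp \<tau>\<close> and \<open>\<zeta> = g * exp (- \<tau>)\<close>. The
  difference of two values of \<tau> is the hyperbolic width of a sector.\<close>

definition \<tau> :: "int \<times> int \<Rightarrow> real" where "\<tau> v = ln (\<xi> v / \<zeta> v) / 2"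
definition g :: "int \<times> int \<Rightarrow> real" where "g v = sqrt (\<xi> v * \<zeta> v)"
definition sector :: "int \<times> int \<Rightarrow> int \<times> int \<Rightarrow> real \<Rightarrow> (int \<times> int) set" where
  "sector p w X = {v \<in> P. 0 < cross2 p v \<and> 0 < cross2 v w \<and> \<xi> v * \<zeta> v \<le> X}"

lemma W: "0 < W" using W_pos by (simp add: W_def)

lemma c_nonneg: "0 \<le> c"
proof (rule ccontr)
  assume "\<not> 0 \<le> c"
  then obtain \<delta> where d: "0 < \<delta>" "\<forall>A\<in>SL2. \<forall>a b. 0 < a \<and> a < \<delta> \<and> 0 < b \<and> b < \<delta> \<longrightarrow>
      \<bar>cone_density {v. act2 A v \<in> P} a b - c\<bar> < - c" using density[of "- c"] by auto
  have "\<bar>cone_density P (\<delta> / 2) (\<delta> / 2) - c\<bar> < - c"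
    using d(2)[rule_format, OF SL2_closed(1), of "\<delta> / 2" "\<delta> / 2"] d(1) by simp
  moreover have "0 \<le> cone_density P (\<delta> / 2) (\<delta> / 2)"
    using d by (intro cone_density_bounds) auto
  ultimately show False by linarith
qed

lemma cross2_W: "\<xi> p * \<zeta> w - \<xi> w * \<zeta> p = W * of_int (cross2 p w)"
  by (simp add: \<xi>_def \<zeta>_def W_def cross2_def algebra_simps)

lemma \<xi>_\<zeta>_eq:
  assumes "positive v" shows "\<xi> v = g v * exp (\<tau> v)" "\<zeta> v = g v * exp (- \<tau> v)" "0 < g v"
proof -
  have p: "0 < \<xi> v" "0 < \<zeta> v" using assms by (auto simp: positive_def)
  then show "0 < g v" by (simp add: g_def)
  have "exp (\<tau> v) = sqrt (\<xi> v / \<zeta> v)"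
  proof (rule real_sqrt_unique[symmetric])
    show "(exp (\<tau> v))\<^sup>2 = \<xi> v / \<zeta> v" using p by (simp add: \<tau>_def power2_eq_square flip: exp_add)
  qed simp
  then have e: "exp (\<tau> v) = sqrt (\<xi> v) / sqrt (\<zeta> v)" by (simp add: real_sqrt_divide)
  show "\<xi> v = g v * exp (\<tau> v)" "\<zeta> v = g v * exp (- \<tau> v)"
    using p by (simp_all add: e g_def real_sqrt_mult exp_minus)
qed

text \<open>The hyperbolic counterpart of computing a determinant from two lengths and the sine of
  the enclosed angle. For a unimodular cone it ties the area \<open>1 / (2 * g p * g w)\<close> of
  the triangle directly to the width.\<close>

lemma sinh_cross:
  assumes "positive p" "positive w"
  shows "2 * g p * g w * sinh (\<tau> p - \<tau> w) = W * of_int (cross2 p w)"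
    and "2 * g p * g w * cosh (\<tau> p - \<tau> w) = \<xi> p * \<zeta> w + \<xi> w * \<zeta> p"
  unfolding cross2_W[symmetric] \<xi>_\<zeta>_eq[OF assms(1)] \<xi>_\<zeta>_eq[OF assms(2)]
  by (simp_all add: sinh_def cosh_def exp_diff exp_minus field_simps)

lemma \<tau>_less:
  assumes "positive p" "positive w" "0 < cross2 p w" shows "\<tau> w < \<tau> p"
proof -
  have "0 < W * of_int (cross2 p w)" using assms W by simp
  then have "0 < 2 * g p * g w * sinh (\<tau> p - \<tau> w)" using sinh_cross(1)[OF assms(1,2)] by simp
  moreover have "0 < 2 * g p * g w" using \<xi>_\<zeta>_eq(3) assms by simp
  ultimately have "0 < sinh (\<tau> p - \<tau> w)" by (rule zero_less_mult_pos)
  then show ?thesis by simp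
qed

lemma cone_coordinates:
  "cross2 p w * fst v = cross2 v w * fst p + cross2 p v * fst w"
  "cross2 p w * snd v = cross2 v w * snd p + cross2 p v * snd w"
  by (simp_all add: cross2_def algebra_simps)

lemma cone_coordinates_form:
  "of_int (cross2 p w) * \<xi> v = of_int (cross2 v w) * \<xi> p + of_int (cross2 p v) * \<xi> w"
  "of_int (cross2 p w) * \<zeta> v = of_int (cross2 v w) * \<zeta> p + of_int (cross2 p v) * \<zeta> w"
  by (simp_all add: cross2_def \<xi>_def \<zeta>_def algebra_simps)

lemma positive_cone:
  assumes "positive p" "positive w" "0 < cross2 p w" "0 < cross2 p v" "0 < cross2 v w"
  shows "positive v"
proof -
  have "0 < of_int (cross2 p w) * \<xi> v" "0 < of_int (cross2 p w) * \<zeta> v"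
    unfolding cone_coordinates_form[of p w v] using assms by (auto simp: positive_def intro!: add_pos_pos)
  then show ?thesis using assms(3) by (simp add: positive_def zero_less_mult_iff)
qed

lemma form_eq:
  assumes "positive p" "positive w"
  shows "(of_int (cross2 p w))\<^sup>2 * (\<xi> v * \<zeta> v) =
    (of_int (cross2 v w) * g p)\<^sup>2 + (of_int (cross2 p v) * g w)\<^sup>2 +
    2 * (of_int (cross2 v w) * g p) * (of_int (cross2 p v) * g w) * cosh (\<tau> p - \<tau> w)"
proof -
  let ?s = "of_int (cross2 v w) :: real" and ?t = "of_int (cross2 p v) :: real"
  have g2: "(g p)\<^sup>2 = \<xi> p * \<zeta> p" "(g w)\<^sup>2 = \<xi> w * \<zeta> w" using assms by (auto simp: g_def positive_def)
  have "(of_int (cross2 p w))\<^sup>2 * (\<xi> v * \<zeta> v) = (of_int (cross2 p w) * \<xi> v) * (of_int (cross2 p w) * \<zeta> v)"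
    by (simp add: power2_eq_square mult_ac)
  also have "\<dots> = ?s\<^sup>2 * (\<xi> p * \<zeta> p) + ?t\<^sup>2 * (\<xi> w * \<zeta> w) + ?s * ?t * (\<xi> p * \<zeta> w + \<xi> w * \<zeta> p)"
    unfolding cone_coordinates_form[of p w v] by (simp add: power2_eq_square algebra_simps)
  also have "\<dots> = (?s * g p)\<^sup>2 + (?t * g w)\<^sup>2 + 2 * (?s * g p) * (?t * g w) * cosh (\<tau> p - \<tau> w)"
    unfolding sinh_cross(2)[OF assms, symmetric] by (simp add: power_mult_distrib g2 mult_ac)
  finally show ?thesis .
qed

text \<open>By Cramer's rule \<open>v\<close> has the coordinates \<open>cross2 v w\<close> and
  \<open>cross2 p v\<close> up to the factor \<open>cross2 p w\<close>. In these the norm form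
  differs from the square of the linear form \<open>N\<close> only by a factor \<open>cosh\<close>
  in the mixed term.\<close>

lemma form_bounds:
  assumes "positive p" "positive w" "0 < cross2 p v" "0 < cross2 v w"
  defines "N \<equiv> of_int (cross2 v w) * g p + of_int (cross2 p v) * g w"
  shows "N\<^sup>2 \<le> (of_int (cross2 p w))\<^sup>2 * (\<xi> v * \<zeta> v)"
    and "(of_int (cross2 p w))\<^sup>2 * (\<xi> v * \<zeta> v) \<le> cosh (\<tau> p - \<tau> w) * N\<^sup>2"
proof -
  define a where "a = of_int (cross2 v w) * g p"
  define b where "b = of_int (cross2 p v) * g w"
  define C where "C = cosh (\<tau> p - \<tau> w)"
  have ab: "0 < a" "0 < b" using assms \<xi>_\<zeta>_eq(3) by (auto simp: a_def b_def)
  have C: "1 \<le> C" by (simp add: C_def cosh_real_ge_1)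
  have f: "(of_int (cross2 p w))\<^sup>2 * (\<xi> v * \<zeta> v) = a\<^sup>2 + b\<^sup>2 + 2 * (a * b) * C"
    unfolding form_eq[OF assms(1,2)] by (simp add: a_def b_def C_def mult_ac)
  have N: "N\<^sup>2 = a\<^sup>2 + b\<^sup>2 + 2 * (a * b)" by (simp add: N_def a_def b_def power2_sum)
  have "2 * (a * b) * 1 \<le> 2 * (a * b) * C" using ab C by (intro mult_left_mono) auto
  then show "N\<^sup>2 \<le> (of_int (cross2 p w))\<^sup>2 * (\<xi> v * \<zeta> v)" unfolding f N by simp
  have "1 * a\<^sup>2 \<le> C * a\<^sup>2" "1 * b\<^sup>2 \<le> C * b\<^sup>2" using C by (intro mult_right_mono; simp)+
  then show "(of_int (cross2 p w))\<^sup>2 * (\<xi> v * \<zeta> v) \<le> cosh (\<tau> p - \<tau> w) * N\<^sup>2"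
    unfolding f N C_def[symmetric] by (simp add: algebra_simps)
qed

section \<open>Counting in narrow cones and dissecting wide ones\<close>

lemma finite_sector:
  assumes "positive p" "positive w" "0 < cross2 p w"
  shows "finite (sector p w X)"
proof -
  define K where "K = \<bar>of_int (cross2 p w)\<bar> * sqrt \<bar>X\<bar>"
  have gp: "0 < g p" "0 < g w" using \<xi>_\<zeta>_eq(3) assms by auto
  have "(\<lambda>v. (cross2 v w, cross2 p v)) ` sector p w X \<subseteq> {0..\<lfloor>K / g p\<rfloor>} \<times> {0..\<lfloor>K / g w\<rfloor>}"
  proof (intro image_subsetI)
    fix v assume "v \<in> sector p w X"
    then have v: "0 < cross2 p v" "0 < cross2 v w" "\<xi> v * \<zeta> v \<le> X" by (auto simp: sector_def)
    let ?N = "of_int (cross2 v w) * g p + of_int (cross2 p v) * g w"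
    have "?N\<^sup>2 \<le> (of_int (cross2 p w))\<^sup>2 * (\<xi> v * \<zeta> v)" by (rule form_bounds[OF assms(1,2) v(1,2)])
    also have "\<dots> \<le> (of_int (cross2 p w))\<^sup>2 * \<bar>X\<bar>" using v by (intro mult_left_mono) auto
    also have "\<dots> = K\<^sup>2" by (simp add: K_def power_mult_distrib)
    finally have "?N \<le> K" by (rule power2_le_imp_le) (simp add: K_def)
    moreover have "0 < of_int (cross2 v w) * g p" "0 < of_int (cross2 p v) * g w" using v gp by auto
    ultimately have "of_int (cross2 v w) * g p \<le> K" "of_int (cross2 p v) * g w \<le> K" by linarith+
    then show "(cross2 v w, cross2 p v) \<in> {0..\<lfloor>K / g p\<rfloor>} \<times> {0..\<lfloor>K / g w\<rfloor>}"
      using v gp by (auto simp: le_floor_iff field_simps)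
  qed
  then have "finite ((\<lambda>v. (cross2 v w, cross2 p v)) ` sector p w X)" by (rule finite_subset) auto
  moreover have "inj_on (\<lambda>v. (cross2 v w, cross2 p v)) (sector p w X)"
  proof (rule inj_onI)
    fix v v' assume "(cross2 v w, cross2 p v) = (cross2 v' w, cross2 p v')"
    then have "cross2 p w * fst v = cross2 p w * fst v'" "cross2 p w * snd v = cross2 p w * snd v'"
      unfolding cone_coordinates[of p w v] cone_coordinates[of p w v'] by auto
    then show "v = v'" using assms(3) by (auto simp: prod_eq_iff)
  qed
  ultimately show ?thesis by (rule finite_imageD)
qed

definition counted :: "int \<times> int \<Rightarrow> int \<times> int \<Rightarrow> real \<Rightarrow> bool" where
  "counted p w \<kappa> \<longleftrightarrow> (\<forall>\<kappa>'>\<kappa>. \<forall>\<^sub>F X in at_top.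
    \<bar>real (card (sector p w X)) - c * (\<tau> p - \<tau> w) / W * X\<bar> \<le> \<kappa>' * (\<tau> p - \<tau> w) * X)"

text \<open>In the coordinates of the cone the sector lies between two triangles; their linear
  dimensions differ by the square root of the factor \<open>cosh\<close> in
  \<open>form_bounds\<close>.\<close>

lemma sector_card_unimodular:
  assumes pos: "positive p" "positive w" and cr: "cross2 p w = 1" and X: "0 < X"
  defines "A \<equiv> mat2_of (fst p) (fst w) (snd p) (snd w)" and "C \<equiv> sqrt (cosh (\<tau> p - \<tau> w))"
  shows "card (sector p w X) \<le> card (cone_points {v. act2 A v \<in> P} (g p / sqrt X) (g w / sqrt X))"
    and "card (cone_points {v. act2 A v \<in> P} (C * g p / sqrt X) (C * g w / sqrt X)) \<le> card (sector p w X)"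
proof -
  have g: "0 < g p" "0 < g w" using \<xi>_\<zeta>_eq(3) pos by auto
  have C: "0 < C" unfolding C_def by (simp add: cosh_real_pos)
  have act: "act2 A (cross2 v w, cross2 p v) = v" for v
    using cone_coordinates[of p w v] cr by (simp add: act2_def A_def prod_eq_iff mult.commute)
  have coord: "cross2 (act2 A (s, t)) w = s" "cross2 p (act2 A (s, t)) = t" for s t
  proof -
    have "cross2 (act2 A (s, t)) w = s * cross2 p w" "cross2 p (act2 A (s, t)) = t * cross2 p w"
      by (simp_all add: act2_def A_def cross2_def algebra_simps)
    then show "cross2 (act2 A (s, t)) w = s" "cross2 p (act2 A (s, t)) = t" using cr by simp_all
  qed
  have inj: "inj_on (\<lambda>v. (cross2 v w, cross2 p v)) S" for S
    by (rule inj_on_inverseI[of _ "act2 A"]) (simp add: act)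
  have "(\<lambda>v. (cross2 v w, cross2 p v)) ` sector p w X \<subseteq> cone_points {v. act2 A v \<in> P} (g p / sqrt X) (g w / sqrt X)"
  proof (intro image_subsetI)
    fix v assume "v \<in> sector p w X"
    then have v: "v \<in> P" "0 < cross2 p v" "0 < cross2 v w" "\<xi> v * \<zeta> v \<le> X" by (auto simp: sector_def)
    let ?N = "of_int (cross2 v w) * g p + of_int (cross2 p v) * g w"
    have "?N\<^sup>2 \<le> (sqrt X)\<^sup>2" using form_bounds(1)[OF pos v(2,3)] v(4) cr X by simp
    then have "?N \<le> sqrt X" using X by (intro power2_le_imp_le[of ?N]) auto
    then have "of_int (cross2 v w) * (g p / sqrt X) + of_int (cross2 p v) * (g w / sqrt X) \<le> 1"
      using X by (simp flip: add_divide_distrib)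
    then show "(cross2 v w, cross2 p v) \<in> cone_points {v. act2 A v \<in> P} (g p / sqrt X) (g w / sqrt X)"
      using v act by (simp add: cone_points_def)
  qed
  then show "card (sector p w X) \<le> card (cone_points {v. act2 A v \<in> P} (g p / sqrt X) (g w / sqrt X))"
    using g X by (intro card_inj_on_le[OF inj]) (auto intro!: finite_cone_points)
  have "act2 A ` cone_points {v. act2 A v \<in> P} (C * g p / sqrt X) (C * g w / sqrt X) \<subseteq> sector p w X"
  proof (intro image_subsetI)
    fix u assume "u \<in> cone_points {v. act2 A v \<in> P} (C * g p / sqrt X) (C * g w / sqrt X)"
    then obtain s t where u: "u = (s, t)" "act2 A (s, t) \<in> P" "1 \<le> s" "1 \<le> t"
      "of_int s * (C * g p / sqrt X) + of_int t * (C * g w / sqrt X) \<le> 1" by (auto simp: cone_points_def)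
    let ?v = "act2 A (s, t)" and ?N = "of_int s * g p + of_int t * g w"
    have "C * ?N / sqrt X \<le> 1" using u(5) by (simp add: add_divide_distrib algebra_simps)
    then have "C * ?N \<le> sqrt X" using X by simp
    moreover have "0 \<le> C * ?N" using C g u by (intro mult_nonneg_nonneg add_nonneg_nonneg) auto
    ultimately have "(C * ?N)\<^sup>2 \<le> (sqrt X)\<^sup>2" by (intro power_mono)
    then have "cosh (\<tau> p - \<tau> w) * ?N\<^sup>2 \<le> X" using X by (simp add: power_mult_distrib C_def)
    then have "\<xi> ?v * \<zeta> ?v \<le> X"
      using form_bounds(2)[OF pos, of ?v] u by (simp add: coord cr)
    then show "act2 A u \<in> sector p w X" using u by (simp add: sector_def coord)
  qed
  moreover have "inj_on (act2 A) S" for S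
  proof (rule inj_on_inverseI)
    fix u show "(cross2 (act2 A u) w, cross2 p (act2 A u)) = u" by (cases u) (simp only: coord)
  qed
  ultimately show "card (cone_points {v. act2 A v \<in> P} (C * g p / sqrt X) (C * g w / sqrt X)) \<le> card (sector p w X)"
    using cr by (intro card_inj_on_le[of "act2 A"] finite_sector pos) auto
qed

lemma density_at_top:
  assumes A: "A \<in> SL2" and ab: "0 < a" "0 < b" and e: "0 < e"
  shows "\<forall>\<^sub>F X in at_top. \<bar>2 * a * b * real (card (cone_points {v. act2 A v \<in> P} (a / sqrt X) (b / sqrt X))) - c * X\<bar> \<le> e * X"
proof -
  obtain \<delta> where d: "0 < \<delta>" "\<forall>A\<in>SL2. \<forall>a b. 0 < a \<and> a < \<delta> \<and> 0 < b \<and> b < \<delta> \<longrightarrow>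
      \<bar>cone_density {v. act2 A v \<in> P} a b - c\<bar> < e" using density[OF e] by blast
  have "((\<lambda>X. x / sqrt X) \<longlongrightarrow> 0) at_top" for x :: real
    by (intro tendsto_divide_0[OF tendsto_const] filterlim_at_top_imp_at_infinity sqrt_at_top)
  then have ev: "\<forall>\<^sub>F X in at_top. x / sqrt X < \<delta>" for x :: real using d(1) by (intro order_tendstoD)
  show ?thesis
    using ev[of a] ev[of b] eventually_gt_at_top[of 0]
  proof eventually_elim
    case (elim X)
    let ?n = "real (card (cone_points {v. act2 A v \<in> P} (a / sqrt X) (b / sqrt X)))"
    have "\<bar>cone_density {v. act2 A v \<in> P} (a / sqrt X) (b / sqrt X) - c\<bar> < e"
      using d(2) A elim ab by auto
    moreover have "cone_density {v. act2 A v \<in> P} (a / sqrt X) (b / sqrt X) = 2 * a * b * ?n / X"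
    proof -
      have "sqrt X * sqrt X = X" using elim by simp
      then show ?thesis by (simp add: cone_density_def mult_ac)
    qed
    ultimately have "\<bar>2 * a * b * ?n / X - c\<bar> * X \<le> e * X" using elim by (intro mult_right_mono) auto
    moreover have "\<bar>2 * a * b * ?n / X - c\<bar> * X = \<bar>(2 * a * b * ?n / X - c) * X\<bar>" using elim by (simp add: abs_mult)
    moreover have "(2 * a * b * ?n / X - c) * X = 2 * a * b * ?n - c * X" using elim by (simp add: left_diff_distrib)
    ultimately show ?case by simp
  qed
qed

text \<open>Multiplied by \<open>W\<close>, the count in the outer triangle is asymptotically
  \<open>c * X * sinh \<delta>\<close>. Scaling both coordinates by the square root of
  \<open>cosh \<delta>\<close> divides the area by \<open>cosh \<delta>\<close>, so the inner
  triangle gives \<open>c * X * tanh \<delta>\<close>. Both agree with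
  \<open>c * X * \<delta>\<close> up to the relative error \<theta>.\<close>

lemma counted_narrow:
  assumes \<theta>: "0 < \<theta>" "c * \<theta> / W \<le> \<kappa>"
    and \<eta>: "\<forall>x. 0 < x \<and> x \<le> \<eta> \<longrightarrow> sinh x \<le> (1 + \<theta>) * x \<and> (1 - \<theta>) * x \<le> tanh x"
    and pos: "positive p" "positive w" and cr: "cross2 p w = 1" and small: "\<tau> p - \<tau> w \<le> \<eta>"
  shows "counted p w \<kappa>"
  unfolding counted_def
proof (intro allI impI)
  fix \<kappa>' assume \<kappa>': "\<kappa> < \<kappa>'"
  define \<delta> where "\<delta> = \<tau> p - \<tau> w"
  have \<delta>: "0 < \<delta>" using \<tau>_less[OF pos] cr by (simp add: \<delta>_def)
  have st: "sinh \<delta> \<le> (1 + \<theta>) * \<delta>" "(1 - \<theta>) * \<delta> \<le> tanh \<delta>" using \<eta> small \<delta> by (auto simp: \<delta>_def)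
  have tanh0: "0 < tanh \<delta>" "0 < sinh \<delta>" "tanh \<delta> \<le> sinh \<delta>" using \<delta> by (auto simp: tanh_def divide_le_eq cosh_real_ge_1 cosh_real_pos mult_le_cancel_left1)
  define C where "C = sqrt (cosh \<delta>)"
  have C: "0 < C" "C * C = cosh \<delta>" by (auto simp: C_def cosh_real_pos)
  have g: "0 < g p" "0 < g w" using \<xi>_\<zeta>_eq(3) pos by auto
  have gg: "2 * g p * g w * sinh \<delta> = W" using sinh_cross(1)[OF pos] cr by (simp add: \<delta>_def)
  \<comment> \<open>Chosen so that the density error, once multiplied by
    \<open>sinh \<delta>\<close>, becomes exactly the slack
    \<open>(\<kappa>' - \<kappa>) * \<delta> * W\<close>.\<close>
  define e where "e = (\<kappa>' - \<kappa>) * \<delta> * W / sinh \<delta>"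
  have e: "0 < e" using \<kappa>' \<delta> W tanh0 by (simp add: e_def)
  have esinh: "e * sinh \<delta> = (\<kappa>' - \<kappa>) * \<delta> * W" using tanh0 by (simp add: e_def)
  let ?A = "mat2_of (fst p) (fst w) (snd p) (snd w)"
  have A: "?A \<in> SL2" using cr by (simp add: SL2_iff cross2_def mult.commute)
  have \<theta>\<kappa>: "c * \<theta> * \<delta> \<le> \<kappa> * \<delta> * W"
  proof -
    have "c * \<theta> \<le> \<kappa> * W" using \<theta> W by (simp add: divide_le_eq)
    then have "c * \<theta> * \<delta> \<le> \<kappa> * W * \<delta>" using \<delta> by (intro mult_right_mono) auto
    then show ?thesis by (simp add: mult_ac)
  qed
  have "\<forall>\<^sub>F X in at_top. \<bar>2 * g p * g w * real (card (cone_points {v. act2 ?A v \<in> P} (g p / sqrt X) (g w / sqrt X))) - c * X\<bar> \<le> e * X"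
    using A g e by (intro density_at_top)
  moreover have "\<forall>\<^sub>F X in at_top. \<bar>2 * (C * g p) * (C * g w) * real (card (cone_points {v. act2 ?A v \<in> P} (C * g p / sqrt X) (C * g w / sqrt X))) - c * X\<bar> \<le> e * X"
    using A g e C by (intro density_at_top) auto
  ultimately show "\<forall>\<^sub>F X in at_top. \<bar>real (card (sector p w X)) - c * (\<tau> p - \<tau> w) / W * X\<bar> \<le> \<kappa>' * (\<tau> p - \<tau> w) * X"
    using eventually_gt_at_top[of 0]
  proof eventually_elim
    case (elim X)
    let ?n = "real (card (sector p w X))"
    let ?u = "real (card (cone_points {v. act2 ?A v \<in> P} (g p / sqrt X) (g w / sqrt X)))"
    let ?l = "real (card (cone_points {v. act2 ?A v \<in> P} (C * g p / sqrt X) (C * g w / sqrt X)))"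
    have ul: "?n \<le> ?u" "?l \<le> ?n"
      using sector_card_unimodular[OF pos cr elim(3)] by (simp_all add: C_def \<delta>_def)
    have "W * ?n \<le> W * ?u" using ul W by (intro mult_left_mono) auto
    also have "\<dots> = (2 * g p * g w * ?u) * sinh \<delta>" unfolding gg[symmetric] by (simp add: mult_ac)
    also have "\<dots> \<le> (c * X + e * X) * sinh \<delta>" using elim(1) tanh0 by (intro mult_right_mono) auto
    also have "\<dots> = c * X * sinh \<delta> + (e * sinh \<delta>) * X" by (simp add: algebra_simps)
    also have "c * X * sinh \<delta> \<le> c * X * ((1 + \<theta>) * \<delta>)" using st c_nonneg elim by (intro mult_left_mono) auto
    also have "\<dots> = c * \<delta> * X + (c * \<theta> * \<delta>) * X" by (simp add: algebra_simps)
    also have "(c * \<theta> * \<delta>) * X \<le> (\<kappa> * \<delta> * W) * X" using \<theta>\<kappa> elim by (intro mult_right_mono) auto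
    finally have 1: "W * ?n \<le> c * \<delta> * X + \<kappa>' * \<delta> * X * W" unfolding esinh by (simp add: algebra_simps)
    have th: "tanh \<delta> * cosh \<delta> = sinh \<delta>" by (simp add: tanh_def)
    have "(c * X - e * X) * tanh \<delta> \<le> (2 * (C * g p) * (C * g w) * ?l) * tanh \<delta>"
      using elim(2) tanh0 by (intro mult_right_mono) auto
    also have "\<dots> = 2 * g p * g w * (tanh \<delta> * (C * C)) * ?l" by (simp add: mult_ac)
    also have "\<dots> = W * ?l" unfolding C(2) th gg ..
    also have "\<dots> \<le> W * ?n" using ul W by (intro mult_left_mono) auto
    finally have "c * X * tanh \<delta> - (e * tanh \<delta>) * X \<le> W * ?n" by (simp add: algebra_simps)
    moreover have "e * tanh \<delta> \<le> e * sinh \<delta>" using e tanh0 by (intro mult_left_mono) auto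
    then have "(e * tanh \<delta>) * X \<le> ((\<kappa>' - \<kappa>) * \<delta> * W) * X" unfolding esinh using elim by (intro mult_right_mono) auto
    moreover have "c * X * ((1 - \<theta>) * \<delta>) \<le> c * X * tanh \<delta>" using st c_nonneg elim by (intro mult_left_mono) auto
    moreover have "(c * \<theta> * \<delta>) * X \<le> (\<kappa> * \<delta> * W) * X" using \<theta>\<kappa> elim by (intro mult_right_mono) auto
    ultimately have 2: "c * \<delta> * X - \<kappa>' * \<delta> * X * W \<le> W * ?n" by (simp add: algebra_simps)
    have "\<bar>W * ?n - c * \<delta> * X\<bar> \<le> \<kappa>' * \<delta> * X * W" using 1 2 by linarith
    moreover have "W * ?n - c * \<delta> * X = W * (?n - c * \<delta> / W * X)" using W by (simp add: field_simps)
    ultimately have "\<bar>?n - c * \<delta> / W * X\<bar> * W \<le> \<kappa>' * \<delta> * X * W" using W by (simp add: abs_mult mult.commute)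
    then show ?case using W by (simp add: \<delta>_def)
  qed
qed

text \<open>Cutting along the ray of \<open>q\<close> loses at most one vector of \<open>P\<close>:
  a primitive vector on the line of \<open>q\<close> is \<open>q\<close> or its negative, and the
  latter lies outside the sector.\<close>

lemma counted_add:
  assumes pos: "positive p" "positive q" "positive w" and cr: "0 < cross2 p q" "0 < cross2 q w" "0 < cross2 p w"
    and q: "q \<in> primitive_vectors" and E: "counted p q \<kappa>" "counted q w \<kappa>"
  shows "counted p w \<kappa>"
  unfolding counted_def
proof (intro allI impI)
  fix \<kappa>' assume \<kappa>': "\<kappa> < \<kappa>'"
  \<comment> \<open>The two halves of the sector use up the slack as far as \<mu>; the part from
    \<mu> to \<open>\<kappa>'\<close> pays for the vector \<open>q\<close> once \<open>X\<close> is
    large.\<close>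
  define \<mu> where "\<mu> = (\<kappa> + \<kappa>') / 2"
  have \<mu>: "\<kappa> < \<mu>" "\<mu> < \<kappa>'" using \<kappa>' by (auto simp: \<mu>_def)
  have \<delta>: "0 < \<tau> p - \<tau> w" using \<tau>_less[OF pos(1,3) cr(3)] by simp
  have split: "sector p w X = sector p q X \<union> sector q w X \<union> (sector p w X \<inter> {q})" for X
  proof (intro equalityI subsetI)
    fix v assume v: "v \<in> sector p w X"
    then have vp: "v \<in> P" "0 < cross2 p v" "0 < cross2 v w" by (auto simp: sector_def)
    consider "0 < cross2 q v" | "0 < cross2 v q" | "cross2 q v = 0" by (auto simp: cross2_def) linarith
    then show "v \<in> sector p q X \<union> sector q w X \<union> (sector p w X \<inter> {q})"
    proof cases
      case 3
      then have "v = q \<or> v = - q" using parallel_primitive[OF q _ 3] vp primitive by blast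
      moreover have "v \<noteq> - q" using vp(2) cr(1) by (auto simp: cross2_def)
      ultimately show ?thesis using v by blast
    qed (use v in \<open>auto simp: sector_def\<close>)
  next
    fix v assume v: "v \<in> sector p q X \<union> sector q w X \<union> (sector p w X \<inter> {q})"
    have "0 < cross2 p v" if "0 < cross2 q v" "0 < cross2 v w"
    proof -
      have "0 < cross2 q w * cross2 p v" unfolding cross2_identity[of q w p v] using that cr by (auto intro!: add_pos_pos)
      then show ?thesis using cr by (simp add: zero_less_mult_iff)
    qed
    moreover have "0 < cross2 v w" if "0 < cross2 p v" "0 < cross2 v q"
    proof -
      have "cross2 p q * cross2 v w = cross2 p v * cross2 q w + cross2 v q * cross2 p w"
        by (simp add: cross2_def algebra_simps)
      then have "0 < cross2 p q * cross2 v w" using that cr by (auto intro!: add_pos_pos)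
      then show ?thesis using cr by (simp add: zero_less_mult_iff)
    qed
    ultimately show "v \<in> sector p w X" using v by (auto simp: sector_def)
  qed
  have card: "card (sector p w X) = card (sector p q X) + card (sector q w X) + card (sector p w X \<inter> {q})" for X
  proof -
    have fin: "finite (sector p q X)" "finite (sector q w X)" using pos cr by (auto intro: finite_sector)
    have "sector p q X \<inter> sector q w X = {}" by (auto simp: sector_def cross2_def)
    moreover have "(sector p q X \<union> sector q w X) \<inter> (sector p w X \<inter> {q}) = {}" by (auto simp: sector_def cross2_def)
    ultimately show ?thesis using fin by (subst split) (simp add: card_Un_disjoint)
  qed
  have "\<forall>\<^sub>F X in at_top. \<bar>real (card (sector p q X)) - c * (\<tau> p - \<tau> q) / W * X\<bar> \<le> \<mu> * (\<tau> p - \<tau> q) * X"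
    "\<forall>\<^sub>F X in at_top. \<bar>real (card (sector q w X)) - c * (\<tau> q - \<tau> w) / W * X\<bar> \<le> \<mu> * (\<tau> q - \<tau> w) * X"
    using E \<mu> unfolding counted_def by blast+
  moreover have "\<forall>\<^sub>F X in at_top. 1 / ((\<kappa>' - \<mu>) * (\<tau> p - \<tau> w)) \<le> X" by (rule eventually_ge_at_top)
  ultimately show "\<forall>\<^sub>F X in at_top. \<bar>real (card (sector p w X)) - c * (\<tau> p - \<tau> w) / W * X\<bar> \<le> \<kappa>' * (\<tau> p - \<tau> w) * X"
  proof eventually_elim
    case (elim X)
    have "0 < (\<kappa>' - \<mu>) * (\<tau> p - \<tau> w)" using \<mu> \<delta> by simp
    then have 1: "1 \<le> (\<kappa>' - \<mu>) * (\<tau> p - \<tau> w) * X" using elim(3) by (simp add: divide_le_eq mult.commute)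
    have 2: "real (card (sector p w X \<inter> {q})) \<le> 1" using card_Int_singleton_le[of "sector p w X" q] by simp
    have 3: "c * (\<tau> p - \<tau> w) / W * X = c * (\<tau> p - \<tau> q) / W * X + c * (\<tau> q - \<tau> w) / W * X"
      by (simp add: diff_divide_distrib algebra_simps)
    have 4: "\<mu> * (\<tau> p - \<tau> q) * X + \<mu> * (\<tau> q - \<tau> w) * X + (\<kappa>' - \<mu>) * (\<tau> p - \<tau> w) * X = \<kappa>' * (\<tau> p - \<tau> w) * X"
      by (simp add: algebra_simps)
    have 5: "\<bar>a + b + x - (a' + b')\<bar> \<le> e + e' + e''"
      if "\<bar>a - a'\<bar> \<le> e" "\<bar>b - b'\<bar> \<le> e'" "1 \<le> e''" "x \<le> 1" "0 \<le> x" for a b x a' b' e e' e'' :: real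
      using that by linarith
    show ?case unfolding card 3 4[symmetric] of_nat_add by (rule 5[OF elim(1,2) 1 2]) simp
  qed
qed

text \<open>Since \<open>g\<close> is superadditive on the positive cone, \<open>g p + g w\<close> grows by at least \<open>m\<close> when the cone is cut
  at \<open>p + w\<close>; and a unimodular cone on which \<open>g p g w\<close> is large is narrow, by \<open>sinh_cross\<close>.\<close>

lemma counted_refine:
  assumes narrow: "\<And>p w. positive p \<Longrightarrow> positive w \<Longrightarrow> cross2 p w = 1 \<Longrightarrow> \<tau> p - \<tau> w \<le> \<eta> \<Longrightarrow> counted p w \<kappa>"
    and m: "0 < m" and \<eta>: "0 < \<eta>"
    and "positive p" "positive w" "cross2 p w = 1" "m \<le> g p" "m \<le> g w" "W / (m * \<eta>) \<le> g p + g w + real k * m"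
  shows "counted p w \<kappa>"
  using assms(4-)
proof (induction k arbitrary: p w)
  case 0
  have gg: "2 * g p * g w * sinh (\<tau> p - \<tau> w) = W" using sinh_cross(1)[of p w] 0 by simp
  have d: "0 < \<tau> p - \<tau> w" using \<tau>_less[of p w] 0 by simp
  \<comment> \<open>As both values of \<open>g\<close> are at least \<open>m\<close>, a large sum
    forces a large product: \<open>2 * g p * g w\<close> is at least \<open>W / \<eta>\<close>,
    hence the \<open>sinh\<close> of the width, and with it the width, is at most \<eta>.\<close>
  have "m * (g p + g w) \<le> 2 * (g p * g w)"
  proof -
    have "m * g p \<le> g w * g p" "m * g w \<le> g p * g w" using 0 m by (intro mult_right_mono; simp)+
    then show ?thesis by (simp add: algebra_simps)
  qed
  moreover have "W / \<eta> \<le> m * (g p + g w)"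
  proof -
    have "m * (W / (m * \<eta>)) \<le> m * (g p + g w)" using 0 m by (intro mult_left_mono) auto
    then show ?thesis using m by simp
  qed
  ultimately have "W / \<eta> \<le> 2 * (g p * g w)" by simp
  then have "W / \<eta> * (\<tau> p - \<tau> w) \<le> 2 * (g p * g w) * (\<tau> p - \<tau> w)" using d by (intro mult_right_mono) auto
  also have "\<dots> \<le> 2 * (g p * g w) * sinh (\<tau> p - \<tau> w)" using d 0 m by (intro mult_left_mono le_sinh) auto
  also have "\<dots> = W" using gg by (simp add: mult_ac)
  finally have "W * (\<tau> p - \<tau> w) \<le> W * \<eta>" using \<eta> by (simp add: field_simps)
  then have "\<tau> p - \<tau> w \<le> \<eta>" using W by (simp only: mult_le_cancel_left_pos)
  then show ?case using 0 by (intro narrow) auto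
next
  case (Suc k)
  define q where "q = p + w"
  have cr: "cross2 p q = 1" "cross2 q w = 1" using Suc.prems(3) by (auto simp: q_def cross2_def algebra_simps)
  have pq: "positive q" using Suc.prems cr by (intro positive_cone[of p w q]) auto
  have prim: "q \<in> primitive_vectors"
  proof -
    have "mat2_of (fst q) (fst w) (snd q) (snd w) \<in> SL2" using cr(2) by (simp add: SL2_iff cross2_def mult.commute)
    from act2_e1_primitive[OF this] show ?thesis by (simp add: act2_e1)
  qed
  have "(g p + g w)\<^sup>2 \<le> \<xi> q * \<zeta> q"
    using form_bounds(1)[of p w q] Suc.prems cr by simp
  also have "\<dots> = (g q)\<^sup>2" using pq by (simp add: g_def positive_def)
  finally have gq: "g p + g w \<le> g q" by (rule power2_le_imp_le) (use \<xi>_\<zeta>_eq(3)[OF pq] in simp)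
  have "counted p q \<kappa>" "counted q w \<kappa>"
    using Suc.prems gq cr pq m by (auto intro!: Suc.IH simp: algebra_simps)
  then show ?case using Suc.prems cr pq prim by (intro counted_add[of p q w]) auto
qed

lemma counted_unimodular:
  assumes "0 < \<kappa>" "positive p" "positive w" "cross2 p w = 1"
  shows "counted p w \<kappa>"
proof -
  \<comment> \<open>The denominator \<open>c + 1\<close> instead of \<open>c\<close> covers the case
    \<open>c = 0\<close>.\<close>
  define \<theta> where "\<theta> = \<kappa> * W / (c + 1)"
  have \<theta>: "0 < \<theta>" using assms W c_nonneg by (simp add: \<theta>_def)
  have "c * \<theta> \<le> (c + 1) * \<theta>" using \<theta> by (intro mult_right_mono) auto
  also have "\<dots> = \<kappa> * W" using c_nonneg by (simp add: \<theta>_def)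
  finally have \<theta>': "c * \<theta> / W \<le> \<kappa>" using W by (simp add: divide_le_eq)
  obtain \<eta> where \<eta>: "0 < \<eta>" "\<forall>x. 0 < x \<and> x \<le> \<eta> \<longrightarrow> sinh x \<le> (1 + \<theta>) * x \<and> (1 - \<theta>) * x \<le> tanh x"
    using sinh_tanh_small[OF \<theta>] by blast
  define m where "m = min (g p) (g w)"
  have m: "0 < m" using \<xi>_\<zeta>_eq(3) assms by (simp add: m_def)
  obtain k where k: "W / (m * \<eta>) < real k * m" using reals_Archimedean3[OF m] by blast
  show ?thesis
  proof (rule counted_refine[OF counted_narrow[OF \<theta> \<theta>' \<eta>(2)] m \<eta>(1) assms(2-4)])
    show "W / (m * \<eta>) \<le> g p + g w + real k * m" using k \<xi>_\<zeta>_eq(3) assms(2,3) by (smt (verit))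
  qed (auto simp: m_def)
qed

text \<open>A Euclidean descent on the determinant: a vector \<open>q\<close> with
  \<open>cross2 p q = 1\<close> splits off a unimodular cone next to \<open>p\<close>, and the
  remaining cone has as determinant a residue modulo the old one.\<close>

lemma counted_general:
  assumes "0 < \<kappa>" "positive p" "positive w" "0 < cross2 p w" "p \<in> primitive_vectors" "w \<in> primitive_vectors"
  shows "counted p w \<kappa>"
  using assms(2-)
proof (induction "nat (cross2 p w)" arbitrary: p rule: less_induct)
  case less
  let ?D = "cross2 p w"
  show ?case
  proof (cases "?D = 1")
    case True
    then show ?thesis using less.prems assms(1) by (intro counted_unimodular) auto
  next
    case False
    obtain A where A: "A \<in> SL2" "act2 A (1, 0) = p" using primitive_eq_act2_e1[OF less.prems(4)] by blast
    define q0 where "q0 = (A$1$2, A$2$2)"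
    have "cross2 p q0 = 1" using A by (auto simp: q0_def cross2_def act2_e1 SL2_iff mult.commute)
    \<comment> \<open>Adding a multiple of \<open>p\<close> to \<open>q0\<close> keeps
      \<open>cross2 p q = 1\<close> and changes \<open>cross2 q w\<close> by multiples of
      \<open>cross2 p w\<close>; this \<open>k\<close> selects the residue.\<close>
    define k where "k = - (cross2 q0 w div ?D)"
    define q where "q = (fst q0 + k * fst p, snd q0 + k * snd p)"
    have pq: "cross2 p q = 1" using \<open>cross2 p q0 = 1\<close> by (simp add: q_def cross2_def algebra_simps)
    have "cross2 q w = cross2 q0 w + k * ?D" by (simp add: q_def cross2_def algebra_simps)
    also have "\<dots> = cross2 q0 w mod ?D" by (simp add: k_def minus_div_mult_eq_mod)
    finally have qw: "cross2 q w = cross2 q0 w mod ?D" .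
    have prim: "q \<in> primitive_vectors"
    proof -
      have "mat2_of (fst q) (- fst p) (snd q) (- snd p) \<in> SL2" using pq by (simp add: SL2_iff cross2_def algebra_simps)
      from act2_e1_primitive[OF this] show ?thesis by (simp add: act2_e1)
    qed
    have "cross2 q w \<noteq> 0"
    proof
      assume "cross2 q w = 0"
      then have "w = q \<or> w = - q" using parallel_primitive[OF prim less.prems(5)] by simp
      then have "?D = 1 \<or> ?D = - 1" using pq by (auto simp: cross2_def)
      then show False using False less.prems by auto
    qed
    then have qw': "0 < cross2 q w" "cross2 q w < ?D" using less.prems(3) pos_mod_bound[OF less.prems(3), of "cross2 q0 w"] pos_mod_sign[OF less.prems(3), of "cross2 q0 w"]
      unfolding qw by linarith+
    have posq: "positive q" using less.prems qw' pq by (intro positive_cone[of p w q]) auto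
    have "counted q w \<kappa>" using qw' posq less.prems prim by (intro less.hyps) auto
    moreover have "counted p q \<kappa>" using posq less.prems pq assms(1) by (intro counted_unimodular) auto
    ultimately show ?thesis using less.prems posq pq qw' prim by (intro counted_add[of p q w]) auto
  qed
qed

theorem sector_asymptotics:
  assumes "positive p" "positive w" "0 < cross2 p w" "p \<in> primitive_vectors" "w \<in> primitive_vectors"
  shows "((\<lambda>X. real (card (sector p w X)) / X) \<longlongrightarrow> c * (\<tau> p - \<tau> w) / W) at_top"
proof (rule tendstoI)
  fix e :: real assume e: "0 < e"
  have d: "0 < \<tau> p - \<tau> w" using \<tau>_less assms by simp
  define \<kappa> where "\<kappa> = e / (4 * (\<tau> p - \<tau> w))"
  have "0 < \<kappa>" unfolding \<kappa>_def by (rule divide_pos_pos) (use e d in auto)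
  then have \<kappa>: "0 < \<kappa>" "\<kappa> < 2 * \<kappa>" by auto
  have "\<forall>\<^sub>F X in at_top. \<bar>real (card (sector p w X)) - c * (\<tau> p - \<tau> w) / W * X\<bar> \<le> 2 * \<kappa> * (\<tau> p - \<tau> w) * X"
    using counted_general[OF \<kappa>(1) assms] \<kappa>(2) unfolding counted_def by blast
  then show "\<forall>\<^sub>F X in at_top. dist (real (card (sector p w X)) / X) (c * (\<tau> p - \<tau> w) / W) < e"
    using eventually_gt_at_top[of 0]
  proof eventually_elim
    case (elim X)
    let ?L = "c * (\<tau> p - \<tau> w) / W"
    have "\<bar>real (card (sector p w X)) / X - ?L\<bar> = \<bar>real (card (sector p w X)) - ?L * X\<bar> / X"
    proof -
      have "real (card (sector p w X)) / X - ?L = (real (card (sector p w X)) - ?L * X) / X"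
        using elim by (simp add: diff_divide_distrib)
      then show ?thesis using elim by simp
    qed
    also have "\<dots> \<le> 2 * \<kappa> * (\<tau> p - \<tau> w)" using elim by (simp add: divide_le_eq)
    also have "2 * (e / (4 * D)) * D = e / 2" if "0 < D" for D :: real using that by simp
    from this[OF d] have "2 * \<kappa> * (\<tau> p - \<tau> w) = e / 2" unfolding \<kappa>_def .
    also have "\<dots> < e" using e by simp
    finally show ?case by (simp add: dist_real_def)
  qed
qed

section \<open>Half-open sectors described by ratios of the two forms\<close>

lemma card_sector_boundary:
  assumes pos: "positive p" "positive w" and cr: "0 < cross2 p w"
    and S: "sector p w X \<subseteq> S" "S \<subseteq> sector p w X \<union> {u}"
  shows "\<bar>real (card S) - real (card (sector p w X))\<bar> \<le> 1"
proof -
  have fin: "finite (sector p w X)" by (rule finite_sector[OF pos cr])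
  then have "card (sector p w X) \<le> card S" using S by (intro card_mono) (auto intro: finite_subset)
  moreover have "card S \<le> card (insert u (sector p w X))" using fin S by (intro card_mono) auto
  moreover have "card (insert u (sector p w X)) \<le> Suc (card (sector p w X))" by (simp add: card_insert_if fin)
  ultimately show ?thesis by linarith
qed

lemma sector_boundary_asymptotics:
  assumes "positive p" "positive w" "0 < cross2 p w" "p \<in> primitive_vectors" "w \<in> primitive_vectors"
    and S: "\<And>X. sector p w X \<subseteq> S X" "\<And>X. S X \<subseteq> sector p w X \<union> {u}"
  shows "((\<lambda>X. real (card (S X)) / X) \<longlongrightarrow> c * (\<tau> p - \<tau> w) / W) at_top"
proof -
  have "((\<lambda>X. real (card (S X)) / X - real (card (sector p w X)) / X) \<longlongrightarrow> 0) at_top"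
  proof (rule Lim_null_comparison)
    show "\<forall>\<^sub>F X in at_top. norm (real (card (S X)) / X - real (card (sector p w X)) / X) \<le> 1 / X"
      using eventually_gt_at_top[of 0]
    proof eventually_elim
      case (elim X)
      have "\<bar>real (card (S X)) - real (card (sector p w X))\<bar> / X \<le> 1 / X"
        using card_sector_boundary[OF assms(1-3) S] elim by (intro divide_right_mono) auto
      then show ?case using elim by (simp flip: diff_divide_distrib)
    qed
    show "((\<lambda>X::real. 1 / X) \<longlongrightarrow> 0) at_top" by real_asymp
  qed
  from tendsto_add[OF this sector_asymptotics[OF assms(1-5)]] show ?thesis by simp
qed

text \<open>Within the cone where both forms are positive, primitive vectors with the same ratio
  coincide. Closing the sector on one side therefore adds at most the boundary vector
  itself.\<close>

lemma ratio_sector_asymptotics: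
  assumes u: "u \<in> primitive_vectors" "0 < \<xi> u" "0 < \<zeta> u" and u': "u' \<in> primitive_vectors" "0 < \<xi> u'" "0 < \<zeta> u'"
    and less: "\<xi> u / \<zeta> u < \<xi> u' / \<zeta> u'"
  shows "((\<lambda>X. real (card {v \<in> P. 0 < \<xi> v \<and> 0 < \<zeta> v \<and> \<xi> u / \<zeta> u \<le> \<xi> v / \<zeta> v \<and> \<xi> v / \<zeta> v < \<xi> u' / \<zeta> u' \<and> \<xi> v * \<zeta> v \<le> X}) / X)
      \<longlongrightarrow> c * (ln ((\<xi> u' / \<zeta> u') / (\<xi> u / \<zeta> u)) / 2) / W) at_top" (is ?A)
    and "((\<lambda>X. real (card {v \<in> P. 0 < \<xi> v \<and> 0 < \<zeta> v \<and> \<xi> u / \<zeta> u < \<xi> v / \<zeta> v \<and> \<xi> v / \<zeta> v \<le> \<xi> u' / \<zeta> u' \<and> \<xi> v * \<zeta> v \<le> X}) / X)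
      \<longlongrightarrow> c * (ln ((\<xi> u' / \<zeta> u') / (\<xi> u / \<zeta> u)) / 2) / W) at_top" (is ?B)
proof -
  have pos: "positive u'" "positive u" using u u' by (auto simp: positive_def)
  have ratio: "\<xi> v / \<zeta> v < \<xi> v' / \<zeta> v' \<longleftrightarrow> 0 < cross2 v' v" if "0 < \<zeta> v" "0 < \<zeta> v'" for v v'
  proof -
    have "\<xi> v / \<zeta> v < \<xi> v' / \<zeta> v' \<longleftrightarrow> 0 < W * of_int (cross2 v' v)"
      using that cross2_W[of v' v] by (simp add: divide_less_eq field_simps)
    then show ?thesis using W by (simp add: zero_less_mult_iff)
  qed
  have ratio_eq: "\<xi> v / \<zeta> v = \<xi> v' / \<zeta> v' \<longleftrightarrow> cross2 v' v = 0" if "0 < \<zeta> v" "0 < \<zeta> v'" for v v'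
  proof -
    have "\<xi> v / \<zeta> v = \<xi> v' / \<zeta> v' \<longleftrightarrow> W * of_int (cross2 v' v) = 0"
      using that cross2_W[of v' v] by (auto simp: field_simps)
    then show ?thesis using W by simp
  qed
  have same: "v = v'" if "v \<in> primitive_vectors" "v' \<in> primitive_vectors" "0 < \<zeta> v" "0 < \<zeta> v'" "\<xi> v / \<zeta> v = \<xi> v' / \<zeta> v'" for v v'
  proof -
    have "v = v' \<or> v = - v'" using parallel_primitive[OF that(2,1)] ratio_eq that by blast
    moreover have "v \<noteq> - v'" using that(3,4) by (auto simp: \<zeta>_def)
    ultimately show ?thesis by blast
  qed
  have cr: "0 < cross2 u' u" using ratio u u' less by blast
  have sec: "sector u' u X = {v \<in> P. 0 < \<xi> v \<and> 0 < \<zeta> v \<and> \<xi> u / \<zeta> u < \<xi> v / \<zeta> v \<and> \<xi> v / \<zeta> v < \<xi> u' / \<zeta> u' \<and> \<xi> v * \<zeta> v \<le> X}" for X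
  proof (intro equalityI subsetI)
    fix v assume v: "v \<in> sector u' u X"
    then have "positive v" using positive_cone[OF pos cr] by (auto simp: sector_def)
    then show "v \<in> {v \<in> P. 0 < \<xi> v \<and> 0 < \<zeta> v \<and> \<xi> u / \<zeta> u < \<xi> v / \<zeta> v \<and> \<xi> v / \<zeta> v < \<xi> u' / \<zeta> u' \<and> \<xi> v * \<zeta> v \<le> X}"
      using v ratio[of u v] ratio[of v u'] u u' by (simp add: positive_def sector_def)
  next
    fix v assume "v \<in> {v \<in> P. 0 < \<xi> v \<and> 0 < \<zeta> v \<and> \<xi> u / \<zeta> u < \<xi> v / \<zeta> v \<and> \<xi> v / \<zeta> v < \<xi> u' / \<zeta> u' \<and> \<xi> v * \<zeta> v \<le> X}"
    then show "v \<in> sector u' u X" using ratio[of u v] ratio[of v u'] u u' by (simp add: sector_def)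
  qed
  have \<tau>: "\<tau> u' - \<tau> u = ln ((\<xi> u' / \<zeta> u') / (\<xi> u / \<zeta> u)) / 2"
    using u u' by (simp add: \<tau>_def ln_div ln_mult field_simps)
  have "((\<lambda>X. real (card {v \<in> P. 0 < \<xi> v \<and> 0 < \<zeta> v \<and> \<xi> u / \<zeta> u \<le> \<xi> v / \<zeta> v \<and> \<xi> v / \<zeta> v < \<xi> u' / \<zeta> u' \<and> \<xi> v * \<zeta> v \<le> X}) / X)
      \<longlongrightarrow> c * (\<tau> u' - \<tau> u) / W) at_top"
    using primitive same[OF _ u(1) _ u(3)]
    by (intro sector_boundary_asymptotics[where u = u] pos cr u' u) (auto simp: sec le_less)
  then show ?A unfolding \<tau> .
  have "((\<lambda>X. real (card {v \<in> P. 0 < \<xi> v \<and> 0 < \<zeta> v \<and> \<xi> u / \<zeta> u < \<xi> v / \<zeta> v \<and> \<xi> v / \<zeta> v \<le> \<xi> u' / \<zeta> u' \<and> \<xi> v * \<zeta> v \<le> X}) / X)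
      \<longlongrightarrow> c * (\<tau> u' - \<tau> u) / W) at_top"
    using primitive same[OF _ u'(1) _ u'(3)]
    by (intro sector_boundary_asymptotics[where u = u'] pos cr u' u) (auto simp: sec le_less)
  then show ?B unfolding \<tau> .
qed

end

definition linear_form :: "real \<Rightarrow> real \<Rightarrow> int \<times> int \<Rightarrow> real" where
  "linear_form a b v = a * of_int (fst v) + b * of_int (snd v)"

text \<open>For a negative determinant the two forms are interchanged. This inverts the ratios, so
  the closed end of the sector becomes the other one; hence the two half-open versions
  before.\<close>

lemma ratio_sector_count:
  fixes x1 x2 z1 z2 c :: real and P :: "(int \<times> int) set"
  defines "\<xi> \<equiv> linear_form x1 x2" and "\<zeta> \<equiv> linear_form z1 z2"
  assumes W: "x1 * z2 - x2 * z1 \<noteq> 0" and prim: "P \<subseteq> primitive_vectors"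
    and density: "\<And>e. 0 < e \<Longrightarrow> \<exists>\<delta>>0. \<forall>A\<in>SL2. \<forall>a b. 0 < a \<and> a < \<delta> \<and> 0 < b \<and> b < \<delta> \<longrightarrow>
      \<bar>cone_density {v. act2 A v \<in> P} a b - c\<bar> < e"
    and u: "u \<in> primitive_vectors" "0 < \<xi> u" "0 < \<zeta> u" and u': "u' \<in> primitive_vectors" "0 < \<xi> u'" "0 < \<zeta> u'"
    and less: "\<xi> u / \<zeta> u < \<xi> u' / \<zeta> u'"
  shows "((\<lambda>X. real (card {v \<in> P. 0 < \<xi> v \<and> 0 < \<zeta> v \<and> \<xi> u / \<zeta> u \<le> \<xi> v / \<zeta> v \<and> \<xi> v / \<zeta> v < \<xi> u' / \<zeta> u' \<and> \<xi> v * \<zeta> v \<le> X}) / X)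
      \<longlongrightarrow> c * (ln ((\<xi> u' / \<zeta> u') / (\<xi> u / \<zeta> u)) / 2) / \<bar>x1 * z2 - x2 * z1\<bar>) at_top"
proof (cases "0 < x1 * z2 - x2 * z1")
  case True
  interpret fs: form_sector x1 x2 z1 z2 P c by standard (use True prim density in auto)
  have eq: "fs.\<xi> = \<xi>" "fs.\<zeta> = \<zeta>" by (auto simp: fun_eq_iff fs.\<xi>_def fs.\<zeta>_def \<xi>_def \<zeta>_def linear_form_def)
  show ?thesis using fs.ratio_sector_asymptotics(1)[of u u'] u u' less True by (simp add: eq fs.W_def)
next
  case False
  then have neg: "0 < z1 * x2 - z2 * x1" using W by (simp add: mult.commute)
  interpret fs: form_sector z1 z2 x1 x2 P c by standard (use neg prim density in auto)
  have eq: "fs.\<xi> = \<zeta>" "fs.\<zeta> = \<xi>" by (auto simp: fun_eq_iff fs.\<xi>_def fs.\<zeta>_def \<xi>_def \<zeta>_def linear_form_def)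
  have flip: "\<zeta> v / \<xi> v < \<zeta> v' / \<xi> v' \<longleftrightarrow> \<xi> v' / \<zeta> v' < \<xi> v / \<zeta> v"
    if "0 < \<xi> v" "0 < \<zeta> v" "0 < \<xi> v'" "0 < \<zeta> v'" for v v'
    using that by (auto simp: field_simps)
  have set_eq: "{v \<in> P. 0 < \<zeta> v \<and> 0 < \<xi> v \<and> \<zeta> u' / \<xi> u' < \<zeta> v / \<xi> v \<and> \<zeta> v / \<xi> v \<le> \<zeta> u / \<xi> u \<and> \<zeta> v * \<xi> v \<le> X} =
      {v \<in> P. 0 < \<xi> v \<and> 0 < \<zeta> v \<and> \<xi> u / \<zeta> u \<le> \<xi> v / \<zeta> v \<and> \<xi> v / \<zeta> v < \<xi> u' / \<zeta> u' \<and> \<xi> v * \<zeta> v \<le> X}" for X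
    using flip[of u'] flip[of u] u u' by (auto simp: not_less[symmetric] mult.commute)
  have "(\<zeta> u / \<xi> u) / (\<zeta> u' / \<xi> u') = (\<xi> u' / \<zeta> u') / (\<xi> u / \<zeta> u)" by (simp add: field_simps)
  moreover have "\<bar>x1 * z2 - x2 * z1\<bar> = z1 * x2 - z2 * x1" using neg by (simp add: mult.commute)
  moreover have "\<zeta> u' / \<xi> u' < \<zeta> u / \<xi> u" using flip less u u' by simp
  ultimately show ?thesis using fs.ratio_sector_asymptotics(2)[of u' u] u u'
    by (simp only: eq fs.W_def set_eq)
qed

section \<open>Fundamental domains of hyperbolic cyclic groups\<close>

text \<open>The homography on irrational numbers, where the denominator never vanishes; all points
  of the orbits are of this kind, so the point at infinity can be left aside.\<close>

definition mobius :: "mat2 \<Rightarrow> real \<Rightarrow> real" where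
  "mobius A \<omega> = (of_int (A$1$1) * \<omega> + of_int (A$1$2)) / (of_int (A$2$1) * \<omega> + of_int (A$2$2))"

lemma irrational_linear_eq_0:
  assumes "\<omega> \<notin> \<rat>" "of_int c * \<omega> + of_int d = 0"
  shows "c = 0 \<and> d = 0"
proof -
  have "c = 0"
  proof (rule ccontr)
    assume "c \<noteq> 0"
    then have "\<omega> = - of_int d / of_int c" using assms(2) by (simp add: field_simps eq_neg_iff_add_eq_0)
    then show False using assms(1) by simp
  qed
  then show ?thesis using assms(2) by simp
qed

lemma mobius_denominator:
  assumes "A \<in> SL2" "\<omega> \<notin> \<rat>" shows "of_int (A$2$1) * \<omega> + of_int (A$2$2) \<noteq> 0"
  using irrational_linear_eq_0[OF assms(2), of "A$2$1" "A$2$2"] assms(1) by (auto simp: SL2_iff)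

lemma mobius_one [simp]: "mobius (mat 1) \<omega> = \<omega>"
  by (simp add: mobius_def)

lemma mobius_translation [simp]: "mobius (translation_mat k) \<omega> = \<omega> + of_int k"
  by (simp add: mobius_def translation_mat_def)

lemma mobius_mult_aux:
  fixes a b c d a' b' c' d' x :: real
  assumes "c' * x + d' \<noteq> 0" "(c * a' + d * c') * x + (c * b' + d * d') \<noteq> 0"
  shows "((a * a' + b * c') * x + (a * b' + b * d')) / ((c * a' + d * c') * x + (c * b' + d * d')) =
    (a * ((a' * x + b') / (c' * x + d')) + b) / (c * ((a' * x + b') / (c' * x + d')) + d)"
proof -
  define D where "D = c' * x + d'"
  have D: "D \<noteq> 0" using assms(1) by (simp add: D_def)
  have 1: "a * ((a' * x + b') / D) + b = ((a * a' + b * c') * x + (a * b' + b * d')) / D" for a b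
  proof -
    have "a * (u / D) + b = (a * u + b * D) / D" for u using D by (simp add: add_divide_distrib)
    from this[of "a' * x + b'"] show ?thesis by (simp add: D_def algebra_simps)
  qed
  show ?thesis unfolding D_def[symmetric] 1 using D by simp
qed

lemma mobius_mult:
  assumes "A \<in> SL2" "B \<in> SL2" "\<omega> \<notin> \<rat>"
  shows "mobius (A ** B) \<omega> = mobius A (mobius B \<omega>)"
  using mobius_mult_aux[OF mobius_denominator[OF assms(2,3)], of "of_int (A$2$1)" _ "of_int (A$2$2)"]
    mobius_denominator[OF SL2_closed(2)[OF assms(1,2)] assms(3)]
  by (simp add: mobius_def mat2_mult_nth)

lemma mobius_irrational:
  assumes A: "A \<in> SL2" and \<omega>: "\<omega> \<notin> \<rat>"
  shows "mobius A \<omega> \<notin> \<rat>"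
proof
  define r where "r = mobius A \<omega>"
  let ?a = "of_int (A$1$1) :: real" and ?b = "of_int (A$1$2) :: real" and ?c = "of_int (A$2$1) :: real" and ?d = "of_int (A$2$2) :: real"
  assume "mobius A \<omega> \<in> \<rat>"
  then have r: "r \<in> \<rat>" by (simp add: r_def)
  have "?a * \<omega> + ?b = r * (?c * \<omega> + ?d)"
    using mobius_denominator[OF A \<omega>] by (simp add: r_def mobius_def)
  then have eq: "(?a - r * ?c) * \<omega> = r * ?d - ?b" by (simp add: algebra_simps)
  have det: "?a * ?d - ?b * ?c = 1" using A unfolding SL2_iff by (simp flip: of_int_mult of_int_diff)
  show False
  proof (cases "?a - r * ?c = 0")
    case True
    then have "?a = r * ?c" "?b = r * ?d" using eq by auto
    then show False using det by simp
  next
    case False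
    then have "\<omega> = (r * ?d - ?b) / (?a - r * ?c)" using eq by (simp add: field_simps)
    then have "\<omega> \<in> \<rat>" using r by simp
    then show False using \<omega> by simp
  qed
qed

lemma mobius_adj2:
  assumes "A \<in> SL2" "\<omega> \<notin> \<rat>"
  shows "mobius (adj2 A) (mobius A \<omega>) = \<omega>" "mobius A (mobius (adj2 A) \<omega>) = \<omega>"
  using assms mobius_mult[of "adj2 A" A \<omega>] mobius_mult[of A "adj2 A" \<omega>] adj2_inverse[OF assms(1)] by auto

lemma mobius_diff:
  assumes "A \<in> SL2" "x \<notin> \<rat>" "y \<notin> \<rat>"
  shows "mobius A x - mobius A y = (x - y) /
    ((of_int (A$2$1) * x + of_int (A$2$2)) * (of_int (A$2$1) * y + of_int (A$2$2)))"
proof -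
  have det: "of_int (A$1$1) * of_int (A$2$2) - of_int (A$1$2) * of_int (A$2$1) = (1::real)"
    using assms(1) unfolding SL2_iff by (simp flip: of_int_mult of_int_diff)
  have "(a * x + b) / (c * x + d) - (a * y + b) / (c * y + d) = (a * d - b * c) * (x - y) / ((c * x + d) * (c * y + d))"
    if "c * x + d \<noteq> 0" "c * y + d \<noteq> 0" for a b c d :: real
    using that by (simp add: diff_frac_eq) (simp add: algebra_simps)
  from this[OF mobius_denominator[OF assms(1,2)] mobius_denominator[OF assms(1,3)]] det
  show ?thesis by (simp add: mobius_def)
qed

section \<open>Two sectors as a fundamental domain, and the count of vectors in them\<close>

lemma exp_floor_bounds:
  assumes "0 < L" "0 < (x :: real)"
  shows "\<exists>k::int. 1 \<le> exp (2 * (of_int k * L)) * x \<and> exp (2 * (of_int k * L)) * x < exp (2 * L)"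
proof -
  define y where "y = ln x / (2 * L)"
  define k where "k = - \<lfloor>y\<rfloor>"
  have y: "ln x = y * (2 * L)" using assms by (simp add: y_def)
  have "exp (2 * (of_int k * L)) * x = exp (2 * (of_int k * L) + ln x)" using assms by (simp add: exp_add)
  also have "2 * (of_int k * L) + ln x = 2 * L * (y + of_int k)" by (simp add: y algebra_simps)
  finally have e: "exp (2 * (of_int k * L)) * x = exp (2 * L * (y + of_int k))" .
  have "0 \<le> y + of_int k" "y + of_int k < 1" unfolding k_def by linarith+
  moreover have "1 \<le> exp (2 * L * t) \<and> exp (2 * L * t) < exp (2 * L)" if "0 \<le> t" "t < 1" for t
    using that assms(1) by simp
  ultimately have "1 \<le> exp (2 * (of_int k * L)) * x \<and> exp (2 * (of_int k * L)) * x < exp (2 * L)"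
    unfolding e by blast
  then show ?thesis by (rule exI)
qed

text \<open>In the application \<open>Z\<close> consists of all matrices that represent elements of
  the cyclic group. They scale the two eigenforms by reciprocal factors; \<open>Z_surj\<close> can
  ask for the positive sign because \<open>Z\<close> contains \<open>- mat 1\<close>. The condition
  \<open>conj\<close> is what makes heights of orbit points computable.\<close>

locale hyperbolic_pair = finite_index_matrix_group +
  fixes \<alpha> \<alpha>' L :: real and Z :: "mat2 set"
  assumes irrational: "\<alpha> \<notin> \<rat>" "\<alpha>' \<notin> \<rat>" and distinct: "\<alpha> \<noteq> \<alpha>'" and L_pos: "0 < L"
    and Z_sub: "Z \<subseteq> H" and Z_group: "matrix_group Z"
    and Z_character: "A \<in> Z \<Longrightarrow> \<exists>k::int. \<exists>\<sigma>\<in>{1, -1}. \<forall>v.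
      linear_form 1 (- \<alpha>) (act2 A v) = \<sigma> * exp (of_int k * L) * linear_form 1 (- \<alpha>) v \<and>
      linear_form 1 (- \<alpha>') (act2 A v) = \<sigma> * exp (- (of_int k * L)) * linear_form 1 (- \<alpha>') v"
    and Z_surj: "\<exists>A\<in>Z. \<forall>v.
      linear_form 1 (- \<alpha>) (act2 A v) = exp (of_int k * L) * linear_form 1 (- \<alpha>) v \<and>
      linear_form 1 (- \<alpha>') (act2 A v) = exp (- (of_int k * L)) * linear_form 1 (- \<alpha>') v"
    and conj: "A \<in> SL2 \<Longrightarrow> galois_conj (mobius A \<alpha>) = mobius A \<alpha>'" "A \<in> SL2 \<Longrightarrow> galois_conj (mobius A \<alpha>') = mobius A \<alpha>"
begin

abbreviation "\<xi> \<equiv> linear_form 1 (- \<alpha>)"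
abbreviation "\<zeta> \<equiv> linear_form 1 (- \<alpha>')"

lemma forms_nonzero:
  assumes "v \<noteq> (0, 0)" shows "\<xi> v \<noteq> 0" "\<zeta> v \<noteq> 0"
proof -
  have "linear_form 1 (- \<omega>) v \<noteq> 0" if \<omega>: "\<omega> \<notin> \<rat>" for \<omega>
  proof
    assume "linear_form 1 (- \<omega>) v = 0"
    then have "of_int (- snd v) * \<omega> + of_int (fst v) = 0" by (simp add: linear_form_def)
    from irrational_linear_eq_0[OF \<omega> this] show False using assms by (simp add: prod_eq_iff)
  qed
  then show "\<xi> v \<noteq> 0" "\<zeta> v \<noteq> 0" using irrational by blast+
qed

lemma forms_inject:
  assumes "\<xi> v = \<xi> w" shows "v = w"
proof -
  have "\<xi> (fst v - fst w, snd v - snd w) = 0" using assms by (simp add: linear_form_def algebra_simps)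
  then have "(fst v - fst w, snd v - snd w) = (0, 0)" using forms_nonzero by blast
  then show ?thesis by (simp add: prod_eq_iff)
qed

lemma primitive_nonzero: "v \<in> primitive_vectors \<Longrightarrow> v \<noteq> (0, 0)"
  by (auto simp: primitive_vectors_def)

lemma Z_identity:
  assumes "A \<in> SL2" "\<And>v. \<xi> (act2 A v) = \<xi> v" shows "A = mat 1"
proof -
  have "act2 A (1, 0) = (1, 0)" "act2 A (0, 1) = (0, 1)" using assms(2) forms_inject by blast+
  then show ?thesis by (auto simp: act2_def mat2_eq_iff)
qed

lemma Z_fixes:
  assumes "A \<in> Z" shows "mobius A \<alpha> = \<alpha>" "mobius A \<alpha>' = \<alpha>'"
proof -
  have SL: "A \<in> SL2" using assms Z_sub mem_SL2 by blast
  have fixes_root: "mobius A \<omega> = \<omega>" if "\<omega> \<notin> \<rat>" "\<And>v. linear_form 1 (- \<omega>) (act2 A v) = \<mu> * linear_form 1 (- \<omega>) v" for \<omega> \<mu>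
  proof -
    have "linear_form 1 (- \<omega>) (act2 A (0, 1)) = - \<omega> * linear_form 1 (- \<omega>) (act2 A (1, 0))"
      unfolding that(2) by (simp add: linear_form_def)
    then have "of_int (A$1$1) * \<omega> + of_int (A$1$2) = \<omega> * (of_int (A$2$1) * \<omega> + of_int (A$2$2))"
      by (simp add: linear_form_def act2_def algebra_simps)
    then show ?thesis using mobius_denominator[OF SL that(1)] by (simp add: mobius_def)
  qed
  obtain k :: int and \<sigma> where k: "\<forall>v. \<xi> (act2 A v) = \<sigma> * exp (of_int k * L) * \<xi> v \<and> \<zeta> (act2 A v) = \<sigma> * exp (- (of_int k * L)) * \<zeta> v"
    using Z_character[OF assms] by blast
  show "mobius A \<alpha> = \<alpha>" by (rule fixes_root[OF irrational(1)]) (use k in blast)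
  show "mobius A \<alpha>' = \<alpha>'" by (rule fixes_root[OF irrational(2)]) (use k in blast)
qed

definition neg_base :: "int \<times> int" where
  "neg_base = (SOME v. v \<in> primitive_vectors \<and> 0 < \<xi> v \<and> \<zeta> v < 0)"

text \<open>A fraction strictly between the two roots, in lowest terms, yields such a vector up to
  sign. It bounds the sector where \<zeta> is negative, as \<open>(1, 0)\<close> does where \<zeta>
  is positive.\<close>

lemma neg_base: "neg_base \<in> primitive_vectors" "0 < \<xi> neg_base" "\<zeta> neg_base < 0"
proof -
  have "\<exists>v. v \<in> primitive_vectors \<and> 0 < \<xi> v \<and> \<zeta> v < 0"
  proof -
    have "min \<alpha> \<alpha>' < max \<alpha> \<alpha>'" using distinct by auto
    then obtain t where t: "t \<in> \<rat>" "min \<alpha> \<alpha>' < t" "t < max \<alpha> \<alpha>'" using Rats_dense_in_real by blast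
    obtain a b where ab: "t = of_int a / of_int b" "0 < b" "coprime a b" using Rats_cases'[OF t(1)] by metis
    have bt: "of_int a = of_int b * t" using ab by simp
    show ?thesis
    proof (cases "\<alpha> < \<alpha>'")
      case True
      then have "of_int b * \<alpha> < of_int a" "of_int a < of_int b * \<alpha>'" using t ab unfolding bt by auto
      then show ?thesis using ab(3) by (intro exI[of _ "(a, b)"]) (auto simp: linear_form_def primitive_vectors_def mult.commute)
    next
      case False
      then have "of_int b * \<alpha>' < of_int a" "of_int a < of_int b * \<alpha>" using t ab distinct unfolding bt by auto
      then show ?thesis using ab(3) by (intro exI[of _ "(- a, - b)"]) (auto simp: linear_form_def primitive_vectors_def mult.commute)
    qed
  qed
  from someI_ex[OF this] show "neg_base \<in> primitive_vectors" "0 < \<xi> neg_base" "\<zeta> neg_base < 0"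
    by (auto simp: neg_base_def)
qed

text \<open>A fundamental domain for \<open>Z\<close> is cut out by two sectors, one in each of the cones on which the
  norm form \<open>\<xi> \<zeta>\<close> has constant sign. Both are bounded by rays through integral vectors, so that they
  can be dissected into unimodular cones.\<close>

definition base_ratio :: "int \<times> int \<Rightarrow> real" where
  "base_ratio v = (if 0 < \<zeta> v then 1 else \<xi> neg_base / - \<zeta> neg_base)"

text \<open>The condition on \<xi> chooses between \<open>v\<close> and its negative. A generator
  multiplies \<open>\<xi> / \<bar>\<zeta>\<bar>\<close> by \<open>exp (2 * L)\<close> or its
  inverse, and the half-open interval contains exactly one term of each resulting geometric
  progression.\<close>

definition in_domain :: "int \<times> int \<Rightarrow> bool" where
  "in_domain v \<longleftrightarrow> 0 < \<xi> v \<and> 1 \<le> \<xi> v / \<bar>\<zeta> v\<bar> / base_ratio v \<and> \<xi> v / \<bar>\<zeta> v\<bar> / base_ratio v < exp (2 * L)"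

definition domain_vectors :: "real \<Rightarrow> (int \<times> int) set" where
  "domain_vectors X = {v \<in> orbit_vectors. in_domain v \<and> \<bar>\<xi> v * \<zeta> v\<bar> \<le> X}"

lemma base_ratio_pos: "0 < base_ratio v"
  using neg_base by (simp add: base_ratio_def divide_pos_neg)

lemma domain_exists:
  assumes "v \<noteq> (0, 0)" shows "\<exists>A\<in>Z. in_domain (act2 A v)"
proof -
  interpret Z: matrix_group Z by (rule Z_group)
  obtain s where s: "s \<in> Z" "0 < \<xi> (act2 s v)" "act2 s v \<noteq> (0, 0)"
  proof (cases "0 < \<xi> v")
    case True
    then show ?thesis using that[of "mat 1"] Z.one_mem assms by simp
  next
    case False
    then have "0 < \<xi> (- v)" using forms_nonzero[OF assms] by (simp add: linear_form_def)
    then show ?thesis using that[of "- mat 1"] Z.uminus_mem[OF Z.one_mem] assms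
      by (auto simp: act2_uminus prod_eq_iff)
  qed
  define w where "w = act2 s v"
  have nz: "\<zeta> w \<noteq> 0" using forms_nonzero s(3) by (simp add: w_def)
  then have "0 < \<xi> w / \<bar>\<zeta> w\<bar> / base_ratio w" using s base_ratio_pos[of w] by (simp add: w_def)
  from exp_floor_bounds[OF L_pos this] obtain k :: int where
    k: "1 \<le> exp (2 * (of_int k * L)) * (\<xi> w / \<bar>\<zeta> w\<bar> / base_ratio w)" "exp (2 * (of_int k * L)) * (\<xi> w / \<bar>\<zeta> w\<bar> / base_ratio w) < exp (2 * L)"
    by blast
  obtain A where A: "A \<in> Z" "\<forall>v. \<xi> (act2 A v) = exp (of_int k * L) * \<xi> v \<and> \<zeta> (act2 A v) = exp (- (of_int k * L)) * \<zeta> v"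
    using Z_surj by blast
  have Aw: "\<xi> (act2 A w) = exp (of_int k * L) * \<xi> w" "\<zeta> (act2 A w) = exp (- (of_int k * L)) * \<zeta> w"
    using A(2)[rule_format, of w] by blast+
  have "base_ratio (act2 A w) = base_ratio w" using Aw by (simp add: base_ratio_def zero_less_mult_iff)
  moreover have "\<xi> (act2 A w) / \<bar>\<zeta> (act2 A w)\<bar> = exp (2 * (of_int k * L)) * (\<xi> w / \<bar>\<zeta> w\<bar>)"
  proof -
    have "exp (2 * (of_int k * L)) = exp (of_int k * L) * exp (of_int k * L)" by (simp flip: exp_add)
    then show ?thesis using Aw by (simp add: abs_mult exp_minus divide_inverse mult_ac)
  qed
  ultimately have "in_domain (act2 A w)" using k Aw s by (simp add: in_domain_def w_def)
  then have "in_domain (act2 (A ** s) v)" by (simp add: w_def act2_mult)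
  then show ?thesis using A s Z.mult_mem by blast
qed

lemma domain_unique:
  assumes "A \<in> Z" "in_domain v" "in_domain (act2 A v)" shows "A = mat 1"
proof -
  obtain k :: int and \<sigma> where \<sigma>: "\<sigma> \<in> {1, -1}" and
    k: "\<forall>v. \<xi> (act2 A v) = \<sigma> * exp (of_int k * L) * \<xi> v \<and> \<zeta> (act2 A v) = \<sigma> * exp (- (of_int k * L)) * \<zeta> v"
    using Z_character[OF assms(1)] by blast
  have kv: "\<xi> (act2 A v) = \<sigma> * exp (of_int k * L) * \<xi> v" "\<zeta> (act2 A v) = \<sigma> * exp (- (of_int k * L)) * \<zeta> v" for v
    using k[rule_format, of v] by blast+
  have pos: "0 < \<xi> v" "0 < \<xi> (act2 A v)" using assms by (auto simp: in_domain_def)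
  have "\<sigma> = 1"
  proof (rule ccontr)
    assume "\<sigma> \<noteq> 1"
    then have "\<xi> (act2 A v) = - (exp (of_int k * L) * \<xi> v)" using \<sigma> kv by auto
    moreover have "0 < exp (of_int k * L) * \<xi> v" using pos by simp
    ultimately show False using pos by linarith
  qed
  define x where "x = \<xi> v / \<bar>\<zeta> v\<bar> / base_ratio v"
  have "base_ratio (act2 A v) = base_ratio v" using kv \<open>\<sigma> = 1\<close> by (simp add: base_ratio_def zero_less_mult_iff)
  moreover have "\<xi> (act2 A v) / \<bar>\<zeta> (act2 A v)\<bar> = exp (2 * (of_int k * L)) * (\<xi> v / \<bar>\<zeta> v\<bar>)"
  proof -
    have "exp (2 * (of_int k * L)) = exp (of_int k * L) * exp (of_int k * L)" by (simp flip: exp_add)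
    then show ?thesis using kv \<open>\<sigma> = 1\<close> by (simp add: abs_mult exp_minus divide_inverse mult_ac)
  qed
  ultimately have x: "1 \<le> x" "x < exp (2 * L)" "1 \<le> exp (2 * (of_int k * L)) * x" "exp (2 * (of_int k * L)) * x < exp (2 * L)"
    using assms by (auto simp: in_domain_def x_def)
  have "k = 0"
  proof (rule ccontr)
    assume "k \<noteq> 0"
    then consider "1 \<le> k" | "k \<le> - 1" by linarith
    then show False
    proof cases
      case 1
      then have "1 * L \<le> of_int k * L" using L_pos by (intro mult_right_mono) auto
      then have "exp (2 * L) * 1 \<le> exp (2 * (of_int k * L)) * x" using x by (intro mult_mono) auto
      then show False using x by simp
    next
      case 2
      then have "of_int k * L \<le> of_int (- 1) * L" using L_pos by (intro mult_right_mono) (auto simp del: of_int_minus)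
      then have "of_int k * L \<le> - L" by simp
      then have "2 * (of_int k * L) \<le> - (2 * L)" by linarith
      then have "exp (2 * (of_int k * L)) \<le> exp (- (2 * L))" by (simp only: exp_le_cancel_iff)
      then have "exp (2 * (of_int k * L)) * x \<le> exp (- (2 * L)) * x" using x by (intro mult_right_mono) simp_all
      also have "\<dots> < exp (- (2 * L)) * exp (2 * L)" using x by (intro mult_strict_left_mono) auto
      also have "\<dots> = 1" by (simp flip: exp_add)
      finally show False using x by simp
    qed
  qed
  then have "\<xi> (act2 A v) = \<xi> v" for v using kv[of v] \<open>\<sigma> = 1\<close> by simp
  then show ?thesis using assms(1) Z_sub mem_SL2 by (intro Z_identity) auto
qed

lemma norm_form_invariant:
  assumes "A \<in> Z" shows "\<bar>\<xi> (act2 A v) * \<zeta> (act2 A v)\<bar> = \<bar>\<xi> v * \<zeta> v\<bar>"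
proof -
  obtain k :: int and \<sigma> where \<sigma>: "\<sigma> \<in> {1, -1}" and
    k: "\<forall>v. \<xi> (act2 A v) = \<sigma> * exp (of_int k * L) * \<xi> v \<and> \<zeta> (act2 A v) = \<sigma> * exp (- (of_int k * L)) * \<zeta> v"
    using Z_character[OF assms] by blast
  have kv: "\<xi> (act2 A v) = \<sigma> * exp (of_int k * L) * \<xi> v" "\<zeta> (act2 A v) = \<sigma> * exp (- (of_int k * L)) * \<zeta> v"
    using k[rule_format, of v] by blast+
  have "\<xi> (act2 A v) * \<zeta> (act2 A v) = (\<sigma> * \<sigma>) * (exp (of_int k * L) * exp (- (of_int k * L))) * (\<xi> v * \<zeta> v)"
    using kv by (simp add: mult_ac)
  also have "\<dots> = \<xi> v * \<zeta> v" using \<sigma> by (auto simp flip: exp_add)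
  finally show ?thesis by simp
qed

text \<open>On the domain \<xi> and the absolute value of \<zeta> are of the same order, so a bound
  for their product bounds both; the coordinates of \<open>v\<close> are recovered linearly from
  them, as the two roots are distinct.\<close>

lemma finite_domain_vectors: "finite (domain_vectors X)"
proof -
  define R where "R = max 1 (\<xi> neg_base / - \<zeta> neg_base)"
  define r where "r = min 1 (\<xi> neg_base / - \<zeta> neg_base)"
  have r: "0 < r" "0 < R" using base_ratio_pos[of neg_base] neg_base by (auto simp: r_def R_def base_ratio_def)
  define B where "B = \<bar>X\<bar> * (R * exp (2 * L)) + \<bar>X\<bar> / r + 1"
  have bounds: "\<bar>\<xi> v\<bar> \<le> B \<and> \<bar>\<zeta> v\<bar> \<le> B" if "v \<in> domain_vectors X" for v
  proof -
    have v: "0 < \<xi> v" "1 \<le> \<xi> v / \<bar>\<zeta> v\<bar> / base_ratio v" "\<xi> v / \<bar>\<zeta> v\<bar> / base_ratio v < exp (2 * L)" "\<xi> v * \<bar>\<zeta> v\<bar> \<le> \<bar>X\<bar>" "\<zeta> v \<noteq> 0"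
      using that orbit_vectors_primitive primitive_nonzero forms_nonzero by (auto simp: domain_vectors_def in_domain_def abs_mult)
    have br: "r \<le> base_ratio v" "base_ratio v \<le> R" by (auto simp: base_ratio_def r_def R_def)
    have lo: "r * \<bar>\<zeta> v\<bar> \<le> \<xi> v"
    proof -
      have "base_ratio v * \<bar>\<zeta> v\<bar> \<le> \<xi> v" using v base_ratio_pos[of v] by (simp add: field_simps)
      moreover have "r * \<bar>\<zeta> v\<bar> \<le> base_ratio v * \<bar>\<zeta> v\<bar>" using br by (intro mult_right_mono) auto
      ultimately show ?thesis by linarith
    qed
    have hi: "\<xi> v \<le> R * exp (2 * L) * \<bar>\<zeta> v\<bar>"
    proof -
      have "\<xi> v \<le> exp (2 * L) * base_ratio v * \<bar>\<zeta> v\<bar>" using v base_ratio_pos[of v] by (simp add: field_simps)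
      also have "\<dots> \<le> exp (2 * L) * R * \<bar>\<zeta> v\<bar>" using br by (intro mult_right_mono mult_left_mono) auto
      finally show ?thesis by (simp add: mult_ac)
    qed
    have sq: "t \<le> s + 1" if "t * t \<le> s" "0 \<le> s" for s t :: real
    proof (rule ccontr)
      assume "\<not> t \<le> s + 1"
      then have "(s + 1) * (s + 1) \<le> t * t" using that by (intro mult_mono) auto
      moreover have "s < (s + 1) * (s + 1)" using that by (simp add: algebra_simps add_pos_nonneg)
      ultimately show False using that by linarith
    qed
    have "\<xi> v * \<xi> v \<le> R * exp (2 * L) * (\<xi> v * \<bar>\<zeta> v\<bar>)" using mult_left_mono[OF hi, of "\<xi> v"] v by (simp add: mult_ac)
    also have "\<dots> \<le> R * exp (2 * L) * \<bar>X\<bar>" using v r by (intro mult_left_mono) auto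
    finally have 1: "\<xi> v \<le> R * exp (2 * L) * \<bar>X\<bar> + 1" using r by (intro sq) auto
    have "\<bar>\<zeta> v\<bar> * (r * \<bar>\<zeta> v\<bar>) \<le> \<bar>\<zeta> v\<bar> * \<xi> v" using lo by (intro mult_left_mono) auto
    then have "\<bar>\<zeta> v\<bar> * \<bar>\<zeta> v\<bar> * r \<le> \<bar>X\<bar>" using v by (simp add: mult_ac)
    then have "\<bar>\<zeta> v\<bar> * \<bar>\<zeta> v\<bar> \<le> \<bar>X\<bar> / r" using r by (simp only: pos_le_divide_eq)
    then have 2: "\<bar>\<zeta> v\<bar> \<le> \<bar>X\<bar> / r + 1" using r by (intro sq) auto
    have "0 \<le> \<bar>X\<bar> / r" "0 \<le> R * exp (2 * L) * \<bar>X\<bar>" using r by auto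
    then show ?thesis using 1 2 v unfolding B_def by (simp add: mult_ac)
  qed
  define N where "N = \<lceil>B + \<bar>\<alpha>\<bar> * (2 * B / \<bar>\<alpha> - \<alpha>'\<bar>) + 2 * B / \<bar>\<alpha> - \<alpha>'\<bar>\<rceil>"
  have "domain_vectors X \<subseteq> {- N..N} \<times> {- N..N}"
  proof
    fix v assume "v \<in> domain_vectors X"
    from bounds[OF this] have b: "\<bar>\<xi> v\<bar> \<le> B" "\<bar>\<zeta> v\<bar> \<le> B" by auto
    have "\<bar>of_int (snd v)\<bar> * \<bar>\<alpha> - \<alpha>'\<bar> = \<bar>\<zeta> v - \<xi> v\<bar>"
      unfolding abs_mult[symmetric] by (simp add: linear_form_def algebra_simps)
    also have "\<dots> \<le> 2 * B" using b by linarith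
    finally have s: "\<bar>of_int (snd v)\<bar> \<le> 2 * B / \<bar>\<alpha> - \<alpha>'\<bar>" using distinct by (simp add: pos_le_divide_eq)
    have "\<bar>of_int (fst v)\<bar> \<le> \<bar>\<xi> v\<bar> + \<bar>\<alpha> * of_int (snd v)\<bar>" by (simp add: linear_form_def)
    also have "\<bar>\<alpha> * of_int (snd v)\<bar> \<le> \<bar>\<alpha>\<bar> * (2 * B / \<bar>\<alpha> - \<alpha>'\<bar>)" unfolding abs_mult using s by (intro mult_left_mono) auto
    finally have f: "\<bar>of_int (fst v)\<bar> \<le> B + \<bar>\<alpha>\<bar> * (2 * B / \<bar>\<alpha> - \<alpha>'\<bar>)" using b by linarith
    have B0: "0 \<le> 2 * B / \<bar>\<alpha> - \<alpha>'\<bar>" "0 \<le> B" using s b by linarith+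
    then have "0 \<le> \<bar>\<alpha>\<bar> * (2 * B / \<bar>\<alpha> - \<alpha>'\<bar>)" by (intro mult_nonneg_nonneg) auto
    moreover have "B + \<bar>\<alpha>\<bar> * (2 * B / \<bar>\<alpha> - \<alpha>'\<bar>) + 2 * B / \<bar>\<alpha> - \<alpha>'\<bar> \<le> of_int N" unfolding N_def by (rule le_of_int_ceiling)
    ultimately have "of_int \<bar>snd v\<bar> \<le> (of_int N :: real)" "of_int \<bar>fst v\<bar> \<le> (of_int N :: real)" using s f B0 by (simp_all only: of_int_abs)
    then have "\<bar>snd v\<bar> \<le> N" "\<bar>fst v\<bar> \<le> N" by (simp_all only: of_int_le_iff)
    then show "v \<in> {- N..N} \<times> {- N..N}" by (cases v) auto
  qed
  then show ?thesis by (rule finite_subset) auto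
qed

text \<open>Each sector runs from a primitive vector to its image under an element of
  \<open>Z\<close> that multiplies the ratio by \<open>exp (2 * L)\<close>, so its width is
  \<open>L\<close>. The determinant of the forms is the difference of the roots up to sign. The two
  sectors contribute equally, which doubles the 6 of the density.\<close>

theorem domain_vectors_asymptotics:
  "((\<lambda>X. real (card (domain_vectors X)) / X) \<longlongrightarrow>
    12 * real width * L / (pi\<^sup>2 * real (card cosets) * \<bar>\<alpha> - \<alpha>'\<bar>)) at_top"
proof -
  define c where "c = 6 * real width / (pi\<^sup>2 * real (card cosets))"
  have dens: "\<exists>\<delta>>0. \<forall>A\<in>SL2. \<forall>a b. 0 < a \<and> a < \<delta> \<and> 0 < b \<and> b < \<delta> \<longrightarrow>
      \<bar>cone_density {v. act2 A v \<in> orbit_vectors} a b - c\<bar> < e" if "0 < e" for e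
    using pulled_orbit_density[OF that] unfolding pulled_orbit_def c_def .
  obtain K where K: "K \<in> Z" "\<forall>v. \<xi> (act2 K v) = exp (of_int 1 * L) * \<xi> v \<and> \<zeta> (act2 K v) = exp (- (of_int 1 * L)) * \<zeta> v"
    using Z_surj by blast
  have K1: "\<xi> (act2 K v) = exp L * \<xi> v" "\<zeta> (act2 K v) = exp (- L) * \<zeta> v" for v
    using K(2)[rule_format, of v] by simp_all
  have K_prim: "act2 K v \<in> primitive_vectors" if v: "v \<in> primitive_vectors" for v
  proof -
    obtain A where "A \<in> SL2" "act2 A (1, 0) = v" using primitive_eq_act2_e1[OF v] by blast
    then show ?thesis using act2_e1_primitive[of "K ** A"] K Z_sub mem_SL2 by (auto simp: act2_mult)
  qed
  have ratioK: "(exp L * x) / (exp (- L) * y) = exp (2 * L) * (x / y)" for x y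
  proof -
    have "exp (2 * L) = exp L * exp L" by (simp flip: exp_add)
    then show ?thesis by (simp add: exp_minus divide_inverse mult_ac)
  qed
  have e2: "1 < exp (2 * L)" using L_pos by simp
  define D1 where "D1 X = {v \<in> orbit_vectors. 0 < \<xi> v \<and> 0 < \<zeta> v \<and> 1 \<le> \<xi> v / \<zeta> v \<and> \<xi> v / \<zeta> v < exp (2 * L) \<and> \<xi> v * \<zeta> v \<le> X}" for X
  \<comment> \<open>On the cone where \<zeta> is negative its sign is changed, so that both forms
    are positive there and the sector count applies.\<close>
  define \<zeta>' where "\<zeta>' = linear_form (- 1) \<alpha>'"
  have \<zeta>': "\<zeta>' v = - \<zeta> v" for v by (simp add: \<zeta>'_def linear_form_def)
  define \<rho> where "\<rho> = \<xi> neg_base / \<zeta>' neg_base"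
  have \<rho>: "0 < \<rho>" using neg_base by (simp add: \<rho>_def \<zeta>' divide_pos_neg)
  define D2 where "D2 X = {v \<in> orbit_vectors. 0 < \<xi> v \<and> 0 < \<zeta>' v \<and> \<rho> \<le> \<xi> v / \<zeta>' v \<and> \<xi> v / \<zeta>' v < exp (2 * L) * \<rho> \<and> \<xi> v * \<zeta>' v \<le> X}" for X
  have "((\<lambda>X. real (card (D1 X)) / X) \<longlongrightarrow> c * (ln (exp (2 * L)) / 2) / \<bar>1 * - \<alpha>' - - \<alpha> * 1\<bar>) at_top"
  proof -
    have u: "(1, 0) \<in> primitive_vectors" "\<xi> (1, 0) = 1" "\<zeta> (1, 0) = 1" by (auto simp: primitive_vectors_def linear_form_def)
    have r: "\<xi> (act2 K (1, 0)) / \<zeta> (act2 K (1, 0)) = exp (2 * L)" "\<xi> (1, 0) / \<zeta> (1, 0) = 1" unfolding K1 ratioK u by simp_all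
    show ?thesis
      using ratio_sector_count[of 1 "- \<alpha>'" "- \<alpha>" 1 orbit_vectors c "(1, 0)" "act2 K (1, 0)", OF _ orbit_vectors_primitive dens u(1)]
        u K_prim[OF u(1)] distinct e2 K1
      unfolding r by (simp add: D1_def u)
  qed
  moreover have "((\<lambda>X. real (card (D2 X)) / X) \<longlongrightarrow> c * (ln (exp (2 * L)) / 2) / \<bar>1 * \<alpha>' - - \<alpha> * - 1\<bar>) at_top"
  proof -
    have r: "\<xi> (act2 K neg_base) / \<zeta>' (act2 K neg_base) = exp (2 * L) * \<rho>" unfolding \<zeta>' K1 \<rho>_def
      using ratioK[of "\<xi> neg_base" "\<zeta> neg_base"] by simp
    have "exp (2 * L) * \<rho> / \<rho> = exp (2 * L)" "\<rho> < exp (2 * L) * \<rho>" using \<rho> e2 by auto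
    then show ?thesis
      using ratio_sector_count[of 1 \<alpha>' "- \<alpha>" "- 1" orbit_vectors c neg_base "act2 K neg_base", OF _ orbit_vectors_primitive dens neg_base(1)]
        neg_base K_prim[OF neg_base(1)] distinct K1
      unfolding \<zeta>'_def[symmetric] r \<rho>_def[symmetric] by (simp add: D2_def \<zeta>' mult_pos_neg)
  qed
  ultimately have "((\<lambda>X. real (card (D1 X)) / X + real (card (D2 X)) / X) \<longlongrightarrow>
    c * (ln (exp (2 * L)) / 2) / \<bar>1 * - \<alpha>' - - \<alpha> * 1\<bar> + c * (ln (exp (2 * L)) / 2) / \<bar>1 * \<alpha>' - - \<alpha> * - 1\<bar>) at_top"
    by (rule tendsto_add)
  also have "c * (ln (exp (2 * L)) / 2) / \<bar>1 * - \<alpha>' - - \<alpha> * 1\<bar> + c * (ln (exp (2 * L)) / 2) / \<bar>1 * \<alpha>' - - \<alpha> * - 1\<bar> =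
    12 * real width * L / (pi\<^sup>2 * real (card cosets) * \<bar>\<alpha> - \<alpha>'\<bar>)"
    by (simp add: c_def abs_minus_commute add.commute mult_ac)
  also have "(\<lambda>X. real (card (D1 X)) / X + real (card (D2 X)) / X) = (\<lambda>X. real (card (domain_vectors X)) / X)"
  proof
    fix X
    have br: "base_ratio v = (if 0 < \<zeta> v then 1 else \<rho>)" for v by (simp add: base_ratio_def \<rho>_def \<zeta>')
    have D_iff: "v \<in> domain_vectors X \<longleftrightarrow> v \<in> D1 X \<union> D2 X" if v: "v \<in> orbit_vectors" for v
    proof -
      have "v \<in> primitive_vectors" using v orbit_vectors_primitive by blast
      then have "\<zeta> v \<noteq> 0" by (intro forms_nonzero primitive_nonzero)
      then consider "0 < \<zeta> v" | "0 < \<zeta>' v" "\<not> 0 < \<zeta> v" by (auto simp: \<zeta>')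
      then show ?thesis
      proof cases
        case 1
        then show ?thesis using v by (auto simp: domain_vectors_def in_domain_def D1_def D2_def br \<zeta>' abs_mult)
      next
        case 2
        then have "\<bar>\<zeta> v\<bar> = \<zeta>' v" by (simp add: \<zeta>')
        moreover have "1 \<le> x / \<rho> \<longleftrightarrow> \<rho> \<le> x" "x / \<rho> < exp (2 * L) \<longleftrightarrow> x < exp (2 * L) * \<rho>" for x
          using \<rho> by (simp_all add: pos_le_divide_eq pos_divide_less_eq)
        ultimately show ?thesis using v 2 by (auto simp: domain_vectors_def in_domain_def D1_def D2_def br abs_mult simp del: divide_divide_eq_left)
      qed
    qed
    have D: "domain_vectors X = D1 X \<union> D2 X"
    proof (rule Set.set_eqI)
      fix v show "v \<in> domain_vectors X \<longleftrightarrow> v \<in> D1 X \<union> D2 X"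
        using D_iff[of v] by (cases "v \<in> orbit_vectors") (auto simp: domain_vectors_def D1_def D2_def)
    qed
    moreover have "D1 X \<inter> D2 X = {}" by (auto simp: D1_def D2_def \<zeta>')
    moreover have "finite (D1 X)" "finite (D2 X)" using finite_domain_vectors[of X] by (auto simp: D)
    ultimately show "real (card (D1 X)) / X + real (card (D2 X)) / X = real (card (domain_vectors X)) / X"
      by (simp add: card_Un_disjoint add_divide_distrib)
  qed
  finally show ?thesis .
qed

end

section \<open>Orbits of pairs of conjugate quadratic irrationals\<close>

lemma card_eq_via_relation:
  assumes "\<And>c. c \<in> C \<Longrightarrow> \<exists>!x. x \<in> F \<and> R c x" "\<And>x. x \<in> F \<Longrightarrow> \<exists>!c. c \<in> C \<and> R c x"
  shows "card C = card F"
proof -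
  have "bij_betw (\<lambda>c. THE x. x \<in> F \<and> R c x) C F"
  proof (rule bij_betwI[where g = "\<lambda>x. THE c. c \<in> C \<and> R c x"])
    show "(\<lambda>c. THE x. x \<in> F \<and> R c x) \<in> C \<rightarrow> F" using theI'[OF assms(1)] by blast
    show "(\<lambda>x. THE c. c \<in> C \<and> R c x) \<in> F \<rightarrow> C" using theI'[OF assms(2)] by blast
    show "(THE c. c \<in> C \<and> R c (THE x. x \<in> F \<and> R c0 x)) = c0" if "c0 \<in> C" for c0
      by (rule the1_equality[OF assms(2)]) (use theI'[OF assms(1)[OF that]] that in auto)
    show "(THE x. x \<in> F \<and> R (THE c. c \<in> C \<and> R c x0) x) = x0" if "x0 \<in> F" for x0
      by (rule the1_equality[OF assms(1)]) (use theI'[OF assms(2)[OF that]] that in auto)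
  qed
  then show ?thesis by (rule bij_betw_same_card)
qed

lemma translation_rel_Image_eq_iff:
  "translation_rel q `` {x} = translation_rel q `` {y} \<longleftrightarrow> (\<exists>k::int. y = x + of_int k * of_nat q)"
proof
  assume h: "translation_rel q `` {x} = translation_rel q `` {y}"
  have "y \<in> translation_rel q `` {y}" by (auto simp: translation_rel_def intro: exI[of _ 0])
  then show "\<exists>k::int. y = x + of_int k * of_nat q" unfolding h[symmetric] by (auto simp: translation_rel_def)
next
  assume "\<exists>k::int. y = x + of_int k * of_nat q"
  then obtain k :: int where k: "y = x + of_int k * of_nat q" by blast
  show "translation_rel q `` {x} = translation_rel q `` {y}"
  proof (intro equalityI subsetI)
    fix z assume "z \<in> translation_rel q `` {x}"
    then obtain j :: int where "z = x + of_int j * of_nat q" by (auto simp: translation_rel_def)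
    then have "z = y + of_int (j - k) * of_nat q" by (simp add: k algebra_simps)
    then show "z \<in> translation_rel q `` {y}" unfolding translation_rel_def by blast
  next
    fix z assume "z \<in> translation_rel q `` {y}"
    then obtain j :: int where "z = y + of_int j * of_nat q" by (auto simp: translation_rel_def)
    then have "z = x + of_int (j + k) * of_nat q" by (simp add: k algebra_simps)
    then show "z \<in> translation_rel q `` {x}" unfolding translation_rel_def by blast
  qed
qed

section \<open>Orbit points as classes of pairs of a vector and a root\<close>

context hyperbolic_pair
begin

definition orbit_points :: "real \<Rightarrow> real set" where
  "orbit_points s = {\<beta>. (\<exists>A\<in>H. \<exists>\<omega>\<in>{\<alpha>, \<alpha>'}. \<beta> = mobius A \<omega>) \<and> height \<beta> \<le> s}"

definition stabilizer_matrices :: "mat2 set" where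
  "stabilizer_matrices = {A \<in> H. mobius A ` {\<alpha>, \<alpha>'} = {\<alpha>, \<alpha>'}}"

abbreviation point_class :: "real \<Rightarrow> real set" where
  "point_class \<beta> \<equiv> translation_rel width `` {\<beta>}"

text \<open>The point obtained from \<omega> by the inverse of a matrix in \<open>H\<close> with
  first column \<open>v\<close>. Such a matrix is unique up to right multiplication by translations
  in \<open>H\<close>, which shift the point by multiples of the width.\<close>

definition vector_class :: "int \<times> int \<Rightarrow> real \<Rightarrow> real set" where
  "vector_class v \<omega> = point_class (mobius (adj2 (SOME A. A \<in> H \<and> act2 A (1, 0) = v)) \<omega>)"

lemma pair_irrational: "\<omega> \<in> {\<alpha>, \<alpha>'} \<Longrightarrow> \<omega> \<notin> \<rat>"
  using irrational by blast

lemma same_column_translation: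
  assumes "A \<in> H" "B \<in> H" "act2 A (1, 0) = act2 B (1, 0)"
  shows "\<exists>k. A = B ** translation_mat (int width * k)"
proof -
  have "act2 (adj2 B ** A) (1, 0) = (1, 0)"
    using assms act2_adj2(1)[OF mem_SL2[OF assms(2)]] by (simp add: act2_mult)
  moreover have BA: "adj2 B ** A \<in> H" using assms adj_mem mult_mem by blast
  ultimately obtain k where k: "adj2 B ** A = translation_mat k" using fix_e1_translation mem_SL2 by blast
  then have "int width dvd k" using BA translation_mat_mem_iff by simp
  moreover have "A = B ** translation_mat k" using adj2_cancel(2)[OF mem_SL2[OF assms(2)], of A] k by simp
  ultimately show ?thesis by (auto elim: dvdE)
qed

lemma mobius_adj2_translation:
  assumes "A \<in> SL2" "\<omega> \<notin> \<rat>"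
  shows "mobius (adj2 (A ** translation_mat k)) \<omega> = mobius (adj2 A) \<omega> - of_int k"
  using assms by (simp add: adj2_mult mobius_mult)

lemma vector_class_eq:
  assumes A: "A \<in> H" and \<omega>: "\<omega> \<notin> \<rat>"
  shows "vector_class (act2 A (1, 0)) \<omega> = point_class (mobius (adj2 A) \<omega>)"
proof -
  define B where "B = (SOME B. B \<in> H \<and> act2 B (1, 0) = act2 A (1, 0))"
  have B: "B \<in> H" "act2 B (1, 0) = act2 A (1, 0)"
    unfolding B_def using someI_ex[of "\<lambda>B. B \<in> H \<and> act2 B (1, 0) = act2 A (1, 0)"] A by blast+
  obtain k where k: "B = A ** translation_mat (int width * k)" using same_column_translation[OF B(1) A B(2)] by blast
  have "mobius (adj2 A) \<omega> = mobius (adj2 B) \<omega> + of_int k * of_nat width"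
    unfolding k mobius_adj2_translation[OF mem_SL2[OF A] \<omega>] by (simp add: mult.commute)
  then have "point_class (mobius (adj2 B) \<omega>) = point_class (mobius (adj2 A) \<omega>)"
    unfolding translation_rel_Image_eq_iff by blast
  then show ?thesis by (simp add: vector_class_def B_def)
qed

lemma pair_closed:
  assumes A: "A \<in> SL2" and \<omega>: "\<omega> \<in> {\<alpha>, \<alpha>'}" "mobius A \<omega> \<in> {\<alpha>, \<alpha>'}"
  shows "mobius A ` {\<alpha>, \<alpha>'} = {\<alpha>, \<alpha>'}"
proof -
  have c: "galois_conj \<alpha> = \<alpha>'" "galois_conj \<alpha>' = \<alpha>" using conj[of "mat 1"] by simp_all
  note g = conj[OF A]
  from \<omega> consider "mobius A \<alpha> = \<alpha>" | "mobius A \<alpha> = \<alpha>'" | "mobius A \<alpha>' = \<alpha>" | "mobius A \<alpha>' = \<alpha>'" by auto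
  then show ?thesis using g c by cases auto
qed

text \<open>Two pairs with the same class are related by the quotient of their matrices. It carries
  a root to a root, and since conjugation commutes with homographies it preserves the pair of roots,
  so it is in the stabilizer.\<close>

lemma vector_class_eq_iff:
  assumes A: "A \<in> H" "A' \<in> H" and \<omega>: "\<omega> \<in> {\<alpha>, \<alpha>'}" "\<omega>' \<in> {\<alpha>, \<alpha>'}"
  shows "vector_class (act2 A' (1, 0)) \<omega>' = vector_class (act2 A (1, 0)) \<omega> \<longleftrightarrow>
    (\<exists>B\<in>stabilizer_matrices. act2 B (act2 A (1, 0)) = act2 A' (1, 0) \<and> mobius B \<omega> = \<omega>')"
proof
  note irr = pair_irrational[OF \<omega>(1)] pair_irrational[OF \<omega>(2)]
  note SL = mem_SL2[OF A(1)] mem_SL2[OF A(2)]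
  assume "vector_class (act2 A' (1, 0)) \<omega>' = vector_class (act2 A (1, 0)) \<omega>"
  then have "point_class (mobius (adj2 A) \<omega>) = point_class (mobius (adj2 A') \<omega>')"
    using A irr by (simp add: vector_class_eq)
  then obtain k :: int where k: "mobius (adj2 A') \<omega>' = mobius (adj2 A) \<omega> + of_int k * of_nat width"
    unfolding translation_rel_Image_eq_iff by blast
  \<comment> \<open>Right multiplication by a translation in \<open>H\<close> keeps the first column
    and turns equality modulo the width into equality.\<close>
  define C where "C = A ** translation_mat (int width * (- k))"
  have CH: "C \<in> H" using A mult_mem translation_mat_mem_iff by (simp add: C_def)
  have Ce: "act2 C (1, 0) = act2 A (1, 0)" unfolding C_def act2_mult by (simp add: act2_def translation_mat_def)
  have eq: "mobius (adj2 A') \<omega>' = mobius (adj2 C) \<omega>"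
    unfolding C_def mobius_adj2_translation[OF SL(1) irr(1)] k by (simp add: mult.commute)
  define B where "B = A' ** adj2 C"
  have BH: "B \<in> H" using A CH by (simp add: B_def mult_mem adj_mem)
  have "mobius B \<omega> = \<omega>'"
    unfolding B_def using mobius_adj2(2)[OF SL(2) irr(2)] eq SL mem_SL2[OF CH] irr by (simp add: mobius_mult)
  moreover have "act2 B (act2 A (1, 0)) = act2 A' (1, 0)"
    unfolding Ce[symmetric] B_def act2_mult using act2_adj2(1)[OF mem_SL2[OF CH]] by simp
  moreover have "B \<in> stabilizer_matrices"
    using BH pair_closed[OF mem_SL2[OF BH] \<omega>(1)] \<omega> \<open>mobius B \<omega> = \<omega>'\<close> by (simp add: stabilizer_matrices_def)
  ultimately show "\<exists>B\<in>stabilizer_matrices. act2 B (act2 A (1, 0)) = act2 A' (1, 0) \<and> mobius B \<omega> = \<omega>'" by blast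
next
  note irr = pair_irrational[OF \<omega>(1)] pair_irrational[OF \<omega>(2)]
  assume "\<exists>B\<in>stabilizer_matrices. act2 B (act2 A (1, 0)) = act2 A' (1, 0) \<and> mobius B \<omega> = \<omega>'"
  then obtain B where B: "B \<in> H" "act2 (B ** A) (1, 0) = act2 A' (1, 0)" "mobius B \<omega> = \<omega>'"
    by (auto simp: stabilizer_matrices_def act2_mult)
  have "mobius (adj2 (B ** A)) \<omega>' = mobius (adj2 A) \<omega>"
    unfolding B(3)[symmetric] adj2_mult using mem_SL2[OF B(1)] mem_SL2[OF A(1)] irr(1)
    by (simp add: mobius_mult mobius_irrational mobius_adj2)
  then show "vector_class (act2 A' (1, 0)) \<omega>' = vector_class (act2 A (1, 0)) \<omega>"
    using vector_class_eq[OF mult_mem[OF B(1) A(1)] irr(2)] vector_class_eq[OF A(1) irr(1)] by (simp add: B(2))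
qed

text \<open>The conjugate of the point is the image of the other root, and the difference of the
  images is the difference of the roots divided by the two denominators. These denominators are
  \<xi> and \<zeta> at the first column of the inverse matrix.\<close>

lemma height_mobius:
  assumes A: "A \<in> H" and \<omega>: "\<omega> \<in> {\<alpha>, \<alpha>'}"
  defines "v \<equiv> act2 (adj2 A) (1, 0)"
  shows "height (mobius A \<omega>) \<le> s \<longleftrightarrow> \<bar>\<xi> v * \<zeta> v\<bar> \<le> s * \<bar>\<alpha> - \<alpha>'\<bar> / 2"
proof -
  have SL: "A \<in> SL2" using A mem_SL2 by blast
  have v: "\<xi> v = of_int (A$2$1) * \<alpha> + of_int (A$2$2)" "\<zeta> v = of_int (A$2$1) * \<alpha>' + of_int (A$2$2)"
    by (simp_all add: v_def act2_e1 adj2_def linear_form_def)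
  have "\<bar>mobius A \<omega> - galois_conj (mobius A \<omega>)\<bar> = \<bar>mobius A \<alpha> - mobius A \<alpha>'\<bar>"
    using \<omega> conj[OF SL] by (auto simp: abs_minus_commute)
  also have "\<dots> = \<bar>\<alpha> - \<alpha>'\<bar> / \<bar>\<xi> v * \<zeta> v\<bar>"
    unfolding mobius_diff[OF SL irrational] v by simp
  finally have "height (mobius A \<omega>) = 2 * \<bar>\<xi> v * \<zeta> v\<bar> / \<bar>\<alpha> - \<alpha>'\<bar>" by (simp add: height_def)
  moreover have "0 < \<bar>\<alpha> - \<alpha>'\<bar>" using distinct by simp
  ultimately show ?thesis by (simp add: pos_divide_le_eq mult.commute)
qed

lemma orbit_vectors_eq_act2: "v \<in> orbit_vectors \<longleftrightarrow> (\<exists>A\<in>H. act2 A (1, 0) = v)"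
  by (auto simp: orbit_vectors_def)

lemma domain_vectors_act2:
  assumes "v \<in> orbit_vectors" "\<bar>\<xi> v * \<zeta> v\<bar> \<le> X"
  shows "\<exists>A\<in>Z. act2 A v \<in> domain_vectors X"
proof -
  have "v \<noteq> (0, 0)" using assms orbit_vectors_primitive primitive_nonzero by blast
  then obtain A where A: "A \<in> Z" "in_domain (act2 A v)" using domain_exists by blast
  then have "act2 A v \<in> domain_vectors X"
    using assms Z_sub norm_form_invariant by (auto simp: domain_vectors_def orbit_vectors_act)
  then show ?thesis using A by blast
qed

lemma orbit_points_classes:
  defines "X s \<equiv> s * \<bar>\<alpha> - \<alpha>'\<bar> / 2"
  shows "orbit_points s // translation_rel width =
    (\<lambda>(v, \<omega>). vector_class v \<omega>) ` (domain_vectors (X s) \<times> {\<alpha>, \<alpha>'})"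
proof (intro equalityI subsetI)
  fix c assume "c \<in> orbit_points s // translation_rel width"
  then obtain B \<omega> where B: "B \<in> H" "\<omega> \<in> {\<alpha>, \<alpha>'}" "c = point_class (mobius B \<omega>)" "height (mobius B \<omega>) \<le> s"
    by (auto simp: quotient_def orbit_points_def)
  define v where "v = act2 (adj2 B) (1, 0)"
  have "v \<in> orbit_vectors" using B adj_mem by (auto simp: v_def orbit_vectors_def)
  moreover have "\<bar>\<xi> v * \<zeta> v\<bar> \<le> X s" using B height_mobius[OF B(1,2)] by (simp add: v_def X_def)
  ultimately obtain A where A: "A \<in> Z" "act2 A v \<in> domain_vectors (X s)" using domain_vectors_act2 by blast
  have AH: "A \<in> H" using A Z_sub by blast
  note SL = mem_SL2[OF AH] mem_SL2[OF B(1)]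
  have \<omega>: "\<omega> \<notin> \<rat>" by (rule pair_irrational[OF B(2)])
  have fix\<omega>: "mobius A \<omega> = \<omega>" using Z_fixes[OF A(1)] B(2) by auto
  have "vector_class (act2 A v) \<omega> = point_class (mobius (adj2 (A ** adj2 B)) \<omega>)"
    using vector_class_eq[of "A ** adj2 B" \<omega>] AH B \<omega> by (simp add: v_def act2_mult mult_mem adj_mem)
  also have "mobius (adj2 (A ** adj2 B)) \<omega> = mobius B (mobius (adj2 A) (mobius A \<omega>))"
    unfolding fix\<omega> using SL \<omega> by (simp add: adj2_mult mobius_mult)
  also have "\<dots> = mobius B \<omega>" using mobius_adj2(1)[OF SL(1) \<omega>] by simp
  finally have "c = vector_class (act2 A v) \<omega>" using B by simp
  then show "c \<in> (\<lambda>(v, \<omega>). vector_class v \<omega>) ` (domain_vectors (X s) \<times> {\<alpha>, \<alpha>'})"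
    using A B by (intro image_eqI[of _ _ "(act2 A v, \<omega>)"]) auto
next
  fix c assume "c \<in> (\<lambda>(v, \<omega>). vector_class v \<omega>) ` (domain_vectors (X s) \<times> {\<alpha>, \<alpha>'})"
  then obtain v \<omega> where c: "v \<in> domain_vectors (X s)" "\<omega> \<in> {\<alpha>, \<alpha>'}" "c = vector_class v \<omega>" by auto
  then obtain A where A: "A \<in> H" "act2 A (1, 0) = v" by (auto simp: domain_vectors_def orbit_vectors_eq_act2)
  have "c = point_class (mobius (adj2 A) \<omega>)"
    using vector_class_eq[OF A(1) pair_irrational[OF c(2)]] c A by simp
  moreover have "height (mobius (adj2 A) \<omega>) \<le> s"
    using height_mobius[OF adj_mem[OF A(1)] c(2)] c(1) A by (simp add: domain_vectors_def X_def)
  ultimately show "c \<in> orbit_points s // translation_rel width"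
    using A c adj_mem by (auto simp: quotient_def orbit_points_def)
qed

text \<open>Conjugation that takes \<open>v\<close> to the first basis vector turns \<open>B\<close>
  into a translation, and a translation with a finite fixed point is trivial.\<close>

lemma stabilizer_action_free:
  assumes B: "B \<in> SL2" and v: "v \<in> primitive_vectors" "act2 B v = v" and \<omega>: "\<omega> \<notin> \<rat>" "mobius B \<omega> = \<omega>"
  shows "B = mat 1"
proof -
  obtain A where A: "A \<in> SL2" "act2 A (1, 0) = v" using primitive_eq_act2_e1[OF v(1)] by blast
  have "act2 (adj2 A ** (B ** A)) (1, 0) = (1, 0)" using A v act2_adj2(1)[OF A(1), of "(1, 0)"] by (simp add: act2_mult)
  then obtain k where k: "adj2 A ** (B ** A) = translation_mat k" using fix_e1_translation A B by (metis SL2_closed(2,3))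
  define x where "x = mobius (adj2 A) \<omega>"
  have x: "x \<notin> \<rat>" "mobius A x = \<omega>" using A \<omega> by (auto simp: x_def mobius_irrational mobius_adj2)
  have "mobius (adj2 A ** (B ** A)) x = x" using A B x \<omega> mobius_irrational by (simp add: mobius_mult x_def[symmetric])
  then have "k = 0" by (simp add: k)
  then have "adj2 A ** (B ** A) = mat 1" unfolding k by (auto simp: mat2_eq_iff translation_mat_def)
  then have "B ** A = A" using adj2_cancel(2)[OF A(1), of "B ** A"] by simp
  then show ?thesis using adj2_cancel(3)[OF A(1), of B] adj2_inverse(2)[OF A(1)] by simp
qed

text \<open>The stabilizer acts freely on pairs of a primitive vector and a root, and a fibre is the
  part of one of its orbits whose vectors lie in the domain. Each coset of \<open>Z\<close> in the
  stabilizer contains exactly one element that moves \<open>v\<close> into the domain, so the size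
  is the same for all fibres.\<close>

lemma card_fiber:
  assumes v: "v \<in> domain_vectors X" and \<omega>: "\<omega> \<in> {\<alpha>, \<alpha>'}"
  shows "card {x \<in> domain_vectors X \<times> {\<alpha>, \<alpha>'}. (case x of (v', \<omega>') \<Rightarrow> vector_class v' \<omega>') = vector_class v \<omega>} =
    card (matrix_group.coset Z ` stabilizer_matrices)"
proof -
  interpret Z: matrix_group Z by (rule Z_group)
  let ?F = "{x \<in> domain_vectors X \<times> {\<alpha>, \<alpha>'}. (case x of (v', \<omega>') \<Rightarrow> vector_class v' \<omega>') = vector_class v \<omega>}"
  obtain A where A: "A \<in> H" "act2 A (1, 0) = v" using v by (auto simp: domain_vectors_def orbit_vectors_eq_act2)
  have irr: "\<omega> \<notin> \<rat>" by (rule pair_irrational[OF \<omega>])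
  have prim: "v \<in> primitive_vectors" using v orbit_vectors_primitive by (auto simp: domain_vectors_def)
  have ZS: "A ** B \<in> stabilizer_matrices \<and> mobius (A ** B) \<omega> = mobius B \<omega>" if "A \<in> Z" "B \<in> stabilizer_matrices" for A B
  proof -
    have AH: "A \<in> H" "B \<in> H" using that Z_sub by (auto simp: stabilizer_matrices_def)
    have B\<omega>: "mobius B \<omega> \<in> {\<alpha>, \<alpha>'}" using that(2) \<omega> by (auto simp: stabilizer_matrices_def)
    have "mobius (A ** B) \<omega> = mobius A (mobius B \<omega>)" by (rule mobius_mult[OF mem_SL2[OF AH(1)] mem_SL2[OF AH(2)] irr])
    also have "\<dots> = mobius B \<omega>" using Z_fixes[OF that(1)] B\<omega> by auto
    finally have eq: "mobius (A ** B) \<omega> = mobius B \<omega>" .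
    have "A ** B \<in> H" using AH by (rule mult_mem)
    then show ?thesis using eq B\<omega> pair_closed[OF mem_SL2[OF \<open>A ** B \<in> H\<close>] \<omega>] by (simp add: stabilizer_matrices_def)
  qed
  have F_iff: "x \<in> ?F \<longleftrightarrow> fst x \<in> domain_vectors X \<and> (\<exists>B\<in>stabilizer_matrices. x = (act2 B v, mobius B \<omega>))" for x
  proof -
    obtain v' \<omega>' where x: "x = (v', \<omega>')" by fastforce
    show ?thesis
    proof
      assume h: "x \<in> ?F"
      then obtain A' where A': "A' \<in> H" "act2 A' (1, 0) = v'" by (auto simp: x domain_vectors_def orbit_vectors_eq_act2)
      have "\<omega>' \<in> {\<alpha>, \<alpha>'}" using h by (auto simp: x)
      moreover have "vector_class (act2 A' (1, 0)) \<omega>' = vector_class (act2 A (1, 0)) \<omega>" using h A A' by (simp add: x)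
      ultimately obtain B where "B \<in> stabilizer_matrices" "act2 B v = v'" "mobius B \<omega> = \<omega>'"
        using vector_class_eq_iff[OF A(1) A'(1) \<omega>, of \<omega>'] A A' by blast
      then show "fst x \<in> domain_vectors X \<and> (\<exists>B\<in>stabilizer_matrices. x = (act2 B v, mobius B \<omega>))"
        using h unfolding x by auto
    next
      assume h: "fst x \<in> domain_vectors X \<and> (\<exists>B\<in>stabilizer_matrices. x = (act2 B v, mobius B \<omega>))"
      then obtain B where B: "B \<in> stabilizer_matrices" "v' = act2 B v" "\<omega>' = mobius B \<omega>" by (auto simp: x)
      have BA: "B ** A \<in> H" using B A mult_mem by (auto simp: stabilizer_matrices_def)
      have \<omega>': "\<omega>' \<in> {\<alpha>, \<alpha>'}" using B \<omega> by (auto simp: stabilizer_matrices_def)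
      have "act2 (B ** A) (1, 0) = v'" using A B by (simp add: act2_mult)
      then have "vector_class v' \<omega>' = vector_class v \<omega>"
        using vector_class_eq_iff[OF A(1) BA \<omega> \<omega>'] A B by auto
      then show "x \<in> ?F" using h \<omega>' by (simp add: x)
    qed
  qed
  show ?thesis
  proof (rule sym, rule card_eq_via_relation[where R = "\<lambda>c x. \<exists>B\<in>c. x = (act2 B v, mobius B \<omega>)"])
    fix c assume "c \<in> Z.coset ` stabilizer_matrices"
    then obtain B where B: "B \<in> stabilizer_matrices" "c = Z.coset B" by blast
    have c_iff: "C \<in> c \<longleftrightarrow> (\<exists>A\<in>Z. C = A ** B)" for C by (auto simp: B Z.coset_def)
    have BH: "B \<in> H" using B by (simp add: stabilizer_matrices_def)
    have "act2 B v \<in> orbit_vectors" using v orbit_vectors_act[OF BH] by (simp add: domain_vectors_def)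
    \<comment> \<open>Elements that exchange the roots also exchange \<xi> and \<zeta> up to
      factors. The invariance of the norm is therefore read off from the height, because both pairs
      represent the same point.\<close>
    moreover have "\<bar>\<xi> (act2 B v) * \<zeta> (act2 B v)\<bar> \<le> X"
    proof -
      have "height (mobius (adj2 (B ** A)) (mobius B \<omega>)) = height (mobius (adj2 A) \<omega>)"
        using mem_SL2[OF A(1)] mem_SL2[OF BH] irr
        by (simp add: adj2_mult mobius_mult mobius_irrational mobius_adj2)
      moreover have "mobius B \<omega> \<in> {\<alpha>, \<alpha>'}" using B \<omega> by (auto simp: stabilizer_matrices_def)
      moreover have "act2 (adj2 (adj2 (B ** A))) (1, 0) = act2 B v" "act2 (adj2 (adj2 A)) (1, 0) = v"
        using A by (simp_all add: act2_mult)
      moreover have "\<bar>\<xi> v * \<zeta> v\<bar> \<le> (2 * X / \<bar>\<alpha> - \<alpha>'\<bar>) * \<bar>\<alpha> - \<alpha>'\<bar> / 2" using v distinct by (simp add: domain_vectors_def)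
      ultimately have "\<bar>\<xi> (act2 B v) * \<zeta> (act2 B v)\<bar> \<le> (2 * X / \<bar>\<alpha> - \<alpha>'\<bar>) * \<bar>\<alpha> - \<alpha>'\<bar> / 2"
        using height_mobius[OF adj_mem[OF mult_mem[OF BH A(1)]], of "mobius B \<omega>"] height_mobius[OF adj_mem[OF A(1)] \<omega>] by metis
      then show ?thesis using distinct by simp
    qed
    ultimately obtain z where z: "z \<in> Z" "act2 z (act2 B v) \<in> domain_vectors X" using domain_vectors_act2 by blast
    show "\<exists>!x. x \<in> ?F \<and> (\<exists>B\<in>c. x = (act2 B v, mobius B \<omega>))"
    proof (rule ex1I[of _ "(act2 (z ** B) v, mobius (z ** B) \<omega>)"])
      have "z ** B \<in> stabilizer_matrices" using ZS z B by blast
      then show "(act2 (z ** B) v, mobius (z ** B) \<omega>) \<in> ?F \<and> (\<exists>Ba\<in>c. (act2 (z ** B) v, mobius (z ** B) \<omega>) = (act2 Ba v, mobius Ba \<omega>))"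
        unfolding F_iff fst_conv using z(2)[folded act2_mult] c_iff z(1) by blast
      fix x assume x: "x \<in> ?F \<and> (\<exists>B\<in>c. x = (act2 B v, mobius B \<omega>))"
      then have "fst x \<in> domain_vectors X" unfolding F_iff by blast
      moreover obtain C where C: "C \<in> c" "x = (act2 C v, mobius C \<omega>)" using x by blast
      moreover from C(1) obtain z' where "z' \<in> Z" "C = z' ** B" unfolding c_iff by blast
      ultimately have z': "z' \<in> Z" "x = (act2 (z' ** B) v, mobius (z' ** B) \<omega>)" "act2 (z' ** B) v \<in> domain_vectors X"
        by simp_all
      define y where "y = act2 (z ** B) v"
      have zSL: "z \<in> SL2" using z Z_sub mem_SL2 by blast
      have "act2 (z' ** adj2 z) y = act2 (z' ** B) v"
        using act2_adj2(1)[OF zSL] by (simp add: y_def act2_mult)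
      moreover have "in_domain y" "in_domain (act2 (z' ** B) v)" using z z' by (auto simp: y_def act2_mult domain_vectors_def)
      moreover have "z' ** adj2 z \<in> Z" using z z' by (simp add: Z.mult_mem Z.adj_mem)
      ultimately have "z' ** adj2 z = mat 1" using domain_unique by simp
      then have "z' = z" using adj2_cancel(4)[OF zSL, of z'] by simp
      then show "x = (act2 (z ** B) v, mobius (z ** B) \<omega>)" using z' by simp
    qed
  next
    fix x assume "x \<in> ?F"
    then obtain B where B: "B \<in> stabilizer_matrices" "x = (act2 B v, mobius B \<omega>)" unfolding F_iff by blast
    show "\<exists>!c. c \<in> Z.coset ` stabilizer_matrices \<and> (\<exists>B\<in>c. x = (act2 B v, mobius B \<omega>))"
    proof (rule ex1I[of _ "Z.coset B"])
      have "mat 1 ** B \<in> Z.coset B" unfolding Z.coset_def using Z.one_mem by blast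
      then show "Z.coset B \<in> Z.coset ` stabilizer_matrices \<and> (\<exists>Ba\<in>Z.coset B. x = (act2 Ba v, mobius Ba \<omega>))"
        using B by auto
      fix c assume "c \<in> Z.coset ` stabilizer_matrices \<and> (\<exists>B\<in>c. x = (act2 B v, mobius B \<omega>))"
      then obtain D z where D: "D \<in> stabilizer_matrices" "c = Z.coset D" "z \<in> Z" "x = (act2 (z ** D) v, mobius (z ** D) \<omega>)"
        by (auto simp: Z.coset_def)
      have SL: "B \<in> SL2" "D \<in> SL2" "z \<in> SL2" using B D Z_sub mem_SL2 by (auto simp: stabilizer_matrices_def)
      have "adj2 B ** (z ** D) = mat 1"
      proof (rule stabilizer_action_free[OF _ prim _ irr])
        show "adj2 B ** (z ** D) \<in> SL2" using SL by auto
        show "act2 (adj2 B ** (z ** D)) v = v"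
          using B D act2_adj2(1)[OF SL(1), of v] by (simp add: act2_mult)
        have "mobius (z ** D) \<omega> = mobius B \<omega>" using B D by simp
        then show "mobius (adj2 B ** (z ** D)) \<omega> = \<omega>"
          using SL irr by (simp add: mobius_mult[of "adj2 B" "z ** D"] mobius_adj2)
      qed
      then have "z ** D = B" using adj2_cancel(2)[OF SL(1), of "z ** D"] by simp
      then have "B ** adj2 D = z" using adj2_cancel(3)[OF SL(2), of z] by simp
      then have "Z.coset B = Z.coset D" using D SL Z.coset_eq_iff by simp
      then show "c = Z.coset B" using D by simp
    qed
  qed
qed

text \<open>Counting the pairs in two ways: the factor 2 stands for the two roots, and every class
  has the same number of pairs over it.\<close>

theorem orbit_points_count:
  "card (orbit_points s // translation_rel width) * card (matrix_group.coset Z ` stabilizer_matrices) =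
    2 * card (domain_vectors (s * \<bar>\<alpha> - \<alpha>'\<bar> / 2))"
proof -
  let ?R = "domain_vectors (s * \<bar>\<alpha> - \<alpha>'\<bar> / 2) \<times> {\<alpha>, \<alpha>'}" and ?f = "\<lambda>(v, \<omega>). vector_class v \<omega>"
  let ?n = "card (matrix_group.coset Z ` stabilizer_matrices)"
  have fin: "finite ?R" using finite_domain_vectors by auto
  have Q: "orbit_points s // translation_rel width = ?f ` ?R" by (rule orbit_points_classes)
  have "(\<Sum>c\<in>?f ` ?R. card {x \<in> ?R. ?f x = c}) = 1 * card ?R"
  proof (rule sum_multicount)
    show "\<forall>x\<in>?R. card {c \<in> ?f ` ?R. ?f x = c} = 1"
    proof
      fix x assume "x \<in> ?R"
      then have "{c \<in> ?f ` ?R. ?f x = c} = {?f x}" by blast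
      then show "card {c \<in> ?f ` ?R. ?f x = c} = 1" by simp
    qed
  qed (use fin in auto)
  also have "(\<Sum>c\<in>?f ` ?R. card {x \<in> ?R. ?f x = c}) = (\<Sum>c\<in>?f ` ?R. ?n)"
  proof (rule sum.cong)
    fix c assume "c \<in> ?f ` ?R"
    then obtain v \<omega> where "v \<in> domain_vectors (s * \<bar>\<alpha> - \<alpha>'\<bar> / 2)" "\<omega> \<in> {\<alpha>, \<alpha>'}" "c = vector_class v \<omega>" by auto
    then show "card {x \<in> ?R. ?f x = c} = ?n" using card_fiber by simp
  qed simp
  finally have "card (?f ` ?R) * ?n = card ?R" by simp
  then show ?thesis unfolding Q using distinct by (simp add: card_cartesian_product)
qed

theorem orbit_points_asymptotics:
  defines "n \<equiv> card (matrix_group.coset Z ` stabilizer_matrices)"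
  shows "n \<noteq> 0 \<and> ((\<lambda>s. real (card (orbit_points s // translation_rel width)) / s) \<longlongrightarrow>
    12 * real width * L / (pi\<^sup>2 * real (card cosets) * real n)) at_top"
proof -
  define d where "d = \<bar>\<alpha> - \<alpha>'\<bar> / 2"
  have d: "0 < d" using distinct by (simp add: d_def)
  define C where "C = 12 * real width * L / (pi\<^sup>2 * real (card cosets))"
  have "cosets \<noteq> {}" using SL2_closed(1) by (auto simp: cosets_def)
  then have "0 < card cosets" using finite_cosets by (simp add: card_gt_0_iff)
  then have C: "0 < C" using width(1) L_pos by (simp add: C_def)
  have "filterlim (\<lambda>s. s * d) at_top at_top"
    using filterlim_tendsto_pos_mult_at_top[OF tendsto_const d filterlim_ident] by (simp only: mult.commute)
  from filterlim_compose[OF domain_vectors_asymptotics this]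
  have "((\<lambda>s. real (card (domain_vectors (s * d))) / (s * d)) \<longlongrightarrow> C / \<bar>\<alpha> - \<alpha>'\<bar>) at_top"
    by (simp add: C_def)
  then have "((\<lambda>s. 2 * d * (real (card (domain_vectors (s * d))) / (s * d))) \<longlongrightarrow> 2 * d * (C / \<bar>\<alpha> - \<alpha>'\<bar>)) at_top"
    by (intro tendsto_mult tendsto_const)
  moreover have "2 * d * (C / \<bar>\<alpha> - \<alpha>'\<bar>) = C" using distinct by (simp add: d_def)
  moreover have "2 * d * (real (card (domain_vectors (s * d))) / (s * d)) =
      real (card (orbit_points s // translation_rel width)) / s * real n" for s
  proof -
    have "real (card (orbit_points s // translation_rel width)) * real n = 2 * real (card (domain_vectors (s * d)))"
      using orbit_points_count[of s] unfolding n_def d_def by (simp flip: of_nat_mult)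
    then show ?thesis using d by simp
  qed
  ultimately have lim: "((\<lambda>s. real (card (orbit_points s // translation_rel width)) / s * real n) \<longlongrightarrow> C) at_top" by simp
  \<comment> \<open>The finiteness of the index is a consequence of the count: an infinite set of
    cosets would have \<open>card\<close> zero, and then the limit \<open>C\<close> would be zero
    too.\<close>
  have n: "n \<noteq> 0"
  proof
    assume "n = 0"
    then have "((\<lambda>s::real. 0::real) \<longlongrightarrow> C) at_top" using lim by simp
    then show False using C tendsto_unique[OF trivial_limit_at_top_linorder _ tendsto_const] by force
  qed
  have "((\<lambda>s. real (card (orbit_points s // translation_rel width)) / s * real n / real n) \<longlongrightarrow> C / real n) at_top"
    using n by (intro tendsto_divide lim tendsto_const) auto
  then show ?thesis using n by (simp add: C_def)
qed

end

section \<open>Translation to the modular group\<close>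

definition psl_class :: "mat2 \<Rightarrow> mat2 set" where "psl_class A = {A, - A}"

lemma carrier_PSL2Z_eq: "carrier PSL2Z = psl_class ` SL2"
  by (simp add: carrier_PSL2Z SL2_def psl_class_def)

lemma psl_class_mult:
  shows "psl_class A \<otimes>\<^bsub>PSL2Z\<^esub> psl_class B = psl_class (A ** B)"
  by (auto simp: PSL2Z_def FactGroup_def set_mult_def SL2Z_def psl_class_def uminus_mult)

lemma psl_class_one: "\<one>\<^bsub>PSL2Z\<^esub> = psl_class (mat 1)"
  by (simp add: PSL2Z_def FactGroup_def psl_class_def)

lemma psl_class_inv:
  assumes "A \<in> SL2" shows "inv\<^bsub>PSL2Z\<^esub> (psl_class A) = psl_class (adj2 A)"
proof -
  interpret group PSL2Z by (rule group_PSL2Z)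
  show ?thesis
    by (rule inv_equality) (use assms in \<open>auto simp: psl_class_mult psl_class_one adj2_inverse carrier_PSL2Z_eq\<close>)
qed

lemma psl_class_eq: "B \<in> psl_class A \<Longrightarrow> psl_class B = psl_class A"
  by (auto simp: psl_class_def)

lemma psl_class_self [simp]: "A \<in> psl_class A"
  by (simp add: psl_class_def)

lemma psl_class_translation: "translation k = psl_class (translation_mat k)"
  by (simp add: translation_eq psl_class_def translation_mat_def mat2_of_def Let_def)

lemma Union_psl_iff:
  assumes "S \<subseteq> carrier PSL2Z" shows "A \<in> \<Union>S \<longleftrightarrow> A \<in> SL2 \<and> psl_class A \<in> S"
proof
  assume "A \<in> \<Union>S"
  then obtain g where g: "g \<in> S" "A \<in> g" by blast
  then obtain B where "B \<in> SL2" "g = psl_class B" using assms by (auto simp: carrier_PSL2Z_eq)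
  then show "A \<in> SL2 \<and> psl_class A \<in> S" using g psl_class_eq[of A B] by (auto simp: psl_class_def)
qed (use psl_class_self in blast)

lemma Union_psl_inject:
  assumes "S \<subseteq> carrier PSL2Z" "T \<subseteq> carrier PSL2Z" "\<Union>S = \<Union>T" shows "S = T"
proof -
  have sub: "S \<subseteq> T" if h: "S \<subseteq> carrier PSL2Z" "T \<subseteq> carrier PSL2Z" "\<Union>S = \<Union>T" for S T
  proof
    fix g assume g: "g \<in> S"
    then obtain A where A: "A \<in> SL2" "g = psl_class A" using h(1) by (auto simp: carrier_PSL2Z_eq)
    then have "A \<in> \<Union>T" using g h(3) psl_class_self by blast
    then show "g \<in> T" using A Union_psl_iff[OF h(2)] by blast
  qed
  show ?thesis using sub[OF assms] sub[OF assms(2,1) assms(3)[symmetric]] by blast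
qed

text \<open>The union of the classes in \<open>S\<close> is its full preimage in \<open>SL2\<close>,
  which is why it is closed under negation.\<close>

lemma matrix_group_Union:
  assumes "subgroup S PSL2Z" shows "matrix_group (\<Union>S)"
proof -
  interpret group PSL2Z by (rule group_PSL2Z)
  have sub: "S \<subseteq> carrier PSL2Z" by (rule subgroup.subset[OF assms])
  note iff = Union_psl_iff[OF sub]
  show ?thesis
  proof
    show "\<Union>S \<subseteq> SL2" using iff by blast
    show "mat 1 \<in> \<Union>S" unfolding iff using subgroup.one_closed[OF assms] by (simp add: psl_class_one)
    fix A assume A: "A \<in> \<Union>S"
    show "adj2 A \<in> \<Union>S" using A subgroup.m_inv_closed[OF assms, of "psl_class A"] unfolding iff by (simp add: psl_class_inv)
    show "- A \<in> \<Union>S" using A unfolding iff by (simp add: psl_class_def insert_commute)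
    fix B assume "B \<in> \<Union>S"
    then show "A ** B \<in> \<Union>S"
      using A subgroup.m_closed[OF assms, of "psl_class A" "psl_class B"] unfolding iff by (simp add: psl_class_mult)
  qed
qed

lemma Union_r_coset:
  assumes S: "subgroup S PSL2Z"
  shows "\<Union>(S #>\<^bsub>PSL2Z\<^esub> psl_class A) = matrix_group.coset (\<Union>S) A"
proof -
  interpret S: matrix_group "\<Union>S" by (rule matrix_group_Union[OF S])
  have sub: "S \<subseteq> carrier PSL2Z" by (rule subgroup.subset[OF S])
  show ?thesis
  proof (intro equalityI subsetI)
    fix C assume "C \<in> \<Union>(S #>\<^bsub>PSL2Z\<^esub> psl_class A)"
    then obtain g where g: "g \<in> S" "C \<in> g \<otimes>\<^bsub>PSL2Z\<^esub> psl_class A" by (auto simp: r_coset_def)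
    then obtain B where B: "B \<in> SL2" "g = psl_class B" using sub by (auto simp: carrier_PSL2Z_eq)
    then have "B \<in> \<Union>S" using g psl_class_self by blast
    moreover have "C \<in> psl_class (B ** A)" using g(2) unfolding B(2) psl_class_mult .
    then have "C = B ** A \<or> C = (- B) ** A" by (auto simp: psl_class_def uminus_mult)
    ultimately show "C \<in> S.coset A" using S.uminus_mem by (auto simp: S.coset_def)
  next
    fix C assume "C \<in> S.coset A"
    then obtain B where B: "B \<in> \<Union>S" "C = B ** A" by (auto simp: S.coset_def)
    then have "psl_class B \<in> S" using Union_psl_iff[OF sub] by blast
    moreover have "C \<in> psl_class B \<otimes>\<^bsub>PSL2Z\<^esub> psl_class A" unfolding psl_class_mult using B by simp
    ultimately show "C \<in> \<Union>(S #>\<^bsub>PSL2Z\<^esub> psl_class A)" by (auto simp: r_coset_def)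
  qed
qed

text \<open>Serves for both indices of the result: \<open>T\<close> is the whole modular group for
  the index of \<open>G\<close>, and the pair stabilizer for the index of the cyclic group.\<close>

lemma bij_betw_rcosets_cosets:
  assumes S: "subgroup S PSL2Z" and T: "T \<subseteq> carrier PSL2Z"
  shows "bij_betw Union (rcosets\<^bsub>PSL2Z\<lparr>carrier := T\<rparr>\<^esub> S) (matrix_group.coset (\<Union>S) ` (\<Union>T))"
proof -
  interpret group PSL2Z by (rule group_PSL2Z)
  have sub: "S \<subseteq> carrier PSL2Z" by (rule subgroup.subset[OF S])
  have rc: "rcosets\<^bsub>PSL2Z\<lparr>carrier := T\<rparr>\<^esub> S = (\<lambda>g. S #>\<^bsub>PSL2Z\<^esub> g) ` T"
    by (auto simp: RCOSETS_def r_coset_def)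
  show ?thesis
    unfolding bij_betw_def
  proof
    show "inj_on Union (rcosets\<^bsub>PSL2Z\<lparr>carrier := T\<rparr>\<^esub> S)"
    proof (rule inj_onI)
      fix c d assume "c \<in> rcosets\<^bsub>PSL2Z\<lparr>carrier := T\<rparr>\<^esub> S" "d \<in> rcosets\<^bsub>PSL2Z\<lparr>carrier := T\<rparr>\<^esub> S" "\<Union>c = \<Union>d"
      moreover have "c \<subseteq> carrier PSL2Z" if "c \<in> (\<lambda>g. S #>\<^bsub>PSL2Z\<^esub> g) ` T" for c
        using that r_coset_subset_G[OF sub] T by blast
      ultimately show "c = d" unfolding rc by (intro Union_psl_inject)
    qed
    show "Union ` (rcosets\<^bsub>PSL2Z\<lparr>carrier := T\<rparr>\<^esub> S) = matrix_group.coset (\<Union>S) ` (\<Union>T)"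
    proof (intro equalityI subsetI)
      fix x assume "x \<in> Union ` (rcosets\<^bsub>PSL2Z\<lparr>carrier := T\<rparr>\<^esub> S)"
      then obtain g where g: "g \<in> T" "x = \<Union>(S #>\<^bsub>PSL2Z\<^esub> g)" unfolding rc by blast
      then obtain A where "A \<in> SL2" "g = psl_class A" using T by (auto simp: carrier_PSL2Z_eq)
      then show "x \<in> matrix_group.coset (\<Union>S) ` (\<Union>T)" using g Union_r_coset[OF S] psl_class_self by blast
    next
      fix x assume "x \<in> matrix_group.coset (\<Union>S) ` (\<Union>T)"
      then obtain A where A: "A \<in> \<Union>T" "x = matrix_group.coset (\<Union>S) A" by blast
      then have "psl_class A \<in> T" using Union_psl_iff[OF T] by blast
      then show "x \<in> Union ` (rcosets\<^bsub>PSL2Z\<lparr>carrier := T\<rparr>\<^esub> S)"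
        unfolding rc A(2) Union_r_coset[OF S, symmetric] by blast
    qed
  qed
qed

lemma Union_carrier_PSL2Z: "\<Union>(carrier PSL2Z) = SL2"
  using Union_psl_iff[of "carrier PSL2Z"] by (auto simp: carrier_PSL2Z_eq)

lemma psl_act_mobius:
  assumes "A \<in> SL2" "\<omega> \<notin> \<rat>" shows "psl_act (psl_class A) (Some \<omega>) = Some (mobius A \<omega>)"
proof -
  have "psl_act (psl_class A) (Some \<omega>) = homography A (Some \<omega>)"
    by (rule psl_act_eq_homography) (use assms in \<open>auto simp: carrier_PSL2Z_eq\<close>)
  then show ?thesis using mobius_denominator[OF assms] by (simp add: mobius_def)
qed

section \<open>Fixed points, conjugates and eigenforms of a matrix\<close>

lemma mobius_fixed_quadratic:
  assumes "N \<in> SL2" "\<beta> \<notin> \<rat>" "mobius N \<beta> = \<beta>"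
  shows "of_int (N$2$1) * \<beta>\<^sup>2 + of_int (N$2$2 - N$1$1) * \<beta> - of_int (N$1$2) = 0"
proof -
  have "of_int (N$1$1) * \<beta> + of_int (N$1$2) = \<beta> * (of_int (N$2$1) * \<beta> + of_int (N$2$2))"
    using assms(3) mobius_denominator[OF assms(1,2)] by (simp add: mobius_def divide_eq_eq)
  then show ?thesis by (simp add: power2_eq_square algebra_simps)
qed

lemma mobius_fixed_lower_left:
  assumes N: "N \<in> SL2" "\<beta> \<notin> \<rat>" "mobius N \<beta> = \<beta>" and ne: "N \<noteq> mat 1" "N \<noteq> - mat 1"
  shows "N$2$1 \<noteq> 0"
proof
  assume z: "N$2$1 = 0"
  then have "of_int (N$2$2 - N$1$1) * \<beta> + of_int (- N$1$2) = 0"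
    using mobius_fixed_quadratic[OF N] by simp
  from irrational_linear_eq_0[OF N(2) this] have e: "N$2$2 = N$1$1" "N$1$2 = 0" by auto
  then have "N$1$1 * N$1$1 = 1" using N(1) z by (simp add: SL2_iff)
  then have "N$1$1 = 1 \<or> N$1$1 = - 1" by (auto simp: zmult_eq_1_iff)
  then show False using ne z e by (auto simp: mat2_eq_iff)
qed

lemma galois_conj_fixed:
  assumes N: "N \<in> SL2" "\<beta> \<notin> \<rat>" "mobius N \<beta> = \<beta>" and c: "N$2$1 \<noteq> 0"
  shows "galois_conj \<beta> = of_int (N$1$1 - N$2$2) / of_int (N$2$1) - \<beta>"
proof -
  have "galois_conj \<beta> = - of_rat (of_int (N$2$2 - N$1$1) / of_int (N$2$1)) - \<beta>"
  proof (rule galois_conj_eq[OF N(2)])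
    show "of_rat (of_int (N$2$1)) * \<beta>\<^sup>2 + of_rat (of_int (N$2$2 - N$1$1)) * \<beta> + of_rat (- of_int (N$1$2)) = 0"
      using mobius_fixed_quadratic[OF N] by (simp add: of_rat_minus of_rat_diff)
  qed (use c in simp)
  then show ?thesis by (simp add: of_rat_divide of_rat_diff minus_divide_left)
qed

text \<open>Both fixed points are roots of the same integral quadratic equation, so their sum is the
  rational number that determines the conjugate.\<close>

lemma galois_conj_fixed_pair:
  assumes N: "N \<in> SL2" and b: "\<beta> \<notin> \<rat>" "mobius N \<beta> = \<beta>" and b': "\<beta>' \<notin> \<rat>" "mobius N \<beta>' = \<beta>'"
    and ne: "N \<noteq> mat 1" "N \<noteq> - mat 1" "\<beta> \<noteq> \<beta>'"
  shows "galois_conj \<beta> = \<beta>'"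
proof -
  have c: "N$2$1 \<noteq> 0" by (rule mobius_fixed_lower_left[OF N b ne(1,2)])
  have "(\<beta> - \<beta>') * (of_int (N$2$1) * (\<beta> + \<beta>') + of_int (N$2$2 - N$1$1)) = 0"
    using mobius_fixed_quadratic[OF N b] mobius_fixed_quadratic[OF N b'] by algebra
  then have "of_int (N$2$1) * (\<beta> + \<beta>') = of_int (N$1$1 - N$2$2)" using ne by simp
  then have "\<beta> + \<beta>' = of_int (N$1$1 - N$2$2) / of_int (N$2$1)" using c by (simp add: field_simps)
  then show ?thesis unfolding galois_conj_fixed[OF N b c] by linarith
qed

lemma vieta:
  fixes c u b x y :: real
  assumes "c * x\<^sup>2 + u * x - b = 0" "c * (x + y) = - u"
  shows "c * y\<^sup>2 + u * y - b = 0 \<and> c * (x * y) = - b"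
proof -
  have u: "u = - (c * (x + y))" using assms by simp
  show ?thesis using assms(1) unfolding u by (simp add: power2_eq_square algebra_simps)
qed

text \<open>The coefficient rows \<open>(1, - \<alpha>)\<close> and \<open>(1, - \<alpha>')\<close>
  are left eigenvectors of \<open>A\<close>, with eigenvalues \<open>x\<close> and
  \<open>y\<close>.\<close>

definition eigen_pair :: "real \<Rightarrow> real \<Rightarrow> mat2 \<Rightarrow> real \<Rightarrow> real \<Rightarrow> bool" where
  "eigen_pair \<alpha> \<alpha>' A x y \<longleftrightarrow> (\<forall>v. linear_form 1 (- \<alpha>) (act2 A v) = x * linear_form 1 (- \<alpha>) v \<and>
    linear_form 1 (- \<alpha>') (act2 A v) = y * linear_form 1 (- \<alpha>') v)"

lemma eigen_pair_one: "eigen_pair \<alpha> \<alpha>' (mat 1) 1 1"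
  by (simp add: eigen_pair_def)

lemma eigen_pair_mult:
  assumes "eigen_pair \<alpha> \<alpha>' A x y" "eigen_pair \<alpha> \<alpha>' B x' y'"
  shows "eigen_pair \<alpha> \<alpha>' (A ** B) (x * x') (y * y')"
  unfolding eigen_pair_def
proof
  fix v
  show "linear_form 1 (- \<alpha>) (act2 (A ** B) v) = x * x' * linear_form 1 (- \<alpha>) v \<and>
    linear_form 1 (- \<alpha>') (act2 (A ** B) v) = y * y' * linear_form 1 (- \<alpha>') v"
    using assms(1)[unfolded eigen_pair_def, rule_format, of "act2 B v"] assms(2)[unfolded eigen_pair_def, rule_format, of v]
    by (simp add: act2_mult)
qed

lemma eigen_pair_uminus:
  assumes "eigen_pair \<alpha> \<alpha>' A x y" shows "eigen_pair \<alpha> \<alpha>' (- A) (- x) (- y)"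
  unfolding eigen_pair_def
proof
  fix v
  have "linear_form 1 c (- w) = - linear_form 1 c w" for c w by (simp add: linear_form_def)
  then show "linear_form 1 (- \<alpha>) (act2 (- A) v) = - x * linear_form 1 (- \<alpha>) v \<and>
    linear_form 1 (- \<alpha>') (act2 (- A) v) = - y * linear_form 1 (- \<alpha>') v"
    using assms[unfolded eigen_pair_def, rule_format, of v] by (simp add: act2_uminus)
qed

lemma eigen_pair_adj2:
  assumes "A \<in> SL2" "eigen_pair \<alpha> \<alpha>' A x y" "x \<noteq> 0" "y \<noteq> 0"
  shows "eigen_pair \<alpha> \<alpha>' (adj2 A) (1 / x) (1 / y)"
  unfolding eigen_pair_def
proof
  fix v
  show "linear_form 1 (- \<alpha>) (act2 (adj2 A) v) = 1 / x * linear_form 1 (- \<alpha>) v \<and>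
    linear_form 1 (- \<alpha>') (act2 (adj2 A) v) = 1 / y * linear_form 1 (- \<alpha>') v"
    using assms(2)[unfolded eigen_pair_def, rule_format, of "act2 (adj2 A) v"] assms(1,3,4)
    by (simp add: act2_adj2)
qed

lemma eigen_pair_fixed:
  assumes N: "N \<in> SL2" and b: "\<alpha> \<notin> \<rat>" "mobius N \<alpha> = \<alpha>" and b': "\<alpha>' \<notin> \<rat>" "mobius N \<alpha>' = \<alpha>'"
  shows "eigen_pair \<alpha> \<alpha>' N (of_int (N$1$1) - of_int (N$2$1) * \<alpha>) (of_int (N$1$1) - of_int (N$2$1) * \<alpha>')"
proof -
  have e: "of_int (N$1$2) - \<beta> * of_int (N$2$2) = - \<beta> * (of_int (N$1$1) - of_int (N$2$1) * \<beta>)"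
    if "\<beta> \<notin> \<rat>" "mobius N \<beta> = \<beta>" for \<beta>
    using mobius_fixed_quadratic[OF N that] by (simp add: power2_eq_square algebra_simps)
  have "linear_form 1 (- \<beta>) (act2 N v) = (of_int (N$1$1) - of_int (N$2$1) * \<beta>) * linear_form 1 (- \<beta>) v"
    if \<beta>: "\<beta> \<notin> \<rat>" "mobius N \<beta> = \<beta>" for \<beta> v
  proof -
    have "linear_form 1 (- \<beta>) (act2 N v) = (of_int (N$1$1) - of_int (N$2$1) * \<beta>) * of_int (fst v) +
      (of_int (N$1$2) - \<beta> * of_int (N$2$2)) * of_int (snd v)"
      by (simp add: linear_form_def act2_def algebra_simps)
    then show ?thesis unfolding e[OF \<beta>] by (simp add: linear_form_def algebra_simps)
  qed
  then show ?thesis using b b' by (simp add: eigen_pair_def)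
qed

text \<open>It remains to supply the data of \<open>hyperbolic_pair\<close>: the second root is the
  other fixed point of \<open>M\<close>, \<open>L\<close> is the logarithm of the larger eigenvalue
  in absolute value, and \<open>Z\<close> is the preimage of the cyclic group. Orbits and indices
  are then carried over from matrices to classes.\<close>

theorem mainTheorem10:
  fixes \<alpha>\<^sub>0 :: real and G :: "mat2 set set" and \<gamma>\<^sub>0 :: "mat2 set" and M :: mat2
  assumes "quadratic_irrational \<alpha>\<^sub>0"
    and "subgroup G PSL2Z" and "finite (rcosets\<^bsub>PSL2Z\<^esub> G)"
    and "\<gamma>\<^sub>0 \<in> G" and "\<gamma>\<^sub>0 \<noteq> \<one>\<^bsub>PSL2Z\<^esub>" and "psl_act \<gamma>\<^sub>0 (Some \<alpha>\<^sub>0) = Some \<alpha>\<^sub>0"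
    and "M \<in> \<gamma>\<^sub>0"
  shows "(\<lambda>s. real (orbit_count G \<alpha>\<^sub>0 s)) \<sim>[at_top]
         (\<lambda>s. 12 * real (cusp_width G) *
                ln ((\<bar>real_of_int (trace M)\<bar> + sqrt ((real_of_int (trace M))\<^sup>2 - 4)) / 2) /
              (pi\<^sup>2 * real (subgroup_index PSL2Z G) *
                real (subgroup_index (PSL2Z\<lparr>carrier := pair_stabilizer G \<alpha>\<^sub>0\<rparr>)
                        (generate PSL2Z {\<gamma>\<^sub>0}))) * s)"
proof -
  interpret PSL: group PSL2Z by (rule group_PSL2Z)
  define H where "H = \<Union>G"
  define \<alpha>' where "\<alpha>' = galois_conj \<alpha>\<^sub>0"
  have subG: "G \<subseteq> carrier PSL2Z" by (rule subgroup.subset[OF assms(2)])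
  note H_iff = Union_psl_iff[OF subG, folded H_def]
  interpret H: matrix_group H unfolding H_def by (rule matrix_group_Union[OF assms(2)])
  have PSL_carrier: "PSL2Z\<lparr>carrier := carrier PSL2Z\<rparr> = PSL2Z" by simp
  have bijG: "bij_betw Union (rcosets\<^bsub>PSL2Z\<^esub> G) H.cosets"
    using bij_betw_rcosets_cosets[OF assms(2) order_refl, folded H_def]
    unfolding PSL_carrier Union_carrier_PSL2Z H.cosets_def .
  interpret H: finite_index_matrix_group H
    by standard (use bijG assms(3) bij_betw_finite in blast)
  have index: "subgroup_index PSL2Z G = card H.cosets"
    unfolding subgroup_index_def by (rule bij_betw_same_card[OF bijG])
  have width: "cusp_width G = H.width"
  proof -
    have "translation (int q) \<in> G \<longleftrightarrow> translation_mat (int q) \<in> H" for q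
      by (simp add: H_iff psl_class_translation)
    then show ?thesis by (simp add: cusp_width_def H.width_def)
  qed
  have irr: "\<alpha>\<^sub>0 \<notin> \<rat>" using assms(1) by (simp add: quadratic_irrational_def)
  have MH: "M \<in> H" using assms(4,7) by (auto simp: H_def)
  then have M: "M \<in> SL2" by (rule H.mem_SL2)
  have \<gamma>: "\<gamma>\<^sub>0 = psl_class M"
  proof -
    obtain A where "\<gamma>\<^sub>0 = psl_class A" using assms(4) subG by (auto simp: carrier_PSL2Z_eq)
    then show ?thesis using psl_class_eq assms(7) by simp
  qed
  have M_ne: "M \<noteq> mat 1" "M \<noteq> - mat 1"
    using assms(5) unfolding \<gamma> psl_class_one by (auto simp: psl_class_def)
  have M_fix: "mobius M \<alpha>\<^sub>0 = \<alpha>\<^sub>0" using assms(6) psl_act_mobius[OF M irr] by (simp add: \<gamma>)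
  have c: "M$2$1 \<noteq> 0" by (rule mobius_fixed_lower_left[OF M irr M_fix M_ne])
  have \<alpha>': "\<alpha>' = of_int (M$1$1 - M$2$2) / of_int (M$2$1) - \<alpha>\<^sub>0"
    unfolding \<alpha>'_def by (rule galois_conj_fixed[OF M irr M_fix c])
  have irr': "\<alpha>' \<notin> \<rat>"
  proof
    assume "\<alpha>' \<in> \<rat>"
    moreover have "\<alpha>\<^sub>0 = of_int (M$1$1 - M$2$2) / of_int (M$2$1) - \<alpha>'" using \<alpha>' by simp
    ultimately show False using irr by (metis Rats_diff Rats_divide Rats_of_int)
  qed
  have distinct: "\<alpha>\<^sub>0 \<noteq> \<alpha>'"
  proof
    assume "\<alpha>\<^sub>0 = \<alpha>'"
    then have "\<alpha>\<^sub>0 = (of_int (M$1$1 - M$2$2) / of_int (M$2$1)) / 2" using \<alpha>' by simp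
    also have "\<dots> \<in> \<rat>" by (intro Rats_divide Rats_of_int Rats_number_of)
    finally show False using irr by blast
  qed
  have sum: "of_int (M$2$1) * (\<alpha>\<^sub>0 + \<alpha>') = of_int (M$1$1 - M$2$2)" using c by (simp add: \<alpha>')
  have M_fix': "mobius M \<alpha>' = \<alpha>'"
  proof -
    have "of_int (M$2$1) * \<alpha>'\<^sup>2 + of_int (M$2$2 - M$1$1) * \<alpha>' - of_int (M$1$2) = 0"
      by (rule conjunct1[OF vieta[OF mobius_fixed_quadratic[OF M irr M_fix]]]) (use sum in simp)
    then have "of_int (M$1$1) * \<alpha>' + of_int (M$1$2) = \<alpha>' * (of_int (M$2$1) * \<alpha>' + of_int (M$2$2))"
      by (simp add: power2_eq_square algebra_simps)
    then show ?thesis using mobius_denominator[OF M irr'] by (simp add: mobius_def divide_eq_eq)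
  qed
  \<comment> \<open>The eigenvalues of \<open>M\<close>, with sum the trace and product the
    determinant.\<close>
  define x where "x = of_int (M$1$1) - of_int (M$2$1) * \<alpha>\<^sub>0"
  define y where "y = of_int (M$1$1) - of_int (M$2$1) * \<alpha>'"
  have eig: "eigen_pair \<alpha>\<^sub>0 \<alpha>' M x y" unfolding x_def y_def by (rule eigen_pair_fixed[OF M irr M_fix irr' M_fix'])
  have tr: "x + y = of_int (trace M)"
    using sum by (simp add: x_def y_def trace_def sum_2 algebra_simps)
  have xy: "x * y = 1"
  proof -
    have det: "of_int (M$1$1) * of_int (M$2$2) - of_int (M$1$2) * of_int (M$2$1) = (1::real)"
      using M unfolding SL2_iff by (simp flip: of_int_mult of_int_diff)
    have prod: "of_int (M$2$1) * (\<alpha>\<^sub>0 * \<alpha>') = - of_int (M$1$2)"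
      by (rule conjunct2[OF vieta[OF mobius_fixed_quadratic[OF M irr M_fix]]]) (use sum in simp)
    have "x * y = of_int (M$1$1) * of_int (M$1$1) - of_int (M$1$1) * (of_int (M$2$1) * (\<alpha>\<^sub>0 + \<alpha>')) +
        of_int (M$2$1) * (of_int (M$2$1) * (\<alpha>\<^sub>0 * \<alpha>'))"
      by (simp add: x_def y_def algebra_simps)
    also have "\<dots> = 1" unfolding sum prod using det by (simp add: algebra_simps)
    finally show ?thesis .
  qed
  \<comment> \<open>An eigenvalue 1 or -1 would make \<open>\<alpha>\<^sub>0\<close> rational,
    because the lower left entry of \<open>M\<close> is not zero; so \<open>M\<close> is
    hyperbolic.\<close>
  have x_ne: "\<bar>x\<bar> \<noteq> 1"
  proof
    assume "\<bar>x\<bar> = 1"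
    then have "x = 1 \<or> x = - 1" by auto
    then have "of_int (M$2$1) * \<alpha>\<^sub>0 + of_int (1 - M$1$1) = 0 \<or> of_int (M$2$1) * \<alpha>\<^sub>0 + of_int (- 1 - M$1$1) = 0"
      by (auto simp: x_def)
    then show False using irrational_linear_eq_0[OF irr] c by blast
  qed
  define \<sigma> where "\<sigma> = sgn x"
  have x0: "x \<noteq> 0" "y \<noteq> 0" using xy by auto
  have \<sigma>: "\<sigma> \<in> {1, -1}" "\<sigma> * \<sigma> = 1" using x0 by (auto simp: \<sigma>_def sgn_if)
  define L where "L = \<bar>ln \<bar>x\<bar>\<bar>"
  have L: "0 < L" using x_ne x0 by (simp add: L_def ln_eq_zero_iff)
  \<comment> \<open>The form that belongs to \<open>\<alpha>\<^sub>0\<close> may be expanded or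
    contracted by \<open>M\<close>; \<open>j\<close> records which.\<close>
  obtain j :: int where j: "\<bar>j\<bar> = 1" "\<bar>x\<bar> = exp (of_int j * L)"
  proof (cases "0 \<le> ln \<bar>x\<bar>")
    case True
    then show ?thesis using that[of 1] x0 by (simp add: L_def)
  next
    case False
    then show ?thesis using that[of "-1"] x0 by (simp add: L_def)
  qed
  have xj: "x = \<sigma> * exp (of_int j * L)" unfolding j(2)[symmetric] \<sigma>_def by (simp add: sgn_mult_abs)
  have yj: "y = \<sigma> * exp (- (of_int j * L))"
  proof -
    have "x * (\<sigma> * exp (- (of_int j * L))) = (\<sigma> * \<sigma>) * (exp (of_int j * L) * exp (- (of_int j * L)))" by (simp add: xj mult_ac)
    also have "\<dots> = x * y" using \<sigma> xy by (simp flip: exp_add)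
    finally show ?thesis using x0 by simp
  qed
  \<comment> \<open>The absolute trace is \<open>2 * cosh L\<close> and the square root is
    \<open>2 * sinh L\<close>, so the argument of the logarithm is \<open>exp L\<close>.\<close>
  have log: "ln ((\<bar>real_of_int (trace M)\<bar> + sqrt ((real_of_int (trace M))\<^sup>2 - 4)) / 2) = L"
  proof -
    have "real_of_int (trace M) = \<sigma> * (exp (of_int j * L) + exp (- (of_int j * L)))"
      unfolding tr[symmetric] xj yj by (simp add: algebra_simps)
    also have "exp (of_int j * L) + exp (- (of_int j * L)) = exp L + exp (- L)"
    proof -
      have "j = 1 \<or> j = - 1" using j(1) by linarith
      then show ?thesis by auto
    qed
    finally have t: "real_of_int (trace M) = \<sigma> * (exp L + exp (- L))" .
    have abs: "\<bar>real_of_int (trace M)\<bar> = exp L + exp (- L)" using \<sigma>(1) unfolding t by (auto simp: abs_mult add_pos_pos)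
    have "(real_of_int (trace M))\<^sup>2 - 4 = (exp L + exp (- L))\<^sup>2 - 4" using abs by (metis power2_abs)
    also have "\<dots> = (exp L - exp (- L))\<^sup>2" by (simp add: power2_eq_square algebra_simps flip: exp_add)
    finally have "sqrt ((real_of_int (trace M))\<^sup>2 - 4) = \<bar>exp L - exp (- L)\<bar>" by simp
    also have "\<dots> = exp L - exp (- L)" using L by simp
    finally show ?thesis unfolding abs by simp
  qed
  define Z where "Z = \<Union>(generate PSL2Z {\<gamma>\<^sub>0})"
  have \<gamma>_carrier: "{\<gamma>\<^sub>0} \<subseteq> carrier PSL2Z" using assms(4) subG by blast
  have gen: "subgroup (generate PSL2Z {\<gamma>\<^sub>0}) PSL2Z" by (rule PSL.generate_is_subgroup[OF \<gamma>_carrier])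
  interpret Z: matrix_group Z unfolding Z_def by (rule matrix_group_Union[OF gen])
  have gen_G: "generate PSL2Z {\<gamma>\<^sub>0} \<subseteq> G"
    by (rule PSL.generate_subgroup_incl) (use assms(2,4) in auto)
  have Z_sub: "Z \<subseteq> H" using gen_G by (auto simp: Z_def H_def)
  have MZ: "M \<in> Z" using generate.incl[of \<gamma>\<^sub>0 "{\<gamma>\<^sub>0}" PSL2Z] assms(7) by (auto simp: Z_def)
  define hyp where "hyp A \<longleftrightarrow> A \<in> SL2 \<and> (\<exists>k::int. \<exists>\<sigma>\<in>{1, -1}. eigen_pair \<alpha>\<^sub>0 \<alpha>' A (\<sigma> * exp (of_int k * L)) (\<sigma> * exp (- (of_int k * L))))" for A
  have hypI: "hyp A" if "A \<in> SL2" "eigen_pair \<alpha>\<^sub>0 \<alpha>' A (s * exp (of_int k * L)) (s * exp (- (of_int k * L)))" "s \<in> {1, -1}" for A s and k :: int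
    using that unfolding hyp_def by blast
  have hyp_uminus: "hyp (- A)" if "hyp A" for A
  proof -
    from that obtain k :: int and s where h: "A \<in> SL2" "s \<in> {1, -1}" "eigen_pair \<alpha>\<^sub>0 \<alpha>' A (s * exp (of_int k * L)) (s * exp (- (of_int k * L)))"
      unfolding hyp_def by blast
    from eigen_pair_uminus[OF h(3)] show ?thesis using h by (intro hypI[of "- A" "- s" k]) auto
  qed
  have hyp_mult: "hyp (A ** B)" if "hyp A" "hyp B" for A B
  proof -
    from that(1) obtain k :: int and s where h: "A \<in> SL2" "s \<in> {1, -1}" "eigen_pair \<alpha>\<^sub>0 \<alpha>' A (s * exp (of_int k * L)) (s * exp (- (of_int k * L)))"
      unfolding hyp_def by blast
    from that(2) obtain l :: int and t where h': "B \<in> SL2" "t \<in> {1, -1}" "eigen_pair \<alpha>\<^sub>0 \<alpha>' B (t * exp (of_int l * L)) (t * exp (- (of_int l * L)))"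
      unfolding hyp_def by blast
    have e: "s * exp (of_int k * L) * (t * exp (of_int l * L)) = s * t * exp (of_int (k + l) * L)"
      "s * exp (- (of_int k * L)) * (t * exp (- (of_int l * L))) = s * t * exp (- (of_int (k + l) * L))"
      by (simp_all add: distrib_right exp_add exp_diff exp_minus field_simps)
    from eigen_pair_mult[OF h(3) h'(3)] show ?thesis
      unfolding e using h h' by (intro hypI[of "A ** B" "s * t" "k + l"]) auto
  qed
  have hyp_adj: "hyp (adj2 A)" if "hyp A" for A
  proof -
    from that obtain k :: int and s where h: "A \<in> SL2" "s \<in> {1, -1}" "eigen_pair \<alpha>\<^sub>0 \<alpha>' A (s * exp (of_int k * L)) (s * exp (- (of_int k * L)))"
      unfolding hyp_def by blast
    have e: "1 / (s * exp (of_int k * L)) = s * exp (of_int (- k) * L)" "1 / (s * exp (- (of_int k * L))) = s * exp (- (of_int (- k) * L))"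
      using h(2) by (auto simp: exp_minus divide_inverse)
    from eigen_pair_adj2[OF h(1,3)] have "eigen_pair \<alpha>\<^sub>0 \<alpha>' (adj2 A) (s * exp (of_int (- k) * L)) (s * exp (- (of_int (- k) * L)))"
      unfolding e using h(2) by auto
    then show ?thesis using h by (intro hypI[of "adj2 A" s "- k"]) auto
  qed
  have hypM: "hyp M" using eig M \<sigma>(1) unfolding xj yj by (intro hypI)
  have hyp_one: "hyp (mat 1)" using eigen_pair_one by (intro hypI[of _ 1 0]) auto
  have hypZ: "\<exists>B\<in>SL2. g = psl_class B \<and> hyp B" if "g \<in> generate PSL2Z {\<gamma>\<^sub>0}" for g
    using that
  proof (induction rule: generate.induct)
    case one
    then show ?case using hyp_one psl_class_one by auto
  next
    case (incl h)
    then show ?case using hypM M \<gamma> by auto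
  next
    case (inv h)
    then show ?case using hyp_adj[OF hypM] M \<gamma> psl_class_inv[OF M] by (intro bexI[of _ "adj2 M"]) auto
  next
    case (eng g h)
    then obtain A B where "A \<in> SL2" "g = psl_class A" "hyp A" "B \<in> SL2" "h = psl_class B" "hyp B" by blast
    then show ?case using hyp_mult by (intro bexI[of _ "A ** B"]) (auto simp: psl_class_mult)
  qed
  have ZhypI: "hyp A" if "A \<in> Z" for A
  proof -
    from that obtain g where "g \<in> generate PSL2Z {\<gamma>\<^sub>0}" "A \<in> g" by (auto simp: Z_def)
    then obtain B where "g = psl_class B" "hyp B" using hypZ by blast
    then show ?thesis using \<open>A \<in> g\<close> hyp_uminus by (auto simp: psl_class_def)
  qed
  obtain K where K: "K \<in> Z" "eigen_pair \<alpha>\<^sub>0 \<alpha>' K (exp L) (exp (- L))"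
  proof -
    \<comment> \<open>The sign makes the eigenvalues positive; if the first one is less than one,
      the inverse is taken instead.\<close>
    define N where "N = (if \<sigma> = 1 then M else - M)"
    have N: "N \<in> Z" "eigen_pair \<alpha>\<^sub>0 \<alpha>' N (exp (of_int j * L)) (exp (- (of_int j * L)))"
      using \<sigma>(1) MZ Z.uminus_mem eig eigen_pair_uminus[OF eig] by (auto simp: N_def xj yj)
    show ?thesis
    proof (cases "j = 1")
      case True
      then show ?thesis using that[of N] N by simp
    next
      case False
      then have "j = - 1" using j(1) by linarith
      then show ?thesis using that[of "adj2 N"] N Z.adj_mem eigen_pair_adj2[OF Z.mem_SL2[OF N(1)] N(2)]
        by (simp add: exp_minus divide_inverse)
    qed
  qed
  have Zpow: "\<exists>A\<in>Z. eigen_pair \<alpha>\<^sub>0 \<alpha>' A (exp (of_int k * L)) (exp (- (of_int k * L)))" for k :: int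
  proof (induction k rule: int_induct[of _ 0])
    case base
    show ?case using Z.one_mem eigen_pair_one by auto
  next
    case (step1 i)
    then obtain A where A: "A \<in> Z" "eigen_pair \<alpha>\<^sub>0 \<alpha>' A (exp (of_int i * L)) (exp (- (of_int i * L)))" by blast
    have "exp (of_int i * L) * exp L = exp (of_int (i + 1) * L)" "exp (- (of_int i * L)) * exp (- L) = exp (- (of_int (i + 1) * L))"
      by (simp_all add: algebra_simps flip: exp_add)
    then show ?case using eigen_pair_mult[OF A(2) K(2)] Z.mult_mem[OF A(1) K(1)] by auto
  next
    case (step2 i)
    then obtain A where A: "A \<in> Z" "eigen_pair \<alpha>\<^sub>0 \<alpha>' A (exp (of_int i * L)) (exp (- (of_int i * L)))" by blast
    have K': "eigen_pair \<alpha>\<^sub>0 \<alpha>' (adj2 K) (exp (- L)) (exp L)"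
      using eigen_pair_adj2[OF Z.mem_SL2[OF K(1)] K(2)] by (simp add: exp_minus divide_inverse)
    have "exp (of_int i * L) * exp (- L) = exp (of_int (i - 1) * L)" "exp (- (of_int i * L)) * exp L = exp (- (of_int (i - 1) * L))"
      by (simp_all add: algebra_simps flip: exp_add)
    then show ?case using eigen_pair_mult[OF A(2) K'] Z.mult_mem[OF A(1) Z.adj_mem[OF K(1)]] by auto
  qed
  \<comment> \<open>The conjugate of \<open>M\<close> by \<open>A\<close> fixes both images and is
    not plus or minus the identity, so \<open>galois_conj_fixed_pair\<close> applies to the
    images.\<close>
  have conj_gen: "galois_conj (mobius A \<beta>) = mobius A \<beta>'"
    if A: "A \<in> SL2" and \<beta>: "\<beta> \<notin> \<rat>" "mobius M \<beta> = \<beta>" and \<beta>': "\<beta>' \<notin> \<rat>" "mobius M \<beta>' = \<beta>'" and ne: "\<beta> \<noteq> \<beta>'" for A \<beta> \<beta>'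
  proof (rule galois_conj_fixed_pair)
    let ?N = "A ** (M ** adj2 A)"
    show "?N \<in> SL2" using A M by auto
    show "mobius A \<beta> \<notin> \<rat>" "mobius A \<beta>' \<notin> \<rat>" using A \<beta> \<beta>' mobius_irrational by blast+
    have fix_N: "mobius ?N (mobius A \<omega>) = mobius A \<omega>" if "\<omega> \<notin> \<rat>" "mobius M \<omega> = \<omega>" for \<omega>
      using that A M by (simp add: mobius_mult mobius_irrational mobius_adj2)
    show "mobius ?N (mobius A \<beta>) = mobius A \<beta>" "mobius ?N (mobius A \<beta>') = mobius A \<beta>'" using fix_N \<beta> \<beta>' by auto
    have conj_back: "M = adj2 A ** (?N ** A)" using adj2_cancel[OF A] by (simp add: matrix_mul_assoc[symmetric] adj2_inverse[OF A])
    show "?N \<noteq> mat 1" using conj_back M_ne adj2_inverse[OF A] by auto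
    show "?N \<noteq> - mat 1" using conj_back M_ne adj2_inverse[OF A] by (auto simp: uminus_mult)
    show "mobius A \<beta> \<noteq> mobius A \<beta>'" using ne mobius_adj2(1)[OF A \<beta>(1)] mobius_adj2(1)[OF A \<beta>'(1)] by metis
  qed
  interpret hyperbolic_pair H \<alpha>\<^sub>0 \<alpha>' L Z
  proof
    show "\<exists>k::int. \<exists>\<sigma>\<in>{1, -1}. \<forall>v.
      linear_form 1 (- \<alpha>\<^sub>0) (act2 A v) = \<sigma> * exp (of_int k * L) * linear_form 1 (- \<alpha>\<^sub>0) v \<and>
      linear_form 1 (- \<alpha>') (act2 A v) = \<sigma> * exp (- (of_int k * L)) * linear_form 1 (- \<alpha>') v" if "A \<in> Z" for A
      using ZhypI[OF that] unfolding hyp_def eigen_pair_def by blast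
    show "\<exists>A\<in>Z. \<forall>v.
      linear_form 1 (- \<alpha>\<^sub>0) (act2 A v) = exp (of_int k * L) * linear_form 1 (- \<alpha>\<^sub>0) v \<and>
      linear_form 1 (- \<alpha>') (act2 A v) = exp (- (of_int k * L)) * linear_form 1 (- \<alpha>') v" for k :: int
      using Zpow[of k] unfolding eigen_pair_def .
    show "galois_conj (mobius A \<alpha>\<^sub>0) = mobius A \<alpha>'" "galois_conj (mobius A \<alpha>') = mobius A \<alpha>\<^sub>0" if "A \<in> SL2" for A
      using conj_gen[OF that] irr irr' M_fix M_fix' distinct by auto
  qed (use irr irr' distinct L Z_sub Z.matrix_group_axioms in auto)
  have act: "psl_act g (Some \<omega>) = Some (mobius A \<omega>)" if h: "g \<in> carrier PSL2Z" "A \<in> g" "\<omega> \<in> {\<alpha>\<^sub>0, \<alpha>'}" for g A \<omega>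
  proof -
    obtain B where "B \<in> SL2" "g = psl_class B" using h(1) by (auto simp: carrier_PSL2Z_eq)
    with h(2) have A: "g = psl_class A" "A \<in> SL2" using psl_class_eq[of A B] by (auto simp: psl_class_def)
    show ?thesis unfolding A(1) by (rule psl_act_mobius[OF A(2) pair_irrational[OF h(3)]])
  qed
  have orbit: "pair_orbit G \<alpha>\<^sub>0 = {\<beta>. \<exists>A\<in>H. \<exists>\<omega>\<in>{\<alpha>\<^sub>0, \<alpha>'}. \<beta> = mobius A \<omega>}"
  proof (intro equalityI subsetI)
    fix \<beta> assume "\<beta> \<in> pair_orbit G \<alpha>\<^sub>0"
    then obtain \<omega> g where g: "\<omega> \<in> {\<alpha>\<^sub>0, \<alpha>'}" "g \<in> G" "Some \<beta> = psl_act g (Some \<omega>)"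
      by (auto simp: pair_orbit_def orbit_def \<alpha>'_def)
    then obtain A where A: "A \<in> SL2" "g = psl_class A" using subG by (auto simp: carrier_PSL2Z_eq)
    have "A \<in> H" using g A by (simp add: H_iff)
    moreover have "\<beta> = mobius A \<omega>" using act[of g A \<omega>] g A subG by (auto simp: psl_class_def)
    ultimately show "\<beta> \<in> {\<beta>. \<exists>A\<in>H. \<exists>\<omega>\<in>{\<alpha>\<^sub>0, \<alpha>'}. \<beta> = mobius A \<omega>}" using g by blast
  next
    fix \<beta> assume "\<beta> \<in> {\<beta>. \<exists>A\<in>H. \<exists>\<omega>\<in>{\<alpha>\<^sub>0, \<alpha>'}. \<beta> = mobius A \<omega>}"
    then obtain A \<omega> where A: "A \<in> H" "\<omega> \<in> {\<alpha>\<^sub>0, \<alpha>'}" "\<beta> = mobius A \<omega>" by blast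
    then have g: "psl_class A \<in> G" by (simp add: H_iff)
    moreover have "psl_act (psl_class A) (Some \<omega>) = Some \<beta>" using act[of "psl_class A" A \<omega>] A g subG by auto
    ultimately have "Some \<beta> \<in> orbit (PSL2Z\<lparr>carrier := G\<rparr>) psl_act (Some \<omega>)" unfolding orbit_def by force
    then show "\<beta> \<in> pair_orbit G \<alpha>\<^sub>0" using A(2) by (auto simp: pair_orbit_def \<alpha>'_def)
  qed
  have count: "orbit_count G \<alpha>\<^sub>0 s = card (orbit_points s // translation_rel H.width)" for s
    unfolding orbit_count_def orbit orbit_points_def width by simp
  have stab_sub: "pair_stabilizer G \<alpha>\<^sub>0 \<subseteq> carrier PSL2Z"
    using subG by (auto simp: pair_stabilizer_def stabilizer_def)
  have stab: "\<Union>(pair_stabilizer G \<alpha>\<^sub>0) = stabilizer_matrices"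
  proof -
    have "psl_act (psl_class A) ` {Some \<alpha>\<^sub>0, Some \<alpha>'} = {Some \<alpha>\<^sub>0, Some \<alpha>'} \<longleftrightarrow> mobius A ` {\<alpha>\<^sub>0, \<alpha>'} = {\<alpha>\<^sub>0, \<alpha>'}"
      if "A \<in> SL2" for A
      using psl_act_mobius[OF that irr] psl_act_mobius[OF that irr'] by (auto simp: doubleton_eq_iff)
    then have "A \<in> \<Union>(pair_stabilizer G \<alpha>\<^sub>0) \<longleftrightarrow> A \<in> stabilizer_matrices" for A
      unfolding Union_psl_iff[OF stab_sub] stabilizer_matrices_def
      by (auto simp: pair_stabilizer_def stabilizer_def \<alpha>'_def[symmetric] H_iff)
    then show ?thesis by blast
  qed
  have n0: "subgroup_index (PSL2Z\<lparr>carrier := pair_stabilizer G \<alpha>\<^sub>0\<rparr>) (generate PSL2Z {\<gamma>\<^sub>0}) = card (Z.coset ` stabilizer_matrices)"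
    unfolding subgroup_index_def using bij_betw_same_card[OF bij_betw_rcosets_cosets[OF gen stab_sub]] by (simp add: stab Z_def)
  define n where "n = card (Z.coset ` stabilizer_matrices)"
  define C where "C = 12 * real H.width * L / (pi\<^sup>2 * real (card H.cosets) * real n)"
  have n: "n \<noteq> 0" and lim: "((\<lambda>s. real (card (orbit_points s // translation_rel H.width)) / s) \<longlongrightarrow> C) at_top"
    using orbit_points_asymptotics unfolding n_def C_def by blast+
  have "H.cosets \<noteq> {}" using SL2_closed(1) by (auto simp: H.cosets_def)
  then have "0 < card H.cosets" using H.finite_cosets by (simp add: card_gt_0_iff)
  then have C: "C \<noteq> 0" using n L H.width(1) by (simp add: C_def)
  have "(\<lambda>s. real (orbit_count G \<alpha>\<^sub>0 s)) \<sim>[at_top] (\<lambda>s. C * s)"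
  proof (rule asymp_equivI')
    have "((\<lambda>s. real (card (orbit_points s // translation_rel H.width)) / s / C) \<longlongrightarrow> C / C) at_top"
      by (intro tendsto_divide lim tendsto_const C)
    then show "((\<lambda>s. real (orbit_count G \<alpha>\<^sub>0 s) / (C * s)) \<longlongrightarrow> 1) at_top" using C by (simp add: count mult.commute)
  qed
  then show ?thesis unfolding C_def width log index n0 n_def .
qed

end
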